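(* Let $K$ be a field of positive characteristic $p$ and $G$ a group such that the group algebra $KG$ is Lie nilpotent. Then $t_L(KG)=|G'|-p+2$ if and only if one of the following conditions holds: (i) $p=2$, $cl(G)=2$ and $\gamma_2(G)$ is noncyclic of order $4$; (ii) $p=2$, $cl(G)=4$, $\gamma_2(G)\cong C_4\times C_2$ and $\gamma_3(G)\cong C_2\times C_2$; (iii) $p=2$, $cl(G)=4$ and $\gamma_2(G)$ is elementary abelian of order $8$; (iv) $p=3$, $cl(G)=3$ and $\gamma_2(G)$ is elementary abelian of order $9$.
   Context: For an associative algebra $R$ with identity, $[x,y]=xy-yx$ and $[x_1,\ldots,x_n]=[[x_1,\ldots,x_{n-1}],x_n]$. The $n$-th lower Lie power $R^{[n]}$ is the associative ideal generated by all $[x_1,\ldots,x_n]$ with $x_i\in R$ ($R^{[1]}=R$). $R$ is Lie nilpotent if $R^{[m]}=0$ for some $m$, and the lower Lie nilpotency index $t_L(R)$ is the minimal such $m$. $G'=\gamma_2(G)$ is the commutator subgroup, $\gamma_i(G)$ the terms of the lower central series of $G$, $cl(G)$ the nilpotency class of $G$, and $C_n$ the cyclic group of order $n$. (It is known that for Lie nilpotent $KG$, $G'$ is a finite $p$-group and $t_L(KG)\le |G'|+1$.) *)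

theory Defs
  imports "HOL-Algebra.Algebra"
begin

definition ga_carrier :: "('g, 'b) monoid_scheme \<Rightarrow> ('g \<Rightarrow> 'k::field) set" where
  "ga_carrier G = {f. finite {x. f x \<noteq> 0} \<and> {x. f x \<noteq> 0} \<subseteq> carrier G}"

definition ga_mult :: "('g, 'b) monoid_scheme \<Rightarrow> ('g \<Rightarrow> 'k::field) \<Rightarrow> ('g \<Rightarrow> 'k) \<Rightarrow> ('g \<Rightarrow> 'k)" where
  "ga_mult G f h = (\<lambda>z. if z \<in> carrier G
      then (\<Sum>x\<in>{x. f x \<noteq> 0}. f x * h (inv\<^bsub>G\<^esub> x \<otimes>\<^bsub>G\<^esub> z)) else 0)"

definition ga_lie :: "('g, 'b) monoid_scheme \<Rightarrow> ('g \<Rightarrow> 'k::field) \<Rightarrow> ('g \<Rightarrow> 'k) \<Rightarrow> ('g \<Rightarrow> 'k)" where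
  "ga_lie G x y = (\<lambda>z. ga_mult G x y z - ga_mult G y x z)"

definition ga_lie_comms :: "('g, 'b) monoid_scheme \<Rightarrow> nat \<Rightarrow> ('g \<Rightarrow> 'k::field) set" where
  "ga_lie_comms G n = {foldl (ga_lie G) x xs | x xs.
      x \<in> ga_carrier G \<and> set xs \<subseteq> ga_carrier G \<and> length xs = n - 1}"

inductive_set ga_ideal :: "('g, 'b) monoid_scheme \<Rightarrow> ('g \<Rightarrow> 'k::field) set \<Rightarrow> ('g \<Rightarrow> 'k) set"
  for G S where
  gen: "s \<in> S \<Longrightarrow> s \<in> ga_ideal G S"
| zero: "(\<lambda>_. 0) \<in> ga_ideal G S"
| add: "a \<in> ga_ideal G S \<Longrightarrow> b \<in> ga_ideal G S \<Longrightarrow> (\<lambda>z. a z + b z) \<in> ga_ideal G S"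
| lmult: "a \<in> ga_ideal G S \<Longrightarrow> r \<in> ga_carrier G \<Longrightarrow> ga_mult G r a \<in> ga_ideal G S"
| rmult: "a \<in> ga_ideal G S \<Longrightarrow> r \<in> ga_carrier G \<Longrightarrow> ga_mult G a r \<in> ga_ideal G S"

definition lower_lie_power :: "('g, 'b) monoid_scheme \<Rightarrow> nat \<Rightarrow> ('g \<Rightarrow> 'k::field) set" where
  "lower_lie_power G n = ga_ideal G (ga_lie_comms G n)"

definition ga_lie_nilpotent :: "'k::field itself \<Rightarrow> ('g, 'b) monoid_scheme \<Rightarrow> bool" where
  "ga_lie_nilpotent TYPE('k) G \<longleftrightarrow> (\<exists>m\<ge>1. lower_lie_power G m = {(\<lambda>_. 0) :: 'g \<Rightarrow> 'k})"

definition t_L :: "'k::field itself \<Rightarrow> ('g, 'b) monoid_scheme \<Rightarrow> nat" where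
  "t_L TYPE('k) G = (LEAST m. 1 \<le> m \<and> lower_lie_power G m = {(\<lambda>_. 0) :: 'g \<Rightarrow> 'k})"

text \<open>gamma_1(G) = G, gamma_{i+1}(G) = [gamma_i(G), G]; index 0 also gives G (unused).\<close>

fun lcs :: "('g, 'b) monoid_scheme \<Rightarrow> nat \<Rightarrow> 'g set" where
  "lcs G 0 = carrier G"
| "lcs G (Suc 0) = carrier G"
| "lcs G (Suc (Suc n)) = generate G
     (\<Union>h1 \<in> lcs G (Suc n). \<Union>h2 \<in> carrier G.
        {h1 \<otimes>\<^bsub>G\<^esub> h2 \<otimes>\<^bsub>G\<^esub> inv\<^bsub>G\<^esub> h1 \<otimes>\<^bsub>G\<^esub> inv\<^bsub>G\<^esub> h2})"

definition nilpotency_class :: "('g, 'b) monoid_scheme \<Rightarrow> nat" where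
  "nilpotency_class G = (LEAST c. lcs G (Suc c) = {\<one>\<^bsub>G\<^esub>})"

definition elementary_abelian :: "('g, 'b) monoid_scheme \<Rightarrow> nat \<Rightarrow> bool" where
  "elementary_abelian H p \<longleftrightarrow> comm_group H \<and> (\<forall>x \<in> carrier H. x [^]\<^bsub>H\<^esub> p = \<one>\<^bsub>H\<^esub>)"

end

theory Submission
  imports Defs "HOL-Number_Theory.Cong"
begin

text \<open>By multilinearity only Lie commutators of group elements matter. With \<open>ad h\<close>
  the map sending \<open>f\<close> to \<open>f h - h f\<close>, the Lie power of index \<open>k + 1\<close> vanishes iff all \<open>k\<close>-fold products of such
  maps kill \<open>K G\<close>, so no ring structure on \<open>K G\<close> is needed. Let \<open>N = G'\<close> be finite; it is a \<open>p\<close>-group,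
  since \<open>p\<close>-power powers of elements of \<open>G\<close> are central.

  Upper bounds: if \<open>z \<in> N\<close> is central of order \<open>p\<close> and \<open>k\<close> steps suffice for \<open>G/\<langle>z\<rangle>\<close>, then
  \<open>p k\<close> steps suffice for \<open>G\<close>. If \<open>|N| = p ^ n\<close> with \<open>N\<close> noncyclic, one can choose \<open>z\<close> with \<open>N/\<langle>z\<rangle>\<close>
  noncyclic as soon as \<open>n \<ge> 3\<close>, which by induction leaves only \<open>|N| = p ^ 2\<close> and \<open>|N| = 8\<close>. There
  the augmentation powers of \<open>K N\<close>, weighted by the lower central series, give the exact bound.

  Lower bounds: writing a commutator as \<open>u g\<close> with \<open>u \<in> K N\<close>, one has
  \<open>[u g, h] = (u (g,h) - h u h\<inverse>) h g\<close>. If \<open>N\<close> is cyclic, \<open>[a, b, ..., b]\<close> is nonzero as long as no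
  small power of \<open>b\<close> commutes with \<open>a\<close>, so the index is at least \<open>|N| + 1\<close>; in the
  exceptional cases explicit nonzero commutators are computed.\<close>

section \<open>Iterated commutators of group elements\<close>
hide_const (open) Divisibility.prime

text \<open>The list of exceptions comes from comparing a few numbers of steps with
  \<open>p^n - p + 1\<close>, the number that corresponds to the index \<open>|N| - p + 2\<close>.
  For noncyclic \<open>N\<close> of order \<open>p^2\<close> the weights give \<open>2 p - 1\<close>
  steps in class 2 and \<open>3 p - 2\<close> in class 3. The first is at most
  \<open>p^2 - p\<close> unless \<open>p = 2\<close>, the second unless \<open>p \<le> 3\<close>;
  for \<open>p = 2\<close> in class 3 three steps do not suffice, which is one too many again, so
  class 2 with \<open>p = 2\<close> and class 3 with \<open>p = 3\<close> remain. For
  \<open>|N| = 8\<close> six steps suffice unless \<open>gamma_3\<close> has order 4 and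
  \<open>gamma_4\<close> order 2, where the number is 7. A central extension by a group of order
  \<open>p\<close> multiplies the number of steps by \<open>p\<close>, and
  \<open>p (p^m - p + 1) \<le> p^(m+1) - p\<close>, so larger orders give no further exceptions. The
  obstacle on the group side is that \<open>G\<close> may be infinite. The substitute for finiteness
  is that all \<open>p^s\<close>-th powers are central: this passes to quotients and makes the
  conjugation action on a finite normal subgroup that of a finite \<open>p\<close>-group.\<close>

definition delta :: "'g \<Rightarrow> 'g \<Rightarrow> 'k::field" where
  "delta g = (\<lambda>x. of_bool (x = g))"

text \<open>Convolution with a single group element is a translation of the argument, so both
  products can be written without sums. The value 0 outside the carrier is what membership in
  \<open>ga_carrier\<close> demands.\<close>

definition ad :: "('g, 'b) monoid_scheme \<Rightarrow> 'g \<Rightarrow> ('g \<Rightarrow> 'k::field) \<Rightarrow> 'g \<Rightarrow> 'k" where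
  "ad G h f = (\<lambda>x. if x \<in> carrier G
     then f (x \<otimes>\<^bsub>G\<^esub> inv\<^bsub>G\<^esub> h) - f (inv\<^bsub>G\<^esub> h \<otimes>\<^bsub>G\<^esub> x) else 0)"

definition ad_zero :: "('g, 'b) monoid_scheme \<Rightarrow> nat \<Rightarrow> ('g \<Rightarrow> 'k::field) \<Rightarrow> bool" where
  "ad_zero G k f \<longleftrightarrow>
     (\<forall>hs. set hs \<subseteq> carrier G \<longrightarrow> length hs = k \<longrightarrow> fold (ad G) hs f = (\<lambda>_. 0))"

definition lie_zero :: "'k::field itself \<Rightarrow> ('g, 'b) monoid_scheme \<Rightarrow> nat \<Rightarrow> bool" where
  "lie_zero TYPE('k) G k \<longleftrightarrow> (\<forall>g\<in>carrier G. ad_zero G k (delta g :: 'g \<Rightarrow> 'k))"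

lemma ad_sum: "ad G h (\<lambda>z. \<Sum>i\<in>I. c i * F i z) = (\<lambda>z. \<Sum>i\<in>I. c i * ad G h (F i) z)"
  by (auto simp: ad_def sum_subtractf right_diff_distrib)

lemma fold_ad_sum:
  "fold (ad G) hs (\<lambda>z. \<Sum>i\<in>I. c i * F i z) = (\<lambda>z. \<Sum>i\<in>I. c i * fold (ad G) hs (F i) z)"
  by (induction hs arbitrary: F) (simp_all add: ad_sum)

lemma ad_zero_sum:
  "(\<And>i. i \<in> I \<Longrightarrow> ad_zero G k (F i)) \<Longrightarrow> ad_zero G k (\<lambda>z. \<Sum>i\<in>I. c i * F i z)"
  unfolding ad_zero_def by (simp add: fold_ad_sum)

lemma ad_0 [simp]: "ad G h (\<lambda>_. 0) = (\<lambda>_. 0)"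
  by (auto simp: ad_def)

lemma fold_ad_0 [simp]: "fold (ad G) hs (\<lambda>_. 0) = (\<lambda>_. 0)"
  by (induction hs) auto

lemma ad_zero_Suc: "ad_zero G (Suc k) f \<longleftrightarrow> (\<forall>h\<in>carrier G. ad_zero G k (ad G h f))"
proof
  assume L: "ad_zero G (Suc k) f"
  show "\<forall>h\<in>carrier G. ad_zero G k (ad G h f)"
    unfolding ad_zero_def
  proof (intro ballI allI impI)
    fix h hs assume "h \<in> carrier G" "set hs \<subseteq> carrier G" "length hs = k"
    then show "fold (ad G) hs (ad G h f) = (\<lambda>_. 0)"
      using L[unfolded ad_zero_def, rule_format, of "h # hs"] by simp
  qed
next
  assume R: "\<forall>h\<in>carrier G. ad_zero G k (ad G h f)"
  show "ad_zero G (Suc k) f"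
    unfolding ad_zero_def
  proof (intro allI impI)
    fix hs assume "set hs \<subseteq> carrier G" "length hs = Suc k"
    then show "fold (ad G) hs f = (\<lambda>_. 0)"
      using R by (cases hs) (auto simp: ad_zero_def)
  qed
qed

lemma ad_zero_mono:
  assumes "ad_zero G k f" "k \<le> l"
  shows "ad_zero G l f"
  unfolding ad_zero_def
proof (intro allI impI)
  fix hs assume hs: "set hs \<subseteq> carrier G" "length hs = l"
  have "fold (ad G) (take k hs) f = (\<lambda>_. 0)"
    using assms hs set_take_subset[of k hs] unfolding ad_zero_def by (metis length_take min.absorb2 subset_trans)
  then show "fold (ad G) hs f = (\<lambda>_. 0)"
    by (subst append_take_drop_id[of k hs, symmetric], subst fold_append) simp
qed

lemma lie_zero_mono: "lie_zero TYPE('k::field) G k \<Longrightarrow> k \<le> l \<Longrightarrow> lie_zero TYPE('k) G l"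
  unfolding lie_zero_def using ad_zero_mono by blast

lemma fin_supp_eq_sum_delta:
  assumes "f \<in> ga_carrier G"
  shows "f = (\<lambda>z. \<Sum>g\<in>{g. f g \<noteq> 0}. f g * delta g z)"
proof
  fix z
  have "(\<Sum>g\<in>{g. f g \<noteq> 0}. f g * delta g z) = (\<Sum>g\<in>{g. f g \<noteq> 0}. if g = z then f g else 0)"
    by (intro sum.cong) (auto simp: delta_def)
  also have "\<dots> = f z"
    using assms by (subst sum.delta) (auto simp: ga_carrier_def)
  finally show "f z = (\<Sum>g\<in>{g. f g \<noteq> 0}. f g * delta g z)" by simp
qed

lemma lie_zero_imp_ad_zero:
  assumes "lie_zero TYPE('k) G k" "(f :: 'g \<Rightarrow> 'k::field) \<in> ga_carrier G"
  shows "ad_zero G k f"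
proof -
  have "ad_zero G k (\<lambda>z. \<Sum>g\<in>{g. f g \<noteq> 0}. f g * delta g z)"
    using assms by (intro ad_zero_sum) (auto simp: lie_zero_def ga_carrier_def)
  then show ?thesis
    using fin_supp_eq_sum_delta[OF assms(2)] by simp
qed

context group
begin

lemma inv_mult_cancel [simp]:
  assumes "x \<in> carrier G" "y \<in> carrier G"
  shows "inv x \<otimes> (x \<otimes> y) = y" "x \<otimes> (inv x \<otimes> y) = y"
  using assms by (simp_all add: m_assoc[symmetric])

lemmas word_simps = m_assoc inv_mult_group

lemma ad_in_ga_carrier:
  assumes "f \<in> ga_carrier G" "h \<in> carrier G"
  shows "ad G h f \<in> ga_carrier G"
proof -
  have "{x. ad G h f x \<noteq> 0} \<subseteq> (\<lambda>x. x \<otimes> h) ` {x. f x \<noteq> 0} \<union> (\<lambda>x. h \<otimes> x) ` {x. f x \<noteq> 0}"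
  proof
    fix x assume "x \<in> {x. ad G h f x \<noteq> 0}"
    then have x: "x \<in> carrier G" and "f (x \<otimes> inv h) \<noteq> 0 \<or> f (inv h \<otimes> x) \<noteq> 0"
      by (auto simp: ad_def split: if_splits)
    moreover have "x = (x \<otimes> inv h) \<otimes> h" "x = h \<otimes> (inv h \<otimes> x)"
      using x assms by (simp_all add: m_assoc)
    ultimately show "x \<in> (\<lambda>x. x \<otimes> h) ` {x. f x \<noteq> 0} \<union> (\<lambda>x. h \<otimes> x) ` {x. f x \<noteq> 0}"
      by blast
  qed
  moreover have "{x. ad G h f x \<noteq> 0} \<subseteq> carrier G"
    by (auto simp: ad_def)
  moreover have "finite ((\<lambda>x. x \<otimes> h) ` {x. f x \<noteq> 0} \<union> (\<lambda>x. h \<otimes> x) ` {x. f x \<noteq> 0})"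
    using assms by (auto simp: ga_carrier_def)
  ultimately show ?thesis
    unfolding ga_carrier_def using finite_subset by blast
qed

text \<open>Linearity in the second argument is hidden by \<open>ga_mult\<close>, which sums over
  the support of the left factor. For the product \<open>f y\<close> the sum is therefore reindexed
  by \<open>h = x^-1 z\<close>; for \<open>y f\<close> it already has the right form.\<close>

lemma ga_lie_eq_sum_ad:
  assumes f: "f \<in> ga_carrier G" and y: "y \<in> ga_carrier G"
  shows "ga_lie G f y = (\<lambda>z. \<Sum>h\<in>{h. y h \<noteq> 0}. y h * ad G h f z)"
proof
  fix z
  show "ga_lie G f y z = (\<Sum>h\<in>{h. y h \<noteq> 0}. y h * ad G h f z)"
  proof (cases "z \<in> carrier G")
    case False
    then show ?thesis by (simp add: ga_lie_def ga_mult_def ad_def)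
  next
    case z: True
    have fin: "finite {x. f x \<noteq> 0}" "finite {x. y x \<noteq> 0}"
      and sub: "{x. f x \<noteq> 0} \<subseteq> carrier G" "{x. y x \<noteq> 0} \<subseteq> carrier G"
      using f y by (auto simp: ga_carrier_def)
    let ?S = "{x \<in> carrier G. f x \<noteq> 0 \<and> y (inv x \<otimes> z) \<noteq> 0}"
    let ?T = "{h \<in> carrier G. y h \<noteq> 0 \<and> f (z \<otimes> inv h) \<noteq> 0}"
    have "ga_mult G f y z = (\<Sum>x\<in>?S. f x * y (inv x \<otimes> z))"
      unfolding ga_mult_def using z fin sub by (auto intro!: sum.mono_neutral_right)
    also have "\<dots> = (\<Sum>h\<in>?T. f (z \<otimes> inv h) * y h)"
    proof (rule sum.reindex_bij_witness[of _ "\<lambda>h. z \<otimes> inv h" "\<lambda>x. inv x \<otimes> z"])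
      fix x assume "x \<in> ?S"
      then have x: "x \<in> carrier G" "f x \<noteq> 0" "y (inv x \<otimes> z) \<noteq> 0" by auto
      show *: "z \<otimes> inv (inv x \<otimes> z) = x" using x z by (simp add: inv_mult_group m_assoc)
      show "inv x \<otimes> z \<in> ?T" using x z * by simp
      show "f (z \<otimes> inv (inv x \<otimes> z)) * y (inv x \<otimes> z) = f x * y (inv x \<otimes> z)" using * by simp
    next
      fix h assume "h \<in> ?T"
      then have h: "h \<in> carrier G" "y h \<noteq> 0" "f (z \<otimes> inv h) \<noteq> 0" by auto
      show *: "inv (z \<otimes> inv h) \<otimes> z = h" using h z by (simp add: inv_mult_group m_assoc)
      show "z \<otimes> inv h \<in> ?S" using h z * by simp
    qed
    also have "\<dots> = (\<Sum>h\<in>{h. y h \<noteq> 0}. f (z \<otimes> inv h) * y h)"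
      using fin sub by (intro sum.mono_neutral_left) auto
    finally have "ga_mult G f y z = (\<Sum>h\<in>{h. y h \<noteq> 0}. f (z \<otimes> inv h) * y h)" .
    then show ?thesis
      using z by (simp add: ga_lie_def ad_def ga_mult_def right_diff_distrib sum_subtractf mult.commute)
  qed
qed

lemma ga_lie_in_ga_carrier:
  assumes "f \<in> ga_carrier G" "y \<in> ga_carrier G"
  shows "ga_lie G f y \<in> ga_carrier G"
proof -
  have fin: "finite {h. y h \<noteq> 0}" "{h. y h \<noteq> 0} \<subseteq> carrier G"
    using assms by (auto simp: ga_carrier_def)
  have ad: "finite {x. ad G h f x \<noteq> 0}" "{x. ad G h f x \<noteq> 0} \<subseteq> carrier G" if "h \<in> carrier G" for h
    using ad_in_ga_carrier[OF assms(1) that] by (auto simp: ga_carrier_def)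
  have "{x. ga_lie G f y x \<noteq> 0} \<subseteq> (\<Union>h\<in>{h. y h \<noteq> 0}. {x. ad G h f x \<noteq> 0})"
  proof
    fix x assume "x \<in> {x. ga_lie G f y x \<noteq> 0}"
    then have "(\<Sum>h\<in>{h. y h \<noteq> 0}. y h * ad G h f x) \<noteq> 0"
      unfolding ga_lie_eq_sum_ad[OF assms] by simp
    then obtain h where "h \<in> {h. y h \<noteq> 0}" "y h * ad G h f x \<noteq> 0"
      by (rule sum.not_neutral_contains_not_neutral)
    then show "x \<in> (\<Union>h\<in>{h. y h \<noteq> 0}. {x. ad G h f x \<noteq> 0})" by auto
  qed
  moreover have "finite (\<Union>h\<in>{h. y h \<noteq> 0}. {x. ad G h f x \<noteq> 0})"
    using fin ad by blast
  moreover have "(\<Union>h\<in>{h. y h \<noteq> 0}. {x. ad G h f x \<noteq> 0}) \<subseteq> carrier G"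
    using fin ad by blast
  ultimately show ?thesis
    unfolding ga_carrier_def using finite_subset by blast
qed

text \<open>Multilinearity in all arguments at once: every bracket is a combination of maps
  \<open>ad G h\<close>, so if all words of the given length in these maps kill \<open>f\<close>,
  commutators with arbitrary elements vanish as well.\<close>

lemma foldl_ga_lie_zero:
  assumes "ad_zero G (length ys) f" "f \<in> ga_carrier G" "set ys \<subseteq> ga_carrier G"
  shows "foldl (ga_lie G) f ys = (\<lambda>_. 0)"
  using assms
proof (induction ys arbitrary: f)
  case Nil
  then show ?case by (auto simp: ad_zero_def)
next
  case (Cons y ys)
  have y: "y \<in> ga_carrier G" using Cons.prems by simp
  have "ad_zero G (length ys) (ga_lie G f y)"
    unfolding ga_lie_eq_sum_ad[OF Cons.prems(2) y]
    using Cons.prems(1) y by (intro ad_zero_sum) (auto simp: ad_zero_Suc ga_carrier_def)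
  then show ?case
    using Cons ga_lie_in_ga_carrier[OF Cons.prems(2) y] by simp
qed

lemma delta_in_ga_carrier: "g \<in> carrier G \<Longrightarrow> delta g \<in> ga_carrier G"
  by (auto simp: delta_def ga_carrier_def)

lemma ga_lie_delta:
  assumes "f \<in> ga_carrier G" "h \<in> carrier G"
  shows "ga_lie G f (delta h) = ad G h f"
proof -
  have "{x. delta h x \<noteq> (0::'k::field)} = {h}" by (auto simp: delta_def)
  then show ?thesis
    unfolding ga_lie_eq_sum_ad[OF assms(1) delta_in_ga_carrier[OF assms(2)]]
    by (simp add: delta_def)
qed

lemma foldl_ga_lie_delta:
  assumes "f \<in> ga_carrier G" "set hs \<subseteq> carrier G"
  shows "foldl (ga_lie G) f (map delta hs) = fold (ad G) hs f"
  using assms by (induction hs arbitrary: f) (auto simp: ga_lie_delta ad_in_ga_carrier)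

lemma ga_ideal_zero:
  assumes "S \<subseteq> {\<lambda>_. 0}"
  shows "ga_ideal G S = {\<lambda>_. 0}"
proof
  show "ga_ideal G S \<subseteq> {\<lambda>_. 0}"
  proof
    fix f assume "f \<in> ga_ideal G S"
    then show "f \<in> {\<lambda>_. 0}"
      by induction (use assms in \<open>auto simp: ga_mult_def\<close>)
  qed
qed (simp add: ga_ideal.zero)

text \<open>An ideal is zero as soon as its generators are, so the ideal closure never has to be
  computed. The shift by one arises because a commutator of length \<open>Suc k\<close> starts from
  one element and applies \<open>k\<close> maps \<open>ad\<close>.\<close>

theorem lower_lie_power_eq_zero_iff:
  "lower_lie_power G (Suc k) = {(\<lambda>_. 0) :: 'a \<Rightarrow> 'k::field} \<longleftrightarrow> lie_zero TYPE('k) G k"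
proof
  assume L: "lower_lie_power G (Suc k) = {(\<lambda>_. 0) :: 'a \<Rightarrow> 'k}"
  show "lie_zero TYPE('k) G k"
    unfolding lie_zero_def ad_zero_def
  proof (intro ballI allI impI)
    fix g hs assume g: "g \<in> carrier G" and hs: "set hs \<subseteq> carrier G" "length hs = k"
    let ?f = "fold (ad G) hs (delta g :: 'a \<Rightarrow> 'k)"
    have "?f \<in> ga_lie_comms G (Suc k)"
      unfolding ga_lie_comms_def
      using g hs foldl_ga_lie_delta[OF delta_in_ga_carrier[OF g, where ?'c = 'k] hs(1)]
      by (intro CollectI exI[of _ "delta g"] exI[of _ "map delta hs"]) (auto intro: delta_in_ga_carrier)
    then have "?f \<in> lower_lie_power G (Suc k)"
      unfolding lower_lie_power_def by (rule ga_ideal.gen)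
    then show "?f = (\<lambda>_. 0)" using L by simp
  qed
next
  assume R: "lie_zero TYPE('k) G k"
  have "ga_lie_comms G (Suc k) \<subseteq> {(\<lambda>_. 0) :: 'a \<Rightarrow> 'k}"
    unfolding ga_lie_comms_def using foldl_ga_lie_zero lie_zero_imp_ad_zero[OF R] by force
  then show "lower_lie_power G (Suc k) = {(\<lambda>_. 0) :: 'a \<Rightarrow> 'k}"
    unfolding lower_lie_power_def by (rule ga_ideal_zero)
qed

lemma not_lie_zero_0: "\<not> lie_zero TYPE('k::field) G 0"
  unfolding lie_zero_def ad_zero_def
  by (auto simp: delta_def fun_eq_iff intro!: bexI[of _ \<one>] exI[of _ \<one>])

text \<open>The truncated \<open>k - 1\<close> is harmless at \<open>k = 0\<close>, where the two
  hypotheses contradict each other.\<close>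

lemma t_L_eq:
  assumes "lie_zero TYPE('k::field) G k" "\<not> lie_zero TYPE('k) G (k - 1)"
  shows "t_L TYPE('k) G = k + 1"
  unfolding t_L_def
proof (rule Least_equality)
  show "1 \<le> k + 1 \<and> lower_lie_power G (k + 1) = {(\<lambda>_. 0) :: 'a \<Rightarrow> 'k}"
    using assms lower_lie_power_eq_zero_iff[where ?'k = 'k, of k] by simp
next
  fix m assume m: "1 \<le> m \<and> lower_lie_power G m = {(\<lambda>_. 0) :: 'a \<Rightarrow> 'k}"
  then obtain j where j: "m = Suc j" by (cases m) auto
  with m have "lie_zero TYPE('k) G j" using lower_lie_power_eq_zero_iff[where ?'k = 'k, of j] by simp
  with assms(2) have "\<not> j \<le> k - 1" using lie_zero_mono by blast
  then show "k + 1 \<le> m" using j by linarith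
qed

lemma ga_lie_nilpotent_iff: "ga_lie_nilpotent TYPE('k::field) G \<longleftrightarrow> (\<exists>k. lie_zero TYPE('k) G k)"
proof
  assume "ga_lie_nilpotent TYPE('k) G"
  then obtain m where "m \<ge> 1" "lower_lie_power G m = {(\<lambda>_. 0) :: 'a \<Rightarrow> 'k}"
    by (auto simp: ga_lie_nilpotent_def)
  then show "\<exists>k. lie_zero TYPE('k) G k"
    using lower_lie_power_eq_zero_iff[where ?'k = 'k, of "m - 1"] by auto
next
  assume "\<exists>k. lie_zero TYPE('k) G k"
  then obtain k where "lie_zero TYPE('k) G k" ..
  then show "ga_lie_nilpotent TYPE('k) G"
    unfolding ga_lie_nilpotent_def
    using lower_lie_power_eq_zero_iff[where ?'k = 'k, of k] by (intro exI[of _ "Suc k"]) auto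
qed

end

text \<open>Each index of \<open>F\<close> stands for one of two commuting shifts and
  \<open>op\<close> for their difference, so this is the binomial theorem for that difference. The
  abstract family lets one proof serve both \<open>ad\<close> (multiplication by \<open>b\<close> on
  the right and on the left) and \<open>dif\<close> (translation by \<open>t\<close> and the
  identity).\<close>

lemma funpow_binomial:
  fixes F :: "nat \<Rightarrow> nat \<Rightarrow> 'g \<Rightarrow> 'k::comm_ring_1"
  assumes step: "\<And>i j. op (F i j) = (\<lambda>z. F (Suc i) j z - F i (Suc j) z)"
    and diff: "\<And>f g. op (\<lambda>z. f z - g z) = (\<lambda>z. op f z - op g z)"
  shows "(op ^^ n) (F i j) =
    (\<lambda>z. \<Sum>k\<le>n. of_nat (n choose k) * (-1) ^ (n - k) * F (i + k) (j + (n - k)) z)"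
proof (induction n arbitrary: i j)
  case 0
  then show ?case by simp
next
  case (Suc n)
  have diff': "(op ^^ m) (\<lambda>z. f z - g z) = (\<lambda>z. (op ^^ m) f z - (op ^^ m) g z)" for m f g
    by (induction m) (simp_all add: diff)
  let ?c = "\<lambda>k. of_nat (n choose k) * (-1) ^ (n - k) :: 'k"
  show ?case
  proof
    fix z
    have "(op ^^ Suc n) (F i j) z = (op ^^ n) (F (Suc i) j) z - (op ^^ n) (F i (Suc j)) z"
      by (simp add: funpow_Suc_right step diff' del: funpow.simps)
    also have "\<dots> = (\<Sum>k\<le>n. ?c k * F (i + Suc k) (j + (n - k)) z)
        - (\<Sum>k\<le>n. ?c k * F (i + k) (j + Suc (n - k)) z)"
      by (simp add: Suc.IH)
    \<comment> \<open>The term \<open>k = 0\<close> is split off and the rest shifted, so that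
      Pascal's rule applies termwise. The additional term \<open>k = n\<close> has the coefficient
      \<open>n choose Suc n = 0\<close>, so its truncated exponent \<open>n - Suc n\<close> does no
      harm.\<close>
    also have "(\<Sum>k\<le>n. ?c k * F (i + k) (j + Suc (n - k)) z)
        = ?c 0 * F i (j + Suc n) z + (\<Sum>k\<le>n. of_nat (n choose Suc k) * (-1) ^ (n - Suc k) * F (i + Suc k) (j + Suc (n - Suc k)) z)"
    proof -
      have "(\<Sum>k\<le>n. ?c k * F (i + k) (j + Suc (n - k)) z) = (\<Sum>k\<le>Suc n. ?c k * F (i + k) (j + Suc (n - k)) z)"
        by (simp add: binomial_eq_0)
      also have "\<dots> = ?c 0 * F i (j + Suc n) z + (\<Sum>k\<le>n. ?c (Suc k) * F (i + Suc k) (j + Suc (n - Suc k)) z)"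
        by (subst sum.atMost_Suc_shift) simp
      finally show ?thesis .
    qed
    also have "(\<Sum>k\<le>n. of_nat (n choose Suc k) * (-1) ^ (n - Suc k) * F (i + Suc k) (j + Suc (n - Suc k)) z)
        = (\<Sum>k\<le>n. - (of_nat (n choose Suc k) * (-1) ^ (n - k)) * F (i + Suc k) (j + (n - k)) z)"
    proof (intro sum.cong refl)
      fix k assume "k \<in> {..n}"
      then consider "k = n" | "k < n" by force
      then show "of_nat (n choose Suc k) * (-1) ^ (n - Suc k) * F (i + Suc k) (j + Suc (n - Suc k)) z
        = - (of_nat (n choose Suc k) * (-1) ^ (n - k)) * F (i + Suc k) (j + (n - k)) z"
      proof cases
        case 2
        then have "n - k = Suc (n - Suc k)" by simp
        then show ?thesis by simp
      qed (simp add: binomial_eq_0)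
    qed
    finally have "(op ^^ Suc n) (F i j) z = (\<Sum>k\<le>n. ?c k * F (i + Suc k) (j + (n - k)) z)
        - (?c 0 * F i (j + Suc n) z
        + (\<Sum>k\<le>n. - (of_nat (n choose Suc k) * (-1) ^ (n - k)) * F (i + Suc k) (j + (n - k)) z))" .
    also have "\<dots> = (-1) ^ Suc n * F i (j + Suc n) z
        + (\<Sum>k\<le>n. of_nat (Suc n choose Suc k) * (-1) ^ (n - k) * F (i + Suc k) (j + (n - k)) z)"
      by (simp add: sum_negf sum.distrib algebra_simps)
    also have "\<dots> = (\<Sum>k\<le>Suc n. of_nat (Suc n choose k) * (-1) ^ (Suc n - k) * F (i + k) (j + (Suc n - k)) z)"
      by (subst sum.atMost_Suc_shift) simp
    finally show "(op ^^ Suc n) (F i j) z =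
      (\<Sum>k\<le>Suc n. of_nat (Suc n choose k) * (-1) ^ (Suc n - k) * F (i + k) (j + (Suc n - k)) z)" .
  qed
qed

lemma minus_one_power_CHAR:
  assumes "CHAR('k::field) = p" "prime p"
  shows "(-1) ^ p = (-1 :: 'k)"
proof (cases "p = 2")
  case True
  then have "of_nat 2 = (0 :: 'k)" using assms(1) of_nat_CHAR[where 'a = 'k] by metis
  then have "(1::'k) + 1 = 0" by simp
  then have "(1::'k) = -1" using eq_neg_iff_add_eq_0 by blast
  then show ?thesis using True by simp
next
  case False
  then show ?thesis using assms(2) using prime_odd_nat[OF assms(2)] prime_ge_2_nat[OF assms(2)] by simp
qed

text \<open>In characteristic \<open>p\<close> only the two outer binomial coefficients survive. The
  sign \<open>(-1)^p = -1\<close> is right for \<open>p = 2\<close> too, since then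
  \<open>1 = -1\<close>.\<close>

lemma funpow_prime:
  fixes F :: "nat \<Rightarrow> nat \<Rightarrow> 'g \<Rightarrow> 'k::field"
  assumes "\<And>i j. op (F i j) = (\<lambda>z. F (Suc i) j z - F i (Suc j) z)"
    and "\<And>f g. op (\<lambda>z. f z - g z) = (\<lambda>z. op f z - op g z)"
    and p: "CHAR('k) = p" "prime p"
  shows "(op ^^ p) (F i j) = (\<lambda>z. F (i + p) j z - F i (j + p) z)"
proof
  fix z
  have p0: "p > 0" using p prime_gt_0_nat by blast
  have mid: "of_nat (p choose k) = (0::'k)" if "0 < k" "k < p" for k
    using p that dvd_choose_prime[of k p] by (simp add: of_nat_eq_0_iff_char_dvd)
  have "(op ^^ p) (F i j) z = (\<Sum>k\<le>p. of_nat (p choose k) * (-1) ^ (p - k) * F (i + k) (j + (p - k)) z)"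
    using funpow_binomial[of op F p i j] assms(1,2) by simp
  also have "\<dots> = (\<Sum>k\<in>{0, p}. of_nat (p choose k) * (-1) ^ (p - k) * F (i + k) (j + (p - k)) z)"
    by (intro sum.mono_neutral_right) (auto simp: mid)
  also have "\<dots> = F (i + p) j z - F i (j + p) z"
    using p0 minus_one_power_CHAR[OF p] by simp
  finally show "(op ^^ p) (F i j) z = F (i + p) j z - F i (j + p) z" .
qed

lemma ad_diff: "ad G h (\<lambda>z. f z - g z) = (\<lambda>z. ad G h f z - ad G h g z)"
  by (auto simp: ad_def)

lemma funpow_ad_sum: "(ad G h ^^ n) (\<lambda>z. \<Sum>i\<in>I. c i * F i z) = (\<lambda>z. \<Sum>i\<in>I. c i * (ad G h ^^ n) (F i) z)"
  by (induction n) (simp_all add: ad_sum)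

lemma fold_replicate: "fold f (replicate n x) = f x ^^ n"
  by (induction n) (auto simp: funpow_swap1)

lemma lie_zeroD: "lie_zero TYPE('k::field) G k \<Longrightarrow> g \<in> carrier G \<Longrightarrow> set hs \<subseteq> carrier G \<Longrightarrow>
    length hs = k \<Longrightarrow> fold (ad G) hs (delta g :: _ \<Rightarrow> 'k) = (\<lambda>_. 0)"
  unfolding lie_zero_def ad_zero_def by blast

lemma delta_inject: "delta a = (delta b :: 'g \<Rightarrow> 'k::field) \<longleftrightarrow> a = b"
proof
  assume "delta a = (delta b :: 'g \<Rightarrow> 'k)"
  then have "delta a a = (delta b a :: 'k)" by simp
  then show "a = b" by (simp add: delta_def split: if_splits)
qed simp

context group
begin

lemma ad_delta:
  assumes "g \<in> carrier G" "h \<in> carrier G"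
  shows "ad G h (delta g) = (\<lambda>x. delta (g \<otimes> h) x - delta (h \<otimes> g) x)"
proof
  fix x
  have "x \<otimes> inv h = g \<longleftrightarrow> x = g \<otimes> h" "inv h \<otimes> x = g \<longleftrightarrow> x = h \<otimes> g" if "x \<in> carrier G"
    using assms that by (metis inv_solve_right inv_closed inv_inv, metis inv_solve_left)
  then show "ad G h (delta g) x = delta (g \<otimes> h) x - delta (h \<otimes> g) x"
    using assms by (auto simp: ad_def delta_def)
qed

lemma ad_funpow_aux:
  assumes "a \<in> carrier G" "b \<in> carrier G"
  shows "ad G b (delta (b [^] j \<otimes> a \<otimes> b [^] i)) =
    (\<lambda>z. delta (b [^] (j::nat) \<otimes> a \<otimes> b [^] Suc i) z - delta (b [^] Suc j \<otimes> a \<otimes> b [^] (i::nat)) z)"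
proof -
  have "b [^] Suc j = b \<otimes> b [^] j" using assms nat_pow_Suc2 by blast
  then show ?thesis using assms by (simp add: ad_delta m_assoc)
qed

lemma ad_funpow_delta:
  assumes "a \<in> carrier G" "b \<in> carrier G"
  shows "(ad G b ^^ n) (delta a) =
    (\<lambda>z. \<Sum>k\<le>n. of_nat (n choose k) * (-1) ^ (n - k) * delta (b [^] (n - k) \<otimes> a \<otimes> b [^] k) z)"
  using funpow_binomial[where F = "\<lambda>i j. delta (b [^] j \<otimes> a \<otimes> b [^] i)" and op = "ad G b" and i = 0 and j = 0 and n = n,
      OF ad_funpow_aux[OF assms] ad_diff] assms by simp

lemma ad_funpow_prime_delta:
  assumes "a \<in> carrier G" "b \<in> carrier G" "CHAR('k) = p" "prime p"
  shows "(ad G b ^^ p) (delta a) = ad G (b [^] p) (delta a :: 'a \<Rightarrow> 'k::field)"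
  using funpow_prime[where F = "\<lambda>i j. (delta (b [^] j \<otimes> a \<otimes> b [^] i) :: 'a \<Rightarrow> 'k)" and op = "ad G b" and i = 0 and j = 0,
      OF ad_funpow_aux[OF assms(1,2)] ad_diff assms(3,4)] assms by (simp add: ad_delta)

lemma ad_funpow_prime:
  assumes "(f :: 'a \<Rightarrow> 'k::field) \<in> ga_carrier G" "b \<in> carrier G" "CHAR('k) = p" "prime p"
  shows "(ad G b ^^ p) f = ad G (b [^] p) f"
proof -
  have f: "f = (\<lambda>z. \<Sum>g\<in>{g. f g \<noteq> 0}. f g * delta g z)"
    by (rule fin_supp_eq_sum_delta[OF assms(1)])
  have g: "g \<in> carrier G" if "f g \<noteq> 0" for g using assms(1) that by (auto simp: ga_carrier_def)
  have "(ad G b ^^ p) (\<lambda>z. \<Sum>g\<in>{g. f g \<noteq> 0}. f g * delta g z)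
      = (\<lambda>z. \<Sum>g\<in>{g. f g \<noteq> 0}. f g * ad G (b [^] p) (delta g) z)"
    unfolding funpow_ad_sum using g by (simp add: ad_funpow_prime_delta[OF _ assms(2-4)])
  then show ?thesis
    unfolding ad_sum[symmetric] using f by simp
qed

lemma ad_funpow_in_ga_carrier:
  "f \<in> ga_carrier G \<Longrightarrow> b \<in> carrier G \<Longrightarrow> (ad G b ^^ n) f \<in> ga_carrier G"
  by (induction n) (auto intro: ad_in_ga_carrier)

lemma ad_funpow_prime_power:
  assumes "(f :: 'a \<Rightarrow> 'k::field) \<in> ga_carrier G" "b \<in> carrier G" "CHAR('k) = p" "prime p"
  shows "(ad G b ^^ (p ^ s)) f = ad G (b [^] (p ^ s)) f"
  using assms(1,2)
proof (induction s arbitrary: f)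
  case 0
  then show ?case by simp
next
  case (Suc s)
  have "(((ad G b) ^^ (p ^ s)) ^^ n) f = (ad G (b [^] (p ^ s)) ^^ n) f" for n
  proof (induction n)
    case (Suc n)
    then show ?case
      using Suc.IH Suc.prems by (simp add: ad_funpow_in_ga_carrier \<open>\<And>f. f \<in> ga_carrier G \<Longrightarrow> b \<in> carrier G \<Longrightarrow> (ad G b ^^ p ^ s) f = ad G (b [^] p ^ s) f\<close> \<open>b \<in> carrier G\<close> \<open>f \<in> ga_carrier G\<close>)
  qed simp
  then have "(ad G b ^^ (p ^ Suc s)) f = (ad G (b [^] (p ^ s)) ^^ p) f"
    by (simp add: funpow_mult mult.commute)
  also have "\<dots> = ad G (b [^] (p ^ Suc s)) f"
    using Suc.prems assms(3,4) by (subst ad_funpow_prime) (auto simp: nat_pow_pow mult.commute)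
  finally show ?case .
qed

text \<open>Since \<open>k < p^k\<close>, applying \<open>ad b\<close> as often as
  \<open>p^k\<close> times gives zero, and this iterate equals \<open>ad (b^(p^k))\<close>. So
  \<open>b^(p^k)\<close> commutes with everything, with an exponent that is the same for all
  \<open>b\<close>. This is how Lie nilpotency enters the group-theoretic part.\<close>

lemma lie_zero_imp_central_power:
  assumes "lie_zero TYPE('k::field) G k" "CHAR('k) = p" "prime p"
  obtains s where "\<And>g b. g \<in> carrier G \<Longrightarrow> b \<in> carrier G \<Longrightarrow> g \<otimes> b [^] (p ^ s) = b [^] (p ^ s) \<otimes> g"
proof -
  have "p \<ge> 2" using assms prime_ge_2_nat by blast
  then have "k < p ^ k" by (metis less_exp order_less_le_trans power_mono zero_le)
  then have z: "lie_zero TYPE('k) G (p ^ k)" using lie_zero_mono[OF assms(1)] by simp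
  show thesis
  proof (rule that[of k])
    fix g b assume gb: "g \<in> carrier G" "b \<in> carrier G"
    have "(\<lambda>_. 0) = fold (ad G) (replicate (p ^ k) b) (delta g :: 'a \<Rightarrow> 'k)"
      using gb lie_zeroD[OF z gb(1), of "replicate (p ^ k) b"] by (simp add: set_replicate_conv_if)
    also have "\<dots> = ad G (b [^] (p ^ k)) (delta g)"
      using ad_funpow_prime_power[OF delta_in_ga_carrier[OF gb(1)] gb(2) assms(2,3)] by (simp add: fold_replicate)
    also have "\<dots> = (\<lambda>x. delta (g \<otimes> b [^] (p ^ k)) x - delta (b [^] (p ^ k) \<otimes> g) x)"
      using gb by (simp add: ad_delta)
    finally have eq: "(\<lambda>_. 0) = (\<lambda>x. delta (g \<otimes> b [^] (p ^ k)) x - delta (b [^] (p ^ k) \<otimes> g) x :: 'k)" .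
    have "delta (g \<otimes> b [^] (p ^ k)) = (delta (b [^] (p ^ k) \<otimes> g) :: 'a \<Rightarrow> 'k)"
    proof
      fix x show "delta (g \<otimes> b [^] (p ^ k)) x = (delta (b [^] (p ^ k) \<otimes> g) x :: 'k)"
        using fun_cong[OF eq, of x] by simp
    qed
    then show "g \<otimes> b [^] (p ^ k) = b [^] (p ^ k) \<otimes> g"
      by (simp add: delta_inject)
  qed
qed

text \<open>Consider the coefficient of \<open>a b^m\<close> in \<open>[a, b, ..., b]\<close>. The
  term \<open>b^(m-k) a b^k\<close> equals \<open>a b^m\<close> only if \<open>b^(m-k)\<close>
  commutes with \<open>a\<close>, so only \<open>k = m\<close> contributes, with coefficient 1 in
  every characteristic.\<close>

lemma not_lie_zero_of_noncommuting_powers: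
  assumes a: "a \<in> carrier G" and b: "b \<in> carrier G"
    and nc: "\<And>i. 0 < i \<Longrightarrow> i \<le> m \<Longrightarrow> b [^] i \<otimes> a \<noteq> a \<otimes> b [^] (i::nat)"
  shows "\<not> lie_zero TYPE('k::field) G m"
proof
  assume L: "lie_zero TYPE('k) G m"
  let ?f = "(ad G b ^^ m) (delta a :: 'a \<Rightarrow> 'k)"
  have "?f = (\<lambda>_. 0)"
    using lie_zeroD[OF L a, of "replicate m b"] b by (simp add: set_replicate_conv_if fold_replicate)
  moreover have "?f (a \<otimes> b [^] m) =
      (\<Sum>k\<le>m. of_nat (m choose k) * (-1) ^ (m - k) * delta (b [^] (m - k) \<otimes> a \<otimes> b [^] k) (a \<otimes> b [^] m))"
    unfolding ad_funpow_delta[OF a b] ..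
  moreover have "\<dots> = (\<Sum>k\<in>{m}. of_nat (m choose k) * (-1) ^ (m - k) * delta (b [^] (m - k) \<otimes> a \<otimes> b [^] k) (a \<otimes> b [^] m))"
  proof (intro sum.mono_neutral_right ballI)
    fix k assume "k \<in> {..m} - {m}"
    then have k: "0 < m - k" "k \<le> m" by auto
    have "a \<otimes> b [^] m = (a \<otimes> b [^] (m - k)) \<otimes> b [^] k"
      using a b k by (simp add: m_assoc nat_pow_mult)
    then have "b [^] (m - k) \<otimes> a \<otimes> b [^] k \<noteq> a \<otimes> b [^] m"
      using nc[OF k(1)] a b by simp
    then show "of_nat (m choose k) * (-1) ^ (m - k) * delta (b [^] (m - k) \<otimes> a \<otimes> b [^] k) (a \<otimes> b [^] m) = (0::'k)"
      by (simp add: delta_def)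
  qed auto
  moreover have "\<dots> = (1::'k)" using a b by (simp add: delta_def)
  ultimately show False by simp
qed

end

section \<open>The lower central series and central quotients\<close>
context group
begin

definition cm :: "'a \<Rightarrow> 'a \<Rightarrow> 'a" where
  "cm g h = g \<otimes> h \<otimes> inv g \<otimes> inv h"

lemma cm_closed [simp]: "g \<in> carrier G \<Longrightarrow> h \<in> carrier G \<Longrightarrow> cm g h \<in> carrier G"
  by (simp add: cm_def)

lemma inv_cm: "g \<in> carrier G \<Longrightarrow> h \<in> carrier G \<Longrightarrow> inv (cm g h) = cm h g"
  by (simp add: cm_def word_simps)

lemma cm_mult: "g \<in> carrier G \<Longrightarrow> h \<in> carrier G \<Longrightarrow> cm g h \<otimes> (h \<otimes> g) = g \<otimes> h"
  by (simp add: cm_def word_simps)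

lemma conj_eq_cm: "g \<in> carrier G \<Longrightarrow> u \<in> carrier G \<Longrightarrow> g \<otimes> u \<otimes> inv g = cm g u \<otimes> u"
  by (simp add: cm_def word_simps)

lemma conj_eq_cm': "g \<in> carrier G \<Longrightarrow> u \<in> carrier G \<Longrightarrow> g \<otimes> u \<otimes> inv g = u \<otimes> cm (inv u) g"
  by (simp add: cm_def word_simps)

lemma cm_eq_one_iff: "g \<in> carrier G \<Longrightarrow> h \<in> carrier G \<Longrightarrow> cm g h = \<one> \<longleftrightarrow> g \<otimes> h = h \<otimes> g"
  by (metis cm_closed cm_mult l_one m_closed one_closed r_cancel)

lemma cm_mult_left:
  "a \<in> carrier G \<Longrightarrow> b \<in> carrier G \<Longrightarrow> c \<in> carrier G \<Longrightarrow> cm (a \<otimes> b) c = a \<otimes> cm b c \<otimes> inv a \<otimes> cm a c"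
  by (simp add: cm_def word_simps)

lemma lcs_Suc: "1 \<le> n \<Longrightarrow> lcs G (Suc n) = generate G (\<Union>u\<in>lcs G n. \<Union>g\<in>carrier G. {cm u g})"
  by (cases n) (simp_all add: cm_def)

lemma lcs_one [simp]: "lcs G 1 = carrier G"
  by simp

lemma lcs_2: "lcs G 2 = derived G (carrier G)"
  by (simp add: numeral_2_eq_2 derived_def)

lemma lcs_normal: "lcs G n \<lhd> G"
proof (induction n)
  case 0
  then show ?case by (simp add: normal_self)
next
  case (Suc n)
  show ?case
  proof (cases "n = 0")
    case True
    then show ?thesis by (simp add: normal_self)
  next
    case False
    have sub: "u \<in> carrier G" if "u \<in> lcs G n" for u
      using subgroup.mem_carrier[OF normal_imp_subgroup[OF Suc] that] .
    have "generate G (\<Union>u\<in>lcs G n. \<Union>g\<in>carrier G. {cm u g}) \<lhd> G"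
    proof (rule normal_generateI)
      show "(\<Union>u\<in>lcs G n. \<Union>g\<in>carrier G. {cm u g}) \<subseteq> carrier G"
        using sub by auto
    next
      fix h g assume h: "h \<in> (\<Union>u\<in>lcs G n. \<Union>g\<in>carrier G. {cm u g})" and g: "g \<in> carrier G"
      then obtain u k where u: "u \<in> lcs G n" "k \<in> carrier G" "h = cm u k" by auto
      have "g \<otimes> u \<otimes> inv g \<in> lcs G n"
        using normal.inv_op_closed2[OF Suc g u(1)] .
      moreover have "g \<otimes> h \<otimes> inv g = cm (g \<otimes> u \<otimes> inv g) (g \<otimes> k \<otimes> inv g)"
        using u g sub by (simp add: cm_def word_simps)
      ultimately show "g \<otimes> h \<otimes> inv g \<in> (\<Union>u\<in>lcs G n. \<Union>g\<in>carrier G. {cm u g})"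
        using g u by auto
    qed
    then show ?thesis using False by (simp add: lcs_Suc)
  qed
qed

lemma lcs_subgroup: "subgroup (lcs G n) G"
  using normal_imp_subgroup[OF lcs_normal] .

lemma lcs_carrier: "u \<in> lcs G n \<Longrightarrow> u \<in> carrier G"
  using subgroup.mem_carrier[OF lcs_subgroup] .

lemma lcs_conj: "u \<in> lcs G n \<Longrightarrow> g \<in> carrier G \<Longrightarrow> g \<otimes> u \<otimes> inv g \<in> lcs G n"
  using normal.inv_op_closed2[OF lcs_normal] .

lemma cm_in_lcs:
  assumes "u \<in> lcs G n" "g \<in> carrier G" "1 \<le> n"
  shows "cm u g \<in> lcs G (Suc n)" "cm g u \<in> lcs G (Suc n)"
proof -
  show 1: "cm u g \<in> lcs G (Suc n)"
    unfolding lcs_Suc[OF assms(3)] using assms by (intro generate.incl) auto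
  show "cm g u \<in> lcs G (Suc n)"
    using subgroup.m_inv_closed[OF lcs_subgroup 1] assms lcs_carrier inv_cm by simp
qed

lemma lcs_Suc_least:
  assumes "subgroup M G" "\<And>u g. u \<in> lcs G n \<Longrightarrow> g \<in> carrier G \<Longrightarrow> cm u g \<in> M" "1 \<le> n"
  shows "lcs G (Suc n) \<subseteq> M"
  unfolding lcs_Suc[OF assms(3)] using assms by (intro generate_subgroup_incl) auto

lemma lcs_Suc_subset: "lcs G (Suc n) \<subseteq> lcs G n"
proof (cases "n = 0")
  case False
  show ?thesis
  proof (rule lcs_Suc_least[OF lcs_subgroup])
    fix u g assume u: "u \<in> lcs G n" and g: "g \<in> carrier G"
    have "cm u g = u \<otimes> (g \<otimes> inv u \<otimes> inv g)"
      using u g lcs_carrier by (simp add: cm_def word_simps)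
    then show "cm u g \<in> lcs G n"
      using u g lcs_conj subgroup.m_inv_closed[OF lcs_subgroup u] subgroup.m_closed[OF lcs_subgroup] by simp
  qed (use False in simp)
qed simp

lemma lcs_antimono: "m \<le> n \<Longrightarrow> lcs G n \<subseteq> lcs G m"
  using lift_Suc_antimono_le[of "lcs G"] lcs_Suc_subset by blast

lemma one_in_lcs [simp]: "\<one> \<in> lcs G n"
  using subgroup.one_closed[OF lcs_subgroup] .

lemma cm_in_derived: "g \<in> carrier G \<Longrightarrow> h \<in> carrier G \<Longrightarrow> cm g h \<in> lcs G 2"
  using cm_in_lcs(1)[of g 1 h] by (simp add: numeral_2_eq_2)

lemma subgroup_card_dvd:
  assumes "subgroup A G" "subgroup B G" "A \<subseteq> B"
  shows "card A dvd card B"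
proof -
  interpret B: group "G\<lparr>carrier := B\<rparr>" by (rule subgroup_imp_group[OF assms(2)])
  have "subgroup A (G\<lparr>carrier := B\<rparr>)" using assms by (simp add: subgroup_incl)
  from B.lagrange[OF this] have "card (rcosets\<^bsub>G\<lparr>carrier := B\<rparr>\<^esub> A) * card A = card B"
    by (simp add: order_def)
  then show ?thesis by (metis dvd_triv_right)
qed

lemma ord_dvd_subgroup_card:
  assumes "subgroup A G" "a \<in> A"
  shows "ord a dvd card A"
proof -
  have "a \<in> carrier G" using subgroup.mem_carrier[OF assms] .
  then show ?thesis
    using assms subgroup_card_dvd[OF generate_is_subgroup[of "{a}"] assms(1)] generate_subgroup_incl[of "{a}" A]
    by (simp add: generate_pow_card)
qed

lemma ord_pos_of_finite:
  assumes "subgroup A G" "finite A" "a \<in> A"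
  shows "ord a > 0"
proof -
  have "card A > 0" using assms by (metis card_gt_0_iff empty_iff)
  then show ?thesis using ord_dvd_subgroup_card[OF assms(1,3)] by (metis dvd_0_left neq0_conv)
qed

lemma pow_card_eq_one:
  assumes "subgroup A G" "a \<in> A"
  shows "a [^] card A = \<one>"
  using ord_dvd_subgroup_card[OF assms] pow_eq_id subgroup.mem_carrier[OF assms] by simp

lemma nat_pow_in_subgroup: "subgroup A G \<Longrightarrow> a \<in> A \<Longrightarrow> a [^] (n::nat) \<in> A"
  by (induction n) (simp_all add: subgroup.one_closed subgroup.m_closed)

lemma generate_single_nat:
  assumes "a \<in> carrier G" "ord a > 0"
  shows "generate G {a} = (\<lambda>i. a [^] (i::nat)) ` {..<ord a}"
proof
  show "(\<lambda>i. a [^] (i::nat)) ` {..<ord a} \<subseteq> generate G {a}"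
    using assms nat_pow_in_subgroup[OF generate_is_subgroup[of "{a}"]] generate.incl[of a "{a}"] by auto
  show "generate G {a} \<subseteq> (\<lambda>i. a [^] (i::nat)) ` {..<ord a}"
  proof
    fix x assume "x \<in> generate G {a}"
    then obtain k :: int where "x = a [^] k" using generate_pow[OF assms(1)] by auto
    also have "\<dots> = a [^] (k mod int (ord a))"
    proof -
      have "a [^] k = a [^] (k mod int (ord a) + int (ord a) * (k div int (ord a)))" by simp
      also have "\<dots> = a [^] (k mod int (ord a)) \<otimes> (a [^] int (ord a)) [^] (k div int (ord a))"
        using assms by (simp only: int_pow_mult int_pow_pow)
      finally show ?thesis using assms by (simp add: int_pow_int)
    qed
    also have "\<dots> = a [^] nat (k mod int (ord a))"
      using assms by (simp add: int_pow_def2)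
    finally have "x = a [^] nat (k mod int (ord a))" .
    moreover have "nat (k mod int (ord a)) < ord a"
      using assms by (simp add: nat_less_iff)
    ultimately show "x \<in> (\<lambda>i. a [^] (i::nat)) ` {..<ord a}" by blast
  qed
qed

lemma ad_outside: "x \<notin> carrier G \<Longrightarrow> f x = 0 \<Longrightarrow> fold (ad G) hs f x = 0"
proof (induction hs arbitrary: f)
  case (Cons h hs)
  then show ?case by (simp add: ad_def)
qed simp

end

section \<open>Quotients by a finite central cyclic subgroup\<close>

locale central_quotient = group_hom G H \<phi> for G (structure) and H (structure) and \<phi> +
  fixes z n
  assumes surj: "\<phi> ` carrier G = carrier H"
    and z [simp]: "z \<in> carrier G"
    and central: "\<And>g. g \<in> carrier G \<Longrightarrow> g \<otimes>\<^bsub>G\<^esub> z = z \<otimes>\<^bsub>G\<^esub> g"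
    and n: "n = G.ord z" "n > 0"
    and fibre: "\<And>x y. x \<in> carrier G \<Longrightarrow> y \<in> carrier G \<Longrightarrow>
      \<phi> x = \<phi> y \<longleftrightarrow> (\<exists>i<n. y = x \<otimes>\<^bsub>G\<^esub> z [^]\<^bsub>G\<^esub> i)"

text \<open>The quotient has to live on the element type of \<open>G\<close>, because the inductions
  over central quotients range over groups of one fixed type. Hence cosets of \<open><z>\<close> are
  replaced by chosen representatives.\<close>

lemma (in group) central_quotient_exists:
  assumes z: "z \<in> carrier G" and central: "\<And>g. g \<in> carrier G \<Longrightarrow> g \<otimes> z = z \<otimes> g" and o: "ord z > 0"
  obtains H :: "('a, 'b) monoid_scheme" and \<phi> where "central_quotient G H \<phi> z (ord z)"
proof -
  let ?Z = "generate G {z}"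
  have zc: "g \<otimes> z [^] i = z [^] i \<otimes> g" if "g \<in> carrier G" for g and i :: nat
    using that z central by (induction i) (simp_all add: m_assoc[symmetric], metis m_assoc nat_pow_closed)
  have "?Z \<lhd> G"
  proof (rule normal_generateI)
    fix h g assume "h \<in> {z}" "g \<in> carrier G"
    then show "g \<otimes> h \<otimes> inv g \<in> {z}" using z central by (simp add: m_assoc)
  qed (use z in simp)
  then interpret Z: normal ?Z G .
  \<comment> \<open>The choice depends on the coset only as a set, so elements of one coset get the
    same representative.\<close>
  define f where "f x = (SOME y. y \<in> ?Z #> x)" for x
  have f_in: "f x \<in> ?Z #> x" if "x \<in> carrier G" for x
    unfolding f_def using someI[of "\<lambda>y. y \<in> ?Z #> x"] rcos_self[OF that Z.subgroup_axioms] by blast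
  have f_eq: "f x = f y \<longleftrightarrow> x \<otimes> inv y \<in> ?Z" if "x \<in> carrier G" "y \<in> carrier G" for x y
  proof
    assume eq: "f x = f y"
    have "?Z #> x = ?Z #> f x" "?Z #> y = ?Z #> f y"
      using repr_independence[OF f_in _ Z.subgroup_axioms] that by auto
    then have "?Z #> x = ?Z #> y" using eq by simp
    then have "x \<in> ?Z #> y" using rcos_self[OF that(1) Z.subgroup_axioms] by simp
    then show "x \<otimes> inv y \<in> ?Z" using Z.rcos_module_imp[OF is_group that(2)] by blast
  next
    assume "x \<otimes> inv y \<in> ?Z"
    then have "x \<in> ?Z #> y" using Z.rcos_module_rev[OF is_group that(2,1)] by blast
    then have "?Z #> y = ?Z #> x" using repr_independence[OF _ that(2) Z.subgroup_axioms] by simp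
    then show "f x = f y" unfolding f_def by simp
  qed
  then have w: "weak_group_morphism f ?Z G"
    by (intro weak_group_morphism.intro Z.normal_axioms weak_group_morphism_axioms.intro)
  interpret f: group_hom G "image_group f G" f
    by (rule weak_group_morphism_group_hom[OF w])
  let ?I = "image_group f G"
  \<comment> \<open>The image group is a plain monoid record; overriding the fields of
    \<open>G\<close> gives it the record type of \<open>G\<close>, extension included.\<close>
  let ?H = "G\<lparr>carrier := carrier ?I, mult := monoid.mult ?I, one := one ?I\<rparr>"
  interpret H: group ?H
    by (rule groupI) (auto simp: f.H.m_assoc intro: f.H.l_inv_ex)
  show thesis
  proof (rule that, unfold_locales)
    show "f \<in> hom G ?H" using f.homh by (auto simp: hom_def)
    show "f ` carrier G = carrier ?H" by (simp add: image_group_carrier)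
    fix x y assume xy: "x \<in> carrier G" "y \<in> carrier G"
    have "f x = f y \<longleftrightarrow> f y = f x" by auto
    also have "\<dots> \<longleftrightarrow> y \<otimes> inv x \<in> ?Z" using f_eq xy by simp
    also have "\<dots> \<longleftrightarrow> (\<exists>i < ord z. y \<otimes> inv x = z [^] i)"
      unfolding generate_single_nat[OF z o] by auto
    also have "\<dots> \<longleftrightarrow> (\<exists>i < ord z. y = x \<otimes> z [^] i)"
      using xy z zc by (metis inv_solve_right nat_pow_closed)
    finally show "f x = f y \<longleftrightarrow> (\<exists>i < ord z. y = x \<otimes> z [^] i)" .
  qed (use z central o in auto)
qed

section \<open>Translation and difference operators on the group algebra\<close>

definition tr :: "('g, 'b) monoid_scheme \<Rightarrow> 'g \<Rightarrow> ('g \<Rightarrow> 'k::field) \<Rightarrow> 'g \<Rightarrow> 'k" where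
  "tr G t f = (\<lambda>x. if x \<in> carrier G then f (x \<otimes>\<^bsub>G\<^esub> inv\<^bsub>G\<^esub> t) else 0)"

text \<open>In the group algebra \<open>tr G t f\<close> is \<open>f t\<close> and
  \<open>dif G t f\<close> is \<open>f (t - 1)\<close>, so composing these operators multiplies by
  augmentation factors.\<close>

definition dif :: "('g, 'b) monoid_scheme \<Rightarrow> 'g \<Rightarrow> ('g \<Rightarrow> 'k::field) \<Rightarrow> 'g \<Rightarrow> 'k" where
  "dif G t f = (\<lambda>x. tr G t f x - f x)"

lemma tr_diff: "tr G t (\<lambda>x. f x - g x) = (\<lambda>x. tr G t f x - tr G t g x)"
  by (auto simp: tr_def)

lemma dif_diff: "dif G t (\<lambda>x. f x - g x) = (\<lambda>x. dif G t f x - dif G t g x)"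
  by (auto simp: dif_def tr_def)

lemma dif_0 [simp]: "dif G t (\<lambda>_. 0) = (\<lambda>_. 0)"
  by (auto simp: dif_def tr_def)

lemma funpow_dif_0 [simp]: "(dif G t ^^ n) (\<lambda>_. 0) = (\<lambda>_. 0)"
  by (induction n) auto

context group
begin

lemma tr_tr: "s \<in> carrier G \<Longrightarrow> t \<in> carrier G \<Longrightarrow> tr G t (tr G s f) = tr G (s \<otimes> t) f"
  by (auto simp: tr_def word_simps)

lemma tr_one: "(\<And>x. x \<notin> carrier G \<Longrightarrow> f x = 0) \<Longrightarrow> tr G \<one> f = f"
  by (auto simp: tr_def)

lemma tr_delta: "s \<in> carrier G \<Longrightarrow> t \<in> carrier G \<Longrightarrow> tr G t (delta s) = delta (s \<otimes> t)"
  by (auto simp: tr_def delta_def fun_eq_iff inv_solve_right' inv_solve_right)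

lemma tr_in_ga_carrier:
  assumes "f \<in> ga_carrier G" "t \<in> carrier G"
  shows "tr G t f \<in> ga_carrier G"
proof -
  have "{x. tr G t f x \<noteq> 0} \<subseteq> (\<lambda>x. x \<otimes> t) ` {x. f x \<noteq> 0}"
  proof
    fix x assume "x \<in> {x. tr G t f x \<noteq> 0}"
    then have x: "x \<in> carrier G" "f (x \<otimes> inv t) \<noteq> 0"
      by (auto simp: tr_def split: if_splits)
    moreover have "x = (x \<otimes> inv t) \<otimes> t"
      using x assms by (simp add: m_assoc)
    ultimately show "x \<in> (\<lambda>x. x \<otimes> t) ` {x. f x \<noteq> 0}" by blast
  qed
  moreover have "{x. tr G t f x \<noteq> 0} \<subseteq> carrier G" by (auto simp: tr_def)
  ultimately show ?thesis
    using assms finite_subset unfolding ga_carrier_def by blast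
qed

lemma diff_in_ga_carrier:
  "f \<in> ga_carrier G \<Longrightarrow> g \<in> ga_carrier G \<Longrightarrow> (\<lambda>x. f x - g x) \<in> ga_carrier G"
proof -
  assume fg: "f \<in> ga_carrier G" "g \<in> ga_carrier G"
  have sub: "{x. f x - g x \<noteq> 0} \<subseteq> {x. f x \<noteq> 0} \<union> {x. g x \<noteq> 0}" by auto
  show ?thesis
    using finite_subset[OF sub] sub fg unfolding ga_carrier_def by blast
qed

lemma dif_in_ga_carrier: "f \<in> ga_carrier G \<Longrightarrow> t \<in> carrier G \<Longrightarrow> dif G t f \<in> ga_carrier G"
  unfolding dif_def by (intro diff_in_ga_carrier tr_in_ga_carrier)

lemma funpow_dif_in_ga_carrier:
  "f \<in> ga_carrier G \<Longrightarrow> t \<in> carrier G \<Longrightarrow> (dif G t ^^ n) f \<in> ga_carrier G"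
  by (induction n) (auto intro: dif_in_ga_carrier)

lemma ga_carrier_outside: "f \<in> ga_carrier G \<Longrightarrow> x \<notin> carrier G \<Longrightarrow> f x = 0"
  by (auto simp: ga_carrier_def)

text \<open>This is \<open>(t - 1)^p = t^p - 1\<close>. One of the two shifts in the binomial
  identity is the identity map, which is why the family \<open>F\<close> ignores its second
  index.\<close>

lemma dif_funpow_prime:
  assumes "(f :: 'a \<Rightarrow> 'k::field) \<in> ga_carrier G" "t \<in> carrier G" "CHAR('k) = p" "prime p"
  shows "(dif G t ^^ p) f = dif G (t [^] p) f"
proof -
  have "dif G t (tr G (t [^] i) f) = (\<lambda>z. tr G (t [^] Suc i) f z - tr G (t [^] i) f z)" for i
    using assms by (simp add: dif_def tr_tr)
  from funpow_prime[where op = "dif G t" and F = "\<lambda>i j. tr G (t [^] i) f" and i = 0 and j = 0,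
      OF this dif_diff assms(3,4)]
  show ?thesis
    using tr_one[of f] ga_carrier_outside[OF assms(1)] assms by (simp add: dif_def)
qed

end

section \<open>Lie commutators in \<open>G\<close> and in \<open>G/<z>\<close>\<close>

context central_quotient
begin

lemma z_pow_central: "g \<in> carrier G \<Longrightarrow> g \<otimes>\<^bsub>G\<^esub> z [^]\<^bsub>G\<^esub> (i::nat) = z [^]\<^bsub>G\<^esub> i \<otimes>\<^bsub>G\<^esub> g"
proof (induction i)
  case (Suc i)
  have "g \<otimes>\<^bsub>G\<^esub> z [^]\<^bsub>G\<^esub> Suc i = (g \<otimes>\<^bsub>G\<^esub> z [^]\<^bsub>G\<^esub> i) \<otimes>\<^bsub>G\<^esub> z"
    using Suc by (simp add: G.m_assoc[symmetric])
  also have "\<dots> = z [^]\<^bsub>G\<^esub> i \<otimes>\<^bsub>G\<^esub> (g \<otimes>\<^bsub>G\<^esub> z)"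
    using Suc by (simp add: G.m_assoc)
  also have "\<dots> = z [^]\<^bsub>G\<^esub> Suc i \<otimes>\<^bsub>G\<^esub> g"
    using Suc central[of g] by (simp add: G.m_assoc)
  finally show ?case .
qed simp

lemma z_pow_inj: "i < n \<Longrightarrow> j < n \<Longrightarrow> z [^]\<^bsub>G\<^esub> i = z [^]\<^bsub>G\<^esub> j \<Longrightarrow> i = j"
  using G.ord_inj[OF z] n by (auto simp: inj_on_def)

lemma z_pow_n: "z [^]\<^bsub>G\<^esub> n = \<one>\<^bsub>G\<^esub>"
  by (simp add: n)

lemma img_z_pow [simp]: "\<phi> (z [^]\<^bsub>G\<^esub> (i::nat)) = \<one>\<^bsub>H\<^esub>"
proof -
  have "\<phi> z = \<one>\<^bsub>H\<^esub>"
  proof (cases "n = 1")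
    case True
    then show ?thesis using z_pow_n by simp
  next
    case False
    then have "\<exists>i<n. z = \<one>\<^bsub>G\<^esub> \<otimes>\<^bsub>G\<^esub> z [^]\<^bsub>G\<^esub> i" using n(2) by (intro exI[of _ 1]) auto
    then show ?thesis using fibre[of "\<one>\<^bsub>G\<^esub>" z] by simp
  qed
  then show ?thesis by (simp add: hom_nat_pow)
qed

lemma img_mult_z_pow: "x \<in> carrier G \<Longrightarrow> \<phi> (x \<otimes>\<^bsub>G\<^esub> z [^]\<^bsub>G\<^esub> (i::nat)) = \<phi> x"
  by simp

lemma img_cm: "g \<in> carrier G \<Longrightarrow> h \<in> carrier G \<Longrightarrow> \<phi> (G.cm g h) = H.cm (\<phi> g) (\<phi> h)"
  by (simp add: G.cm_def H.cm_def)

lemma img_lcs: "\<phi> ` lcs G i = lcs H i"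
proof (induction i)
  case 0
  then show ?case by (simp add: surj)
next
  case (Suc i)
  show ?case
  proof (cases "i = 0")
    case True
    then show ?thesis by (simp add: surj)
  next
    case False
    have "lcs H (Suc i) = generate H (\<Union>u\<in>lcs H i. \<Union>g\<in>carrier H. {H.cm u g})"
      using False by (simp add: H.lcs_Suc)
    also have "(\<Union>u\<in>lcs H i. \<Union>g\<in>carrier H. {H.cm u g}) = \<phi> ` (\<Union>u\<in>lcs G i. \<Union>g\<in>carrier G. {G.cm u g})"
      unfolding Suc.IH[symmetric] surj[symmetric] using G.lcs_carrier
      by (auto simp: img_cm image_UN)
    also have "generate H (\<phi> ` (\<Union>u\<in>lcs G i. \<Union>g\<in>carrier G. {G.cm u g}))
        = \<phi> ` generate G (\<Union>u\<in>lcs G i. \<Union>g\<in>carrier G. {G.cm u g})"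
      using G.lcs_carrier by (intro generate_img) auto
    finally show ?thesis using False by (simp add: G.lcs_Suc)
  qed
qed

lemma card_img:
  assumes "subgroup S G" "z \<in> S" "finite S"
  shows "card S = n * card (\<phi> ` S)"
proof -
  have S: "s \<in> carrier G" if "s \<in> S" for s using subgroup.mem_carrier[OF assms(1) that] .
  have "card {x \<in> S. \<phi> x = y} = n" if "y \<in> \<phi> ` S" for y
  proof -
    obtain s where s: "s \<in> S" "y = \<phi> s" using \<open>y \<in> \<phi> ` S\<close> by auto
    have "{x \<in> S. \<phi> x = y} = (\<lambda>i. s \<otimes>\<^bsub>G\<^esub> z [^]\<^bsub>G\<^esub> i) ` {..<n}"
    proof (intro equalityI subsetI)
      fix x assume "x \<in> {x \<in> S. \<phi> x = y}"
      then have "x \<in> S" "\<phi> s = \<phi> x" using s by auto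
      then show "x \<in> (\<lambda>i. s \<otimes>\<^bsub>G\<^esub> z [^]\<^bsub>G\<^esub> i) ` {..<n}" using fibre[of s x] s S by auto
    next
      fix x assume "x \<in> (\<lambda>i. s \<otimes>\<^bsub>G\<^esub> z [^]\<^bsub>G\<^esub> i) ` {..<n}"
      then obtain i where i: "i < n" "x = s \<otimes>\<^bsub>G\<^esub> z [^]\<^bsub>G\<^esub> i" by auto
      then have "x \<in> S" using s G.nat_pow_in_subgroup[OF assms(1,2)] subgroup.m_closed[OF assms(1)] by simp
      then show "x \<in> {x \<in> S. \<phi> x = y}" using i s S img_mult_z_pow by simp
    qed
    moreover have "inj_on (\<lambda>i. s \<otimes>\<^bsub>G\<^esub> z [^]\<^bsub>G\<^esub> i) {..<n}"
      using s S z_pow_inj by (auto simp: inj_on_def)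
    ultimately show ?thesis by (simp add: card_image)
  qed
  then have "(\<Sum>y\<in>\<phi> ` S. card {x \<in> S. \<phi> x = y}) = n * card (\<phi> ` S)" by simp
  moreover have "card S = (\<Sum>y\<in>\<phi> ` S. card {x \<in> S. \<phi> x = y})"
    using sum.image_gen[OF assms(3), of "\<lambda>_. 1::nat" \<phi>] by simp
  ultimately show ?thesis by simp
qed

text \<open>Summing over cosets of \<open><z>\<close> is the projection of the group algebra of
  \<open>G\<close> onto that of \<open>H\<close>, described by values, with \<open>f'\<close> the
  image of \<open>f\<close>. It intertwines the maps \<open>ad\<close> because \<open>z\<close> is
  central.\<close>

lemma orbit_sum_ad:
  assumes "\<And>x. x \<in> carrier G \<Longrightarrow> (\<Sum>i<n. f (x \<otimes>\<^bsub>G\<^esub> z [^]\<^bsub>G\<^esub> i)) = f' (\<phi> x)"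
    and h: "h \<in> carrier G" and x: "x \<in> carrier G"
  shows "(\<Sum>i<n. ad G h f (x \<otimes>\<^bsub>G\<^esub> z [^]\<^bsub>G\<^esub> i)) = ad H (\<phi> h) f' (\<phi> x)"
proof -
  have "(\<Sum>i<n. ad G h f (x \<otimes>\<^bsub>G\<^esub> z [^]\<^bsub>G\<^esub> i))
      = (\<Sum>i<n. f ((x \<otimes>\<^bsub>G\<^esub> inv\<^bsub>G\<^esub> h) \<otimes>\<^bsub>G\<^esub> z [^]\<^bsub>G\<^esub> i)) - (\<Sum>i<n. f ((inv\<^bsub>G\<^esub> h \<otimes>\<^bsub>G\<^esub> x) \<otimes>\<^bsub>G\<^esub> z [^]\<^bsub>G\<^esub> i))"
    using h x z_pow_central[of "inv\<^bsub>G\<^esub> h"] by (simp add: ad_def G.m_assoc sum_subtractf)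
  also have "\<dots> = ad H (\<phi> h) f' (\<phi> x)"
    using h x by (simp add: assms(1) ad_def)
  finally show ?thesis .
qed

lemma orbit_sum_fold_ad:
  assumes "\<And>x. x \<in> carrier G \<Longrightarrow> (\<Sum>i<n. f (x \<otimes>\<^bsub>G\<^esub> z [^]\<^bsub>G\<^esub> i)) = f' (\<phi> x)"
    and hs: "set hs \<subseteq> carrier G" and x: "x \<in> carrier G"
  shows "(\<Sum>i<n. fold (ad G) hs f (x \<otimes>\<^bsub>G\<^esub> z [^]\<^bsub>G\<^esub> i)) = fold (ad H) (map \<phi> hs) f' (\<phi> x)"
  using assms(1) hs
proof (induction hs arbitrary: f f')
  case Nil
  then show ?case using x by simp
next
  case (Cons h hs)
  have "(\<Sum>i<n. ad G h f (y \<otimes>\<^bsub>G\<^esub> z [^]\<^bsub>G\<^esub> i)) = ad H (\<phi> h) f' (\<phi> y)" if "y \<in> carrier G" for y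
    using orbit_sum_ad[OF Cons.prems(1)] Cons.prems(2) that by simp
  then show ?case using Cons.IH Cons.prems(2) by simp
qed

lemma orbit_sum_delta:
  assumes "g \<in> carrier G" "x \<in> carrier G"
  shows "(\<Sum>i<n. delta g (x \<otimes>\<^bsub>G\<^esub> z [^]\<^bsub>G\<^esub> i)) = (delta (\<phi> g) (\<phi> x) :: 'k::field)"
proof (cases "\<phi> x = \<phi> g")
  case True
  then obtain j where j: "j < n" "g = x \<otimes>\<^bsub>G\<^esub> z [^]\<^bsub>G\<^esub> j"
    using fibre[of x g] assms by auto
  have "(\<Sum>i<n. delta g (x \<otimes>\<^bsub>G\<^esub> z [^]\<^bsub>G\<^esub> i)) = (\<Sum>i<n. if i = j then 1 else 0 :: 'k)"
    using j assms z_pow_inj by (intro sum.cong) (auto simp: delta_def)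
  then show ?thesis using True j by (simp add: delta_def)
next
  case False
  then have "x \<otimes>\<^bsub>G\<^esub> z [^]\<^bsub>G\<^esub> i \<noteq> g" if "i < n" for i
    using img_mult_z_pow[OF assms(2), of i] by auto
  then have "(\<Sum>i<n. delta g (x \<otimes>\<^bsub>G\<^esub> z [^]\<^bsub>G\<^esub> i)) = (0 :: 'k)"
    by (intro sum.neutral) (auto simp: delta_def)
  then show ?thesis using False by (simp add: delta_def)
qed

lemma orbit_sum_fold_ad_delta:
  assumes "g \<in> carrier G" "x \<in> carrier G" "set hs \<subseteq> carrier G"
  shows "(\<Sum>i<n. fold (ad G) hs (delta g) (x \<otimes>\<^bsub>G\<^esub> z [^]\<^bsub>G\<^esub> i))
    = (fold (ad H) (map \<phi> hs) (delta (\<phi> g)) (\<phi> x) :: 'k::field)"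
  by (rule orbit_sum_fold_ad) (use assms orbit_sum_delta in auto)

text \<open>An element annihilated by \<open>z - 1\<close> is a multiple of
  \<open>1 + z + ... + z^(n-1)\<close>: keep the value of \<open>v\<close> at one representative of
  each coset and put 0 elsewhere.\<close>

lemma invariant_imp_orbit_sum:
  assumes v: "(v :: _ \<Rightarrow> 'k::field) \<in> ga_carrier G" and inv: "dif G z v = (\<lambda>_. 0)"
  obtains w where "w \<in> ga_carrier G"
    "\<And>x. x \<in> carrier G \<Longrightarrow> v x = (\<Sum>i<n. w (x \<otimes>\<^bsub>G\<^esub> z [^]\<^bsub>G\<^esub> i))"
proof -
  define r where "r = inv_into (carrier G) \<phi>"
  define w where "w x = (if x \<in> carrier G \<and> x = r (\<phi> x) then v x else 0)" for x
  have vz: "v (x \<otimes>\<^bsub>G\<^esub> z) = v x" if "x \<in> carrier G" for x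
    using fun_cong[OF inv, of "x \<otimes>\<^bsub>G\<^esub> z"] that by (simp add: dif_def tr_def G.m_assoc)
  have vz': "v (x \<otimes>\<^bsub>G\<^esub> z [^]\<^bsub>G\<^esub> i) = v x" if "x \<in> carrier G" for x and i :: nat
  proof (induction i)
    case (Suc i)
    then show ?case using vz[of "x \<otimes>\<^bsub>G\<^esub> z [^]\<^bsub>G\<^esub> i"] that by (simp add: G.m_assoc)
  qed (use that in simp)
  have "w \<in> ga_carrier G"
    using v unfolding ga_carrier_def w_def by (auto elim: finite_subset[rotated])
  moreover have "v x = (\<Sum>i<n. w (x \<otimes>\<^bsub>G\<^esub> z [^]\<^bsub>G\<^esub> i))" if x: "x \<in> carrier G" for x
  proof -
    have r: "r (\<phi> x) \<in> carrier G" "\<phi> (r (\<phi> x)) = \<phi> x"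
      unfolding r_def using x by (auto simp: inv_into_into f_inv_into_f)
    then obtain j where j: "j < n" "r (\<phi> x) = x \<otimes>\<^bsub>G\<^esub> z [^]\<^bsub>G\<^esub> j"
      using fibre[of x "r (\<phi> x)"] x by auto
    have "(\<Sum>i<n. w (x \<otimes>\<^bsub>G\<^esub> z [^]\<^bsub>G\<^esub> i)) = (\<Sum>i<n. if i = j then v x else 0)"
      using x j z_pow_inj by (intro sum.cong) (auto simp: w_def vz' simp del: nat_pow_Suc)
    then show ?thesis using j by simp
  qed
  ultimately show thesis by (rule that)
qed

lemma orbit_sum_ad_inner:
  assumes "\<And>x. x \<in> carrier G \<Longrightarrow> v x = (\<Sum>i<n. w (x \<otimes>\<^bsub>G\<^esub> z [^]\<^bsub>G\<^esub> i))"
    and hs: "set hs \<subseteq> carrier G" and x: "x \<in> carrier G"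
  shows "fold (ad G) hs v x = (\<Sum>i<n. fold (ad G) hs w (x \<otimes>\<^bsub>G\<^esub> z [^]\<^bsub>G\<^esub> i))"
  using assms(1) hs
proof (induction hs arbitrary: v w)
  case Nil
  then show ?case using x by simp
next
  case (Cons h hs)
  have h: "h \<in> carrier G" using Cons.prems by simp
  have "ad G h v y = (\<Sum>i<n. ad G h w (y \<otimes>\<^bsub>G\<^esub> z [^]\<^bsub>G\<^esub> i))" if y: "y \<in> carrier G" for y
    using h y Cons.prems(1)[of "y \<otimes>\<^bsub>G\<^esub> inv\<^bsub>G\<^esub> h"] Cons.prems(1)[of "inv\<^bsub>G\<^esub> h \<otimes>\<^bsub>G\<^esub> y"] z_pow_central[of "inv\<^bsub>G\<^esub> h"]
    by (simp add: ad_def G.m_assoc sum_subtractf)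
  then show ?case using Cons.IH Cons.prems(2) by simp
qed

text \<open>Write \<open>v\<close> as the sum of the translates of some \<open>w\<close> by the
  powers of \<open>z\<close>. A commutator of \<open>v\<close> is then the coset sum of the same
  commutator of \<open>w\<close>, that is, a combination of commutators in \<open>H\<close>, and
  these vanish.\<close>

lemma ad_zero_of_invariant:
  assumes H: "lie_zero TYPE('k) H k"
    and v: "(v :: _ \<Rightarrow> 'k::field) \<in> ga_carrier G" and inv: "dif G z v = (\<lambda>_. 0)"
  shows "ad_zero G k v"
  unfolding ad_zero_def
proof (intro allI impI ext)
  fix hs x assume hs: "set hs \<subseteq> carrier G" "length hs = k"
  obtain w where w: "w \<in> ga_carrier G" "\<And>x. x \<in> carrier G \<Longrightarrow> v x = (\<Sum>i<n. w (x \<otimes>\<^bsub>G\<^esub> z [^]\<^bsub>G\<^esub> i))"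
    using invariant_imp_orbit_sum[OF v inv] by blast
  show "fold (ad G) hs v x = 0"
  proof (cases "x \<in> carrier G")
    case x: True
    have map_hs: "set (map \<phi> hs) \<subseteq> carrier H" "length (map \<phi> hs) = k" using hs by auto
    have "fold (ad G) hs v x = (\<Sum>i<n. fold (ad G) hs w (x \<otimes>\<^bsub>G\<^esub> z [^]\<^bsub>G\<^esub> i))"
      by (rule orbit_sum_ad_inner[OF w(2) hs(1) x])
    also have "\<dots> = (\<Sum>i<n. \<Sum>g\<in>{g. w g \<noteq> 0}. w g * fold (ad G) hs (delta g) (x \<otimes>\<^bsub>G\<^esub> z [^]\<^bsub>G\<^esub> i))"
      by (subst fin_supp_eq_sum_delta[OF w(1)], subst fold_ad_sum) simp
    also have "\<dots> = (\<Sum>g\<in>{g. w g \<noteq> 0}. w g * (\<Sum>i<n. fold (ad G) hs (delta g) (x \<otimes>\<^bsub>G\<^esub> z [^]\<^bsub>G\<^esub> i)))"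
      by (subst sum.swap) (simp add: sum_distrib_left)
    also have "\<dots> = 0"
    proof (intro sum.neutral ballI)
      fix g assume "g \<in> {g. w g \<noteq> 0}"
      then have g: "g \<in> carrier G" using w(1) by (auto simp: ga_carrier_def)
      have "\<phi> g \<in> carrier H" using g by simp
      have "(\<Sum>i<n. fold (ad G) hs (delta g) (x \<otimes>\<^bsub>G\<^esub> z [^]\<^bsub>G\<^esub> i)) = (0 :: 'k)"
        unfolding orbit_sum_fold_ad_delta[OF g x hs(1)] lie_zeroD[OF H \<open>\<phi> g \<in> carrier H\<close> map_hs] ..
      then show "w g * (\<Sum>i<n. fold (ad G) hs (delta g) (x \<otimes>\<^bsub>G\<^esub> z [^]\<^bsub>G\<^esub> i)) = 0" by simp
    qed
    finally show ?thesis .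
  next
    case False
    then show ?thesis using G.ga_carrier_outside[OF v] by (intro G.ad_outside) auto
  qed
qed

lemma dif_ad: "h \<in> carrier G \<Longrightarrow> dif G z (ad G h f) = ad G h (dif G z f)"
proof
  fix x assume h: "h \<in> carrier G"
  have "inv\<^bsub>G\<^esub> z \<otimes>\<^bsub>G\<^esub> inv\<^bsub>G\<^esub> h = inv\<^bsub>G\<^esub> h \<otimes>\<^bsub>G\<^esub> inv\<^bsub>G\<^esub> z"
    using central[of h] h by (metis G.inv_mult_group z)
  then show "dif G z (ad G h f) x = ad G h (dif G z f) x"
    using h by (auto simp: dif_def tr_def ad_def G.m_assoc)
qed

lemma funpow_dif_ad: "h \<in> carrier G \<Longrightarrow> (dif G z ^^ i) (ad G h f) = ad G h ((dif G z ^^ i) f)"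
  by (induction i) (simp_all add: dif_ad)

lemma funpow_dif_fold_ad:
  "set hs \<subseteq> carrier G \<Longrightarrow> (dif G z ^^ i) (fold (ad G) hs f) = fold (ad G) hs ((dif G z ^^ i) f)"
  by (induction hs arbitrary: f) (simp_all add: funpow_dif_ad)

lemma fold_ad_in_ga_carrier: "set hs \<subseteq> carrier G \<Longrightarrow> f \<in> ga_carrier G \<Longrightarrow> fold (ad G) hs f \<in> ga_carrier G"
  by (induction hs arbitrary: f) (simp_all add: G.ad_in_ga_carrier)

text \<open>Once commutators of length \<open>k\<close> vanish modulo \<open>z\<close>, every further block of \<open>k\<close>
  commutators gains a factor \<open>z - 1\<close>, and \<open>(z - 1) ^ p = 0\<close>.\<close>

lemma lie_zero_lift:
  assumes H: "lie_zero TYPE('k::field) H k" and p: "CHAR('k) = p" "prime p" "n = p"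
  shows "lie_zero TYPE('k) G (k * p)"
proof -
  have *: "ad_zero G (k * i) v" if "(v :: _ \<Rightarrow> 'k) \<in> ga_carrier G" "(dif G z ^^ i) v = (\<lambda>_. 0)" for i v
    using that
  proof (induction i arbitrary: v)
    case 0
    then show ?case by (simp add: ad_zero_def)
  next
    case (Suc i)
    \<comment> \<open>The element \<open>(z - 1)^i v\<close> is annihilated by \<open>z - 1\<close>,
      so the first \<open>k\<close> commutators kill it. As \<open>dif G z\<close> commutes with
      \<open>ad\<close>, the outcome of these \<open>k\<close> commutators on \<open>v\<close>
      itself is annihilated by \<open>(z - 1)^i\<close>, and the induction hypothesis takes
      over.\<close>
    have "ad_zero G k ((dif G z ^^ i) v)"
      using Suc.prems by (intro ad_zero_of_invariant[OF H]) (simp_all add: G.funpow_dif_in_ga_carrier)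
    show ?case
      unfolding ad_zero_def
    proof (intro allI impI)
      fix hs assume hs: "set hs \<subseteq> carrier G" "length hs = k * Suc i"
      let ?h1 = "take k hs" and ?h2 = "drop k hs"
      have h12: "set ?h1 \<subseteq> carrier G" "length ?h1 = k" "set ?h2 \<subseteq> carrier G" "length ?h2 = k * i"
        using hs set_take_subset[of k hs] set_drop_subset[of k hs] by auto
      have "(dif G z ^^ i) (fold (ad G) ?h1 v) = (\<lambda>_. 0)"
        using \<open>ad_zero G k ((dif G z ^^ i) v)\<close> h12 by (simp add: funpow_dif_fold_ad ad_zero_def)
      then have "ad_zero G (k * i) (fold (ad G) ?h1 v)"
        using Suc.IH fold_ad_in_ga_carrier[OF h12(1) Suc.prems(1)] by blast
      then have "fold (ad G) ?h2 (fold (ad G) ?h1 v) = (\<lambda>_. 0)"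
        using h12 by (simp only: ad_zero_def)
      then have "fold (ad G) (?h1 @ ?h2) v = (\<lambda>_. 0)"
        by (simp only: fold_append comp_apply)
      then show "fold (ad G) hs v = (\<lambda>_. 0)" by (simp only: append_take_drop_id)
    qed
  qed
  show ?thesis
    unfolding lie_zero_def
  proof
    fix g assume g: "g \<in> carrier G"
    have d: "(delta g :: _ \<Rightarrow> 'k) \<in> ga_carrier G" by (rule G.delta_in_ga_carrier[OF g])
    have "(dif G z ^^ p) (delta g :: _ \<Rightarrow> 'k) = dif G (z [^]\<^bsub>G\<^esub> p) (delta g)"
      by (rule G.dif_funpow_prime[OF d z p(1,2)])
    also have "\<dots> = (\<lambda>_. 0)"
      using z_pow_n p(3) G.tr_one[of "delta g :: _ \<Rightarrow> 'k"] G.ga_carrier_outside[OF d] by (simp add: dif_def)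
    finally show "ad_zero G (k * p) (delta g :: _ \<Rightarrow> 'k)" using *[OF d] by simp
  qed
qed

end

section \<open>Finite derived subgroups of prime power order\<close>
lemma prime_power_if_only_prime_divisor:
  fixes n p :: nat
  assumes "n > 0" "prime p" "\<And>l. prime l \<Longrightarrow> l dvd n \<Longrightarrow> l = p"
  obtains m where "n = p ^ m"
proof -
  obtain k where k: "n = p ^ multiplicity p n * k" "\<not> p dvd k"
    using multiplicity_decompose'[of n p] assms by (metis not_gr_zero not_prime_unit)
  have "k = 1"
  proof (rule ccontr)
    assume "k \<noteq> 1"
    then obtain l where "prime l" "l dvd k" using prime_factor_nat by blast
    then show False using assms(3)[of l] k by (metis dvd_mult)
  qed
  then show thesis using that k by simp
qed

lemma mult_eq_0_of_coprime_exponent: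
  fixes l :: nat
  assumes "prime l" "prime p" "l \<noteq> p" "l dvd i * p ^ s"
  shows "l dvd i"
  using assms by (metis prime_dvd_mult_iff prime_dvd_power primes_dvd_imp_eq)

definition powers_central :: "('a, 'b) monoid_scheme \<Rightarrow> nat \<Rightarrow> bool" where
  "powers_central G q \<longleftrightarrow> (\<forall>g\<in>carrier G. \<forall>b\<in>carrier G.
     g \<otimes>\<^bsub>G\<^esub> b [^]\<^bsub>G\<^esub> q = b [^]\<^bsub>G\<^esub> q \<otimes>\<^bsub>G\<^esub> g)"

lemma (in central_quotient) powers_central_quotient:
  assumes "powers_central G q"
  shows "powers_central H q"
  unfolding powers_central_def surj[symmetric]
proof clarify
  fix g b assume gb: "g \<in> carrier G" "b \<in> carrier G"
  have "\<phi> (g \<otimes>\<^bsub>G\<^esub> b [^]\<^bsub>G\<^esub> q) = \<phi> (b [^]\<^bsub>G\<^esub> q \<otimes>\<^bsub>G\<^esub> g)"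
    using assms gb by (simp add: powers_central_def)
  then show "\<phi> g \<otimes>\<^bsub>H\<^esub> \<phi> b [^]\<^bsub>H\<^esub> q = \<phi> b [^]\<^bsub>H\<^esub> q \<otimes>\<^bsub>H\<^esub> \<phi> g"
    using gb by (simp add: hom_nat_pow)
qed

context group
begin

lemma sylow_subgroup:
  assumes "subgroup A G" "finite A" "prime l" "card A = l ^ a * m"
  obtains P where "subgroup P G" "P \<subseteq> A" "card P = l ^ a"
proof -
  have "\<exists>P. subgroup P (G\<lparr>carrier := A\<rparr>) \<and> card P = l ^ a"
    using assms by (intro sylow_thm[where m = m] subgroup_imp_group) (auto simp: order_def)
  then obtain P where P: "subgroup P (G\<lparr>carrier := A\<rparr>)" "card P = l ^ a" by auto
  then have "P \<subseteq> A" using subgroup.subset by fastforce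
  moreover have "subgroup P G" using incl_subgroup[OF assms(1) P(1)] .
  ultimately show thesis using that P by blast
qed

lemma cauchy:
  assumes A: "subgroup A G" "finite A" and l: "prime l" "l dvd card A"
  obtains x where "x \<in> A" "ord x = l"
proof -
  obtain m where "card A = l ^ 1 * m" using l by auto
  then obtain P where P: "subgroup P G" "P \<subseteq> A" "card P = l ^ 1"
    using sylow_subgroup[OF A l(1)] by blast
  have "card P > 1" using P l prime_gt_1_nat by simp
  then obtain x where x: "x \<in> P" "x \<noteq> \<one>"
    using subgroup.one_closed[OF P(1)] by (metis (no_types) card_le_Suc0_iff_eq card.infinite leD One_nat_def linorder_not_less less_nat_zero_code)
  have "ord x dvd l" using ord_dvd_subgroup_card[OF P(1) x(1)] P by simp
  moreover have "ord x \<noteq> 1" using ord_eq_1 x subgroup.mem_carrier[OF P(1)] by simp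
  ultimately have "ord x = l" using l(1) by (metis prime_nat_iff)
  then show thesis using that x P by blast
qed

lemma pow_mod_ord: "x \<in> carrier G \<Longrightarrow> x [^] (i mod ord x) = x [^] (i :: nat)"
proof -
  assume x: "x \<in> carrier G"
  have "x [^] i = x [^] (ord x * (i div ord x) + i mod ord x)" by simp
  also have "\<dots> = (x [^] ord x) [^] (i div ord x) \<otimes> x [^] (i mod ord x)"
    using x by (simp only: nat_pow_mult nat_pow_pow nat_pow_closed)
  finally show ?thesis using x by simp
qed

lemma power_generates_of_coprime:
  assumes "x \<in> carrier G" "coprime q (ord x)" "ord x > 0"
  obtains u :: nat where "x = (x [^] q) [^] u"
proof -
  obtain u where "[q * u = 1] (mod (ord x))"
    using cong_solve_coprime_nat[OF assms(2)] by auto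
  then have "x [^] (q * u) = x [^] (1::nat)"
    using pow_mod_ord[OF assms(1)] unfolding cong_def by metis
  then show thesis using that[of u] assms by (simp add: nat_pow_pow)
qed

text \<open>The step of a minimal counterexample argument. An element \<open>z\<close> of prime
  order \<open>l \<noteq> p\<close> is a power of its own \<open>p^s\<close>-th power, hence
  central. By induction \<open>N/<z>\<close> is a \<open>p\<close>-group, so \<open>N\<close> is the
  product of \<open><z>\<close> and a Sylow subgroup \<open>P\<close>. Modulo \<open>P\<close> the
  commutator is multiplicative in its first argument, and as \<open>p^s\<close>-th powers are
  central it must be trivial there; so \<open>N = P\<close>, a contradiction.\<close>

lemma derived_p_group_step:
  assumes fin: "finite (lcs G 2)" and pc: "powers_central G (p ^ s)" and p: "prime p"
    and IH: "\<And>H :: ('a, 'b) monoid_scheme. group H \<Longrightarrow> card (lcs H 2) < card (lcs G 2) \<Longrightarrow>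
      finite (lcs H 2) \<Longrightarrow> powers_central H (p ^ s) \<Longrightarrow> \<exists>m. card (lcs H 2) = p ^ m"
  shows "\<exists>m. card (lcs G 2) = p ^ m"
proof -
  let ?N = "lcs G 2"
  have N: "subgroup ?N G" by (rule lcs_subgroup)
  have N0: "card ?N > 0" using fin one_in_lcs[of 2] by (metis card_gt_0_iff empty_iff)
  show ?thesis
  proof (rule ccontr)
    assume no: "\<nexists>m. card ?N = p ^ m"
    obtain l where l: "prime l" "l dvd card ?N" "l \<noteq> p"
      using prime_power_if_only_prime_divisor[OF N0 p] no by metis
    obtain z where z: "z \<in> ?N" "ord z = l" using cauchy[OF N fin l(1,2)] .
    have zG: "z \<in> carrier G" using z lcs_carrier by blast
    have l0: "ord z > 0" using z l prime_gt_0_nat by simp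
    have "coprime (p ^ s) (ord z)"
      using z l p by (metis coprime_power_left_iff primes_coprime)
    then obtain u :: nat where u: "z = (z [^] (p ^ s)) [^] u"
      using power_generates_of_coprime[OF zG _ l0] by blast
    have central_pow: "g \<otimes> (z [^] (p ^ s)) [^] i = (z [^] (p ^ s)) [^] i \<otimes> g" if "g \<in> carrier G" for g and i :: nat
    proof (induction i)
      case (Suc i)
      let ?w = "z [^] (p ^ s)"
      have w: "?w \<in> carrier G" "g \<otimes> ?w = ?w \<otimes> g" using zG pc that by (auto simp: powers_central_def)
      have "g \<otimes> ?w [^] Suc i = (g \<otimes> ?w [^] i) \<otimes> ?w" using w that by (simp add: m_assoc)
      also have "\<dots> = ?w [^] i \<otimes> (g \<otimes> ?w)" using Suc w that by (simp add: m_assoc)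
      also have "\<dots> = ?w [^] Suc i \<otimes> g" using w that by (simp add: m_assoc)
      finally show ?case .
    qed (use that in simp)
    have central: "g \<otimes> z = z \<otimes> g" if "g \<in> carrier G" for g
      using central_pow[OF that, of u] u by simp
    obtain H :: "('a, 'b) monoid_scheme" and \<phi> where "central_quotient G H \<phi> z (ord z)"
      using central_quotient_exists[OF zG central l0] by blast
    then interpret Q: central_quotient G H \<phi> z l using z by simp
    have card: "card ?N = l * card (lcs H 2)"
      using Q.card_img[OF N z(1) fin] Q.img_lcs[of 2] by simp
    have "card (lcs H 2) < card ?N" using card N0 l prime_gt_1_nat by simp
    moreover have "finite (lcs H 2)" using fin Q.img_lcs[of 2] by (metis finite_imageI)
    ultimately obtain m where m: "card (lcs H 2) = p ^ m"
      using IH[OF Q.H.is_group] Q.powers_central_quotient[OF pc] by blast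
    obtain P where P: "subgroup P G" "P \<subseteq> ?N" "card P = p ^ m"
      using sylow_subgroup[OF N fin p, of m l] card m by (metis mult.commute)
    have Pc: "x \<in> carrier G" if "x \<in> P" for x using subgroup.mem_carrier[OF P(1) that] .
    have Ppow: "x [^] (p ^ m) = \<one>" if "x \<in> P" for x using pow_card_eq_one[OF P(1) that] P(3) by simp
    \<comment> \<open>The order of \<open>z\<close> is prime to \<open>p\<close>, so raising to a
      \<open>p\<close>-power kills no nontrivial power of \<open>z\<close>.\<close>
    have z_pow: "i = 0" if "i < l" "z [^] (i * p ^ t) = \<one>" for i t
    proof -
      have "l dvd i * p ^ t" using that pow_eq_id[OF zG] z by simp
      then have "l dvd i" using mult_eq_0_of_coprime_exponent[OF l(1) p l(3)] by blast
      then show ?thesis using that by auto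
    qed
    have inj: "inj_on \<phi> P"
    proof (rule inj_onI)
      fix x y assume xy: "x \<in> P" "y \<in> P" "\<phi> x = \<phi> y"
      then obtain i where i: "i < l" "y = x \<otimes> z [^] i" using Q.fibre[of x y] Pc by auto
      then have "z [^] i = inv x \<otimes> y" using xy Pc zG by (simp add: m_assoc[symmetric])
      then have "z [^] i \<in> P" using xy P(1) subgroup.m_closed subgroup.m_inv_closed by fastforce
      then have "z [^] (i * p ^ m) = \<one>" using Ppow[of "z [^] i"] zG by (simp add: nat_pow_pow)
      then have "i = 0" using z_pow i by blast
      then show "x = y" using i xy Pc by simp
    qed
    have "\<phi> ` P \<subseteq> lcs H 2" using P Q.img_lcs[of 2] by blast
    moreover have "card (\<phi> ` P) = card (lcs H 2)" using inj P m by (simp add: card_image)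
    ultimately have imgP: "\<phi> ` P = lcs H 2"
      using card_subset_eq[OF \<open>finite (lcs H 2)\<close>] by blast
    have decomp: "\<exists>\<pi>\<in>P. \<exists>i<l. x = \<pi> \<otimes> z [^] i" if "x \<in> ?N" for x
    proof -
      have "\<phi> x \<in> \<phi> ` P" using that imgP Q.img_lcs[of 2] by blast
      then obtain \<pi> where "\<pi> \<in> P" "\<phi> \<pi> = \<phi> x" by auto
      then show ?thesis using Q.fibre[of \<pi> x] Pc lcs_carrier[OF that] by blast
    qed
     \<comment> \<open>Inside \<open>N\<close>, belonging to \<open>P\<close> is a condition on the
       order of an element, and conjugation preserves it. This is what makes \<open>P\<close> normal
       in \<open>G\<close>.\<close>
     have P_iff: "x \<in> P" if xN: "x \<in> ?N" and xpt: "x [^] (p ^ t) = \<one>" and tm: "t \<ge> m" for x t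
    proof -
      obtain \<pi> i where x: "\<pi> \<in> P" "i < l" "x = \<pi> \<otimes> z [^] i" using decomp[OF xN] by blast
      have "x [^] (p ^ t) = \<pi> [^] (p ^ t) \<otimes> (z [^] i) [^] (p ^ t)"
        unfolding x(3) using x Pc zG Q.z_pow_central by (intro pow_mult_distrib) auto
      moreover have "\<pi> [^] (p ^ t) = \<one>"
      proof -
        have "p ^ t = p ^ m * p ^ (t - m)" using tm by (simp add: power_add[symmetric])
        then show ?thesis using Ppow[OF x(1)] Pc[OF x(1)] by (metis nat_pow_one nat_pow_pow)
      qed
      ultimately have "z [^] (i * p ^ t) = \<one>" using xpt x zG by (simp add: nat_pow_pow)
      then have "i = 0" using z_pow x by blast
      then show ?thesis using x Pc by simp
    qed
    have P_conj: "g \<otimes> x \<otimes> inv g \<in> P" if "x \<in> P" "g \<in> carrier G" for g x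
    proof (rule P_iff[of _ m])
      show "g \<otimes> x \<otimes> inv g \<in> ?N" using that P lcs_conj by blast
      have "(g \<otimes> x \<otimes> inv g) [^] k = g \<otimes> x [^] k \<otimes> inv g" for k :: nat
        using that Pc by (induction k) (simp_all add: word_simps)
      then show "(g \<otimes> x \<otimes> inv g) [^] (p ^ m) = \<one>" using Ppow that by simp
    qed simp
    have cm_P: "cm x y \<in> P" if xy: "x \<in> carrier G" "y \<in> carrier G" for x y
    proof -
      obtain \<pi> i where c: "\<pi> \<in> P" "i < l" "cm x y = \<pi> \<otimes> z [^] i"
        using decomp[OF cm_in_derived[OF xy]] by blast
      \<comment> \<open>The \<open>z\<close>-parts add up: normality of \<open>P\<close> absorbs
        every other factor produced when \<open>cm (x^(k+1)) y\<close> is expanded. At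
        \<open>k = p^s\<close> the commutator itself is trivial, which forces
        \<open>i = 0\<close>.\<close>
      have *: "\<exists>\<rho>\<in>P. cm (x [^] k) y = \<rho> \<otimes> z [^] (i * k)" for k :: nat
      proof (induction k)
        case 0
        have "cm (x [^] (0::nat)) y = \<one> \<otimes> z [^] (i * 0)" using xy by (simp add: cm_def)
        then show ?case using subgroup.one_closed[OF P(1)] by blast
      next
        case (Suc k)
        then obtain \<rho> where \<rho>: "\<rho> \<in> P" "cm (x [^] k) y = \<rho> \<otimes> z [^] (i * k)" by blast
        have "cm (x [^] Suc k) y = cm (x \<otimes> x [^] k) y" using xy nat_pow_Suc2 by simp
        also have "\<dots> = x \<otimes> (\<rho> \<otimes> z [^] (i * k)) \<otimes> inv x \<otimes> (\<pi> \<otimes> z [^] i)"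
          using xy \<rho> c by (simp add: cm_mult_left)
        also have "\<dots> = x \<otimes> \<rho> \<otimes> (z [^] (i * k) \<otimes> (inv x \<otimes> \<pi>)) \<otimes> z [^] i"
          using xy \<rho> c Pc zG by (simp add: m_assoc)
        also have "\<dots> = x \<otimes> \<rho> \<otimes> ((inv x \<otimes> \<pi>) \<otimes> z [^] (i * k)) \<otimes> z [^] i"
          using xy c Pc Q.z_pow_central[of "inv x \<otimes> \<pi>"] by simp
        also have "\<dots> = (x \<otimes> \<rho> \<otimes> inv x) \<otimes> \<pi> \<otimes> (z [^] (i * k) \<otimes> z [^] i)"
          using xy \<rho> c Pc zG by (simp add: m_assoc)
        also have "z [^] (i * k) \<otimes> z [^] i = z [^] (i * Suc k)"
          using zG by (simp add: nat_pow_mult add.commute)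
        finally show ?case using P_conj[OF \<rho>(1) xy(1)] subgroup.m_closed[OF P(1) _ c(1)] by blast
      qed
      obtain \<rho> where \<rho>: "\<rho> \<in> P" "cm (x [^] (p ^ s)) y = \<rho> \<otimes> z [^] (i * p ^ s)" using *[of "p ^ s"] by blast
      have "cm (x [^] (p ^ s)) y = \<one>"
        using xy pc by (simp add: cm_eq_one_iff powers_central_def)
      then have "z [^] (i * p ^ s) = inv \<rho>" using \<rho> Pc zG by (metis inv_equality inv_inv nat_pow_closed inv_closed)
      then have "z [^] (i * p ^ s) \<in> P" using \<rho> subgroup.m_inv_closed[OF P(1)] by simp
      then have "z [^] (i * p ^ (s + m)) = \<one>" using Ppow[of "z [^] (i * p ^ s)"] zG by (simp add: nat_pow_pow power_add mult.assoc)
      then have "i = 0" using z_pow c by blast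
      then show ?thesis using c Pc by simp
    qed
    have "?N \<subseteq> P"
      using lcs_Suc_least[OF P(1), of 1] cm_P by (simp add: numeral_2_eq_2)
    then have "?N = P" using P by blast
    then show False using no P(3) by blast
  qed
qed

end

lemma derived_p_group:
  fixes G :: "('a, 'b) monoid_scheme"
  assumes "group G" "finite (lcs G 2)" "powers_central G (p ^ s)" "prime p"
  shows "\<exists>m. card (lcs G 2) = p ^ m"
  using assms(1-3)
proof (induction "card (lcs G 2)" arbitrary: G rule: less_induct)
  case less
  show ?case
    by (rule group.derived_p_group_step[OF less.prems assms(4)]) (rule less.hyps)
qed

section \<open>Fixed points of conjugation on finite normal \<open>p\<close>-subgroups\<close>

lemma finite_BijGroup: "finite M \<Longrightarrow> finite (carrier (BijGroup M))"
proof -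
  assume "finite M"
  then have "finite (M \<rightarrow>\<^sub>E M)" by (intro finite_PiE)
  moreover have "carrier (BijGroup M) \<subseteq> M \<rightarrow>\<^sub>E M"
    by (auto simp: BijGroup_def Bij_def PiE_def bij_betw_def)
  ultimately show ?thesis by (rule finite_subset[rotated])
qed

context group
begin

lemma conj_hom_BijGroup:
  assumes sub: "M \<subseteq> carrier G" and conj: "\<And>g m. g \<in> carrier G \<Longrightarrow> m \<in> M \<Longrightarrow> g \<otimes> m \<otimes> inv g \<in> M"
  shows "(\<lambda>g. \<lambda>m\<in>M. g \<otimes> m \<otimes> inv g) \<in> hom G (BijGroup M)"
proof (rule homI)
  have Bij: "(\<lambda>m\<in>M. g \<otimes> m \<otimes> inv g) \<in> Bij M" if g: "g \<in> carrier G" for g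
  proof -
    have "bij_betw (\<lambda>m. g \<otimes> m \<otimes> inv g) M M"
    proof (rule bij_betw_byWitness[where f' = "\<lambda>m. inv g \<otimes> m \<otimes> g"])
      show "\<forall>m\<in>M. inv g \<otimes> (g \<otimes> m \<otimes> inv g) \<otimes> g = m" "\<forall>m\<in>M. g \<otimes> (inv g \<otimes> m \<otimes> g) \<otimes> inv g = m"
        using g sub by (auto simp: m_assoc subset_iff)
      show "(\<lambda>m. g \<otimes> m \<otimes> inv g) ` M \<subseteq> M" using conj g by auto
      show "(\<lambda>m. inv g \<otimes> m \<otimes> g) ` M \<subseteq> M" using conj[of "inv g"] g by auto
    qed
    then have "bij_betw (\<lambda>m\<in>M. g \<otimes> m \<otimes> inv g) M M"
      by (rule bij_betw_cong[THEN iffD1, rotated]) simp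
    then show ?thesis unfolding Bij_def by simp
  qed
  show "(\<lambda>m\<in>M. g \<otimes> m \<otimes> inv g) \<in> carrier (BijGroup M)" if "g \<in> carrier G" for g
    using Bij[OF that] by (simp add: BijGroup_def)
  show "(\<lambda>m\<in>M. (g \<otimes> h) \<otimes> m \<otimes> inv (g \<otimes> h))
      = (\<lambda>m\<in>M. g \<otimes> m \<otimes> inv g) \<otimes>\<^bsub>BijGroup M\<^esub> (\<lambda>m\<in>M. h \<otimes> m \<otimes> inv h)"
    if gh: "g \<in> carrier G" "h \<in> carrier G" for g h
  proof -
    have "(\<lambda>m\<in>M. (g \<otimes> h) \<otimes> m \<otimes> inv (g \<otimes> h))
      = compose M (\<lambda>m\<in>M. g \<otimes> m \<otimes> inv g) (\<lambda>m\<in>M. h \<otimes> m \<otimes> inv h)"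
      unfolding compose_def
    proof (rule restrict_ext)
      fix m assume "m \<in> M"
      then show "(g \<otimes> h) \<otimes> m \<otimes> inv (g \<otimes> h) = (\<lambda>m\<in>M. g \<otimes> m \<otimes> inv g) ((\<lambda>m\<in>M. h \<otimes> m \<otimes> inv h) m)"
        using gh sub conj[of h m] by (simp add: word_simps subset_iff)
    qed
    then show ?thesis using Bij gh by (simp add: BijGroup_def)
  qed
qed

text \<open>As \<open>G\<close> may be infinite, orbits are counted for its image in the
  permutations of \<open>M\<close>. This image is finite, and a \<open>p\<close>-group because
  \<open>g^(p^s)\<close> acts trivially. So all orbits have \<open>p\<close>-power length;
  \<open>p\<close> divides \<open>|M|\<close> and \<open>\<one>\<close> is a fixed point, hence
  there is another one, and fixed points of conjugation are central.\<close>

lemma normal_p_subgroup_fixed_point: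
  assumes M: "subgroup M G" and conj: "\<And>g m. g \<in> carrier G \<Longrightarrow> m \<in> M \<Longrightarrow> g \<otimes> m \<otimes> inv g \<in> M"
    and fin: "finite M" and p: "prime p" "p dvd card M" and pc: "powers_central G (p ^ s)"
  obtains z where "z \<in> M" "z \<noteq> \<one>" "\<And>g. g \<in> carrier G \<Longrightarrow> g \<otimes> z = z \<otimes> g"
proof -
  have sub: "M \<subseteq> carrier G" using subgroup.subset[OF M] .
  let ?\<Theta> = "\<lambda>g. \<lambda>m\<in>M. g \<otimes> m \<otimes> inv g"
  let ?A = "(BijGroup M)\<lparr>carrier := ?\<Theta> ` carrier G\<rparr>"
  interpret B: group "BijGroup M" by (rule group_BijGroup)
  interpret \<Theta>: group_hom G "BijGroup M" ?\<Theta>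
    by (intro group_hom.intro group_hom_axioms.intro is_group B.is_group conj_hom_BijGroup[OF sub conj])
  have subA: "subgroup (?\<Theta> ` carrier G) (BijGroup M)" by (rule \<Theta>.img_is_subgroup)
  interpret A: group ?A by (rule B.subgroup_imp_group[OF subA])
  have "(\<lambda>a. a) \<in> hom ?A (BijGroup M)"
    using subgroup.subset[OF subA] by (auto simp: hom_def)
  then interpret act: group_action ?A M "\<lambda>a. a"
    by (intro group_action.intro group_hom.intro group_hom_axioms.intro A.is_group B.is_group)
  have finA: "finite (?\<Theta> ` carrier G)"
    using finite_subset[OF subgroup.subset[OF subA] finite_BijGroup[OF fin]] .
  have pos: "card (?\<Theta> ` carrier G) > 0" using finA by (auto simp: card_gt_0_iff)
  \<comment> \<open>Cauchy's theorem in the image: an element of prime order \<open>l\<close> is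
    induced by some \<open>g\<close>, and its \<open>p^s\<close>-th power is trivial, so
    \<open>l = p\<close>.\<close>
  have only: "l = p" if l: "prime l" "l dvd card (?\<Theta> ` carrier G)" for l
  proof -
    obtain a where a: "a \<in> ?\<Theta> ` carrier G" "B.ord a = l" using B.cauchy[OF subA finA l] .
    then obtain g where g: "g \<in> carrier G" "a = ?\<Theta> g" by blast
    have "a [^]\<^bsub>BijGroup M\<^esub> (p ^ s) = ?\<Theta> (g [^] (p ^ s))"
      using g by (simp only: \<Theta>.hom_nat_pow)
    also have "\<dots> = ?\<Theta> \<one>"
    proof (rule restrict_ext)
      fix m assume "m \<in> M"
      then have m: "m \<in> carrier G" using sub by blast
      have "g [^] (p ^ s) \<otimes> m = m \<otimes> g [^] (p ^ s)"
        using pc g m unfolding powers_central_def by metis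
      then show "g [^] (p ^ s) \<otimes> m \<otimes> inv (g [^] (p ^ s)) = \<one> \<otimes> m \<otimes> inv \<one>"
        using g m by (simp add: m_assoc)
    qed
    also have "\<dots> = \<one>\<^bsub>BijGroup M\<^esub>" using \<Theta>.hom_one .
    finally have "l dvd p ^ s" using B.pow_eq_id a \<Theta>.hom_closed[OF g(1)] g by metis
    then show "l = p" using l(1) p(1) by (metis prime_dvd_power primes_dvd_imp_eq)
  qed
  obtain j where j: "card (?\<Theta> ` carrier G) = p ^ j"
    by (rule prime_power_if_only_prime_divisor[OF pos p(1) only])
  have orbit_p: "p dvd card (orbit ?A (\<lambda>a. a) m)" if m: "m \<in> M" and ne: "card (orbit ?A (\<lambda>a. a) m) \<noteq> 1" for m
  proof -
    have "card (orbit ?A (\<lambda>a. a) m) * card (stabilizer ?A (\<lambda>a. a) m) = p ^ j"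
      using act.orbit_stabilizer_theorem[OF m] j by (simp add: order_def)
    then have "card (orbit ?A (\<lambda>a. a) m) dvd p ^ j" by (rule dvdI[OF sym])
    then obtain i where "card (orbit ?A (\<lambda>a. a) m) = p ^ i"
      using divides_primepow_nat[OF p(1)] by blast
    then show ?thesis using ne by (cases i) auto
  qed
  have part: "partition M (orbits ?A M (\<lambda>a. a))" by (rule act.orbit_partition)
  have orb_one: "orbit ?A (\<lambda>a. a) \<one> = {\<one>}"
  proof -
    have "a \<one> = \<one>" if "a \<in> ?\<Theta> ` carrier G" for a
      using that subgroup.one_closed[OF M] by auto
    then have "orbit ?A (\<lambda>a. a) \<one> \<subseteq> {\<one>}" unfolding orbit_def by auto
    then show ?thesis using act.orbit_refl[OF subgroup.one_closed[OF M]] by blast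
  qed
  have "\<exists>m\<in>M. m \<noteq> \<one> \<and> card (orbit ?A (\<lambda>a. a) m) = 1"
  proof (rule ccontr)
    assume no: "\<not> ?thesis"
    let ?O = "orbits ?A M (\<lambda>a. a)"
    have mem: "\<exists>m\<in>M. b = orbit ?A (\<lambda>a. a) m" if "b \<in> ?O" for b
      using that unfolding orbits_def by blast
    have finO: "finite ?O"
      unfolding orbits_def using fin by simp
    have one_O: "{\<one>} \<in> ?O"
      unfolding orbits_def using orb_one subgroup.one_closed[OF M] by blast
    have "card M = (\<Sum>b\<in>?O. card b)"
      using partition.disjoint_sum[OF part fin, of "\<lambda>_. 1 :: nat"] by simp
    also have "\<dots> = 1 + (\<Sum>b\<in>?O - {{\<one>}}. card b)"
      using sum.remove[OF finO one_O, of card] by simp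
    finally have eq: "card M = 1 + (\<Sum>b\<in>?O - {{\<one>}}. card b)" .
    have dv: "p dvd (\<Sum>b\<in>?O - {{\<one>}}. card b)"
    proof (rule dvd_sum)
      fix b assume b: "b \<in> ?O - {{\<one>}}"
      then obtain m where m: "m \<in> M" "b = orbit ?A (\<lambda>a. a) m" using mem by blast
      have "m \<noteq> \<one>" using b m orb_one by auto
      then show "p dvd card b" using orbit_p[OF m(1)] no m by blast
    qed
    have "p dvd 1"
      using p(2)[unfolded eq] unfolding dvd_add_left_iff[OF dv] .
    then show False using p(1) by (metis not_prime_unit)
  qed
  then obtain m where m: "m \<in> M" "m \<noteq> \<one>" "card (orbit ?A (\<lambda>a. a) m) = 1" by blast
  show thesis
  proof (rule that[OF m(1,2)])
    fix g assume g: "g \<in> carrier G"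
    have mc: "m \<in> carrier G" using m sub by blast
    have "?\<Theta> g m \<in> orbit ?A (\<lambda>a. a) m"
      unfolding orbit_def using g by (intro CollectI exI[of _ "?\<Theta> g"]) simp
    then have "g \<otimes> m \<otimes> inv g \<in> orbit ?A (\<lambda>a. a) m" using m by simp
    moreover have "m \<in> orbit ?A (\<lambda>a. a) m" using act.orbit_refl[OF m(1)] .
    moreover obtain y where "orbit ?A (\<lambda>a. a) m = {y}" using m(3) by (rule card_1_singletonE)
    ultimately have "g \<otimes> m \<otimes> inv g = m" by simp
    then show "g \<otimes> m = m \<otimes> g" using g mc by (metis inv_solve_right m_closed)
  qed
qed

lemma normal_p_subgroup_central_element:
  assumes M: "subgroup M G" and conj: "\<And>g m. g \<in> carrier G \<Longrightarrow> m \<in> M \<Longrightarrow> g \<otimes> m \<otimes> inv g \<in> M"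
    and fin: "finite M" and p: "prime p" and M1: "M \<noteq> {\<one>}" "card M dvd p ^ m"
    and pc: "powers_central G (p ^ s)"
  obtains z where "z \<in> M" "ord z = p" "\<And>g. g \<in> carrier G \<Longrightarrow> g \<otimes> z = z \<otimes> g"
proof -
  obtain k where k: "card M = p ^ k" using divides_primepow_nat[OF p] M1(2) by blast
  have "k \<noteq> 0"
  proof
    assume "k = 0"
    then have "card M = 1" using k by simp
    then show False using M1(1) subgroup.one_closed[OF M] by (auto simp: card_1_singleton_iff)
  qed
  then have "p dvd card M" using k by (simp add: dvd_power)
  from normal_p_subgroup_fixed_point[OF M conj fin p this pc]
  obtain y where y: "y \<in> M" "y \<noteq> \<one>" "\<And>g. g \<in> carrier G \<Longrightarrow> g \<otimes> y = y \<otimes> g" by blast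
  have yc: "y \<in> carrier G" using subgroup.mem_carrier[OF M y(1)] .
  obtain i where i: "ord y = p ^ i" using divides_primepow_nat[OF p] ord_dvd_subgroup_card[OF M y(1)] k by metis
  have "i \<noteq> 0" using i y ord_eq_1[OF yc] by auto
  then obtain j where j: "i = Suc j" by (cases i) auto
  have p0: "p > 0" using p prime_gt_0_nat by blast
  show thesis
  proof (rule that[of "y [^] (p ^ j)"])
    show "y [^] (p ^ j) \<in> M" using nat_pow_in_subgroup[OF M y(1)] .
    show "ord (y [^] (p ^ j)) = p" using ord_pow[OF yc, of "p ^ j"] i j p0 by simp
    fix g assume g: "g \<in> carrier G"
    have "g \<otimes> y [^] n = y [^] n \<otimes> g" for n :: nat
    proof (induction n)
      case (Suc n)
      have "g \<otimes> y [^] Suc n = (g \<otimes> y [^] n) \<otimes> y" using g yc by (simp add: m_assoc)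
      also have "\<dots> = y [^] n \<otimes> (g \<otimes> y)" using Suc g yc by (simp add: m_assoc)
      also have "\<dots> = y [^] Suc n \<otimes> g" using g yc y(3)[OF g] by (simp add: m_assoc)
      finally show ?case .
    qed (use g in simp)
    then show "g \<otimes> y [^] (p ^ j) = y [^] (p ^ j) \<otimes> g" .
  qed
qed

lemma lcs_trivial_above: "lcs G m = {\<one>} \<Longrightarrow> m \<le> n \<Longrightarrow> lcs G n = {\<one>}"
  using lcs_antimono[of m n] one_in_lcs[of n] by blast

end

lemma (in central_quotient) img_eq_one:
  assumes "x \<in> carrier G" "\<phi> x = \<one>\<^bsub>H\<^esub>"
  shows "\<exists>i<n. x = z [^]\<^bsub>G\<^esub> i"
  using fibre[of "\<one>\<^bsub>G\<^esub>" x] assms by simp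

text \<open>If the lower central series of the quotient by a central \<open>z\<close> has reached
  the trivial group, that of \<open>G\<close> has reached \<open><z>\<close>, and its next term is
  trivial.\<close>

lemma (in group) lcs_terminates_step:
  assumes fin: "finite (lcs G 2)" and pc: "powers_central G (p ^ s)" and p: "prime p" "card (lcs G 2) = p ^ m"
    and IH: "\<And>H :: ('a, 'b) monoid_scheme. group H \<Longrightarrow> card (lcs H 2) < card (lcs G 2) \<Longrightarrow>
      finite (lcs H 2) \<Longrightarrow> powers_central H (p ^ s) \<Longrightarrow> \<exists>m. card (lcs H 2) = p ^ m \<Longrightarrow>
      \<exists>c. lcs H (Suc c) = {\<one>\<^bsub>H\<^esub>}"
  shows "\<exists>c. lcs G (Suc c) = {\<one>}"
proof (cases "lcs G 2 = {\<one>}")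
  case True
  then show ?thesis by (intro exI[of _ 1]) (simp add: numeral_2_eq_2)
next
  case False
  obtain z where z: "z \<in> lcs G 2" "ord z = p" and central: "\<And>g. g \<in> carrier G \<Longrightarrow> g \<otimes> z = z \<otimes> g"
    using normal_p_subgroup_central_element[OF lcs_subgroup lcs_conj fin p(1) False _ pc] p(2) by (metis dvd_refl)
  have zG: "z \<in> carrier G" using z lcs_carrier by blast
  have p1: "p > 1" using p prime_gt_1_nat by blast
  then obtain H :: "('a, 'b) monoid_scheme" and \<phi> where "central_quotient G H \<phi> z (ord z)"
    using central_quotient_exists[OF zG central] z by auto
  then interpret Q: central_quotient G H \<phi> z p using z by simp
  have card: "card (lcs G 2) = p * card (lcs H 2)"
    using Q.card_img[OF lcs_subgroup z(1) fin] Q.img_lcs[of 2] by simp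
  have fin': "finite (lcs H 2)" using fin Q.img_lcs[of 2] by (metis finite_imageI)
  have "card (lcs H 2) dvd p ^ m" using card p(2) by (metis dvd_triv_right)
  then have pm: "\<exists>m. card (lcs H 2) = p ^ m" using divides_primepow_nat[OF p(1)] by blast
  have lt: "card (lcs H 2) < card (lcs G 2)"
  proof -
    have "card (lcs H 2) > 0" using card p(2) p1 by (intro gr0I) simp
    then show ?thesis using card p1 by simp
  qed
  obtain c where c: "lcs H (Suc c) = {\<one>\<^bsub>H\<^esub>}"
    using IH[OF Q.H.is_group lt fin' Q.powers_central_quotient[OF pc] pm] by blast
  have "lcs G (Suc (Suc c)) \<subseteq> {\<one>}"
  proof (rule lcs_Suc_least[OF triv_subgroup])
    fix u g assume u: "u \<in> lcs G (Suc c)" and g: "g \<in> carrier G"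
    have img: "\<phi> u = \<one>\<^bsub>H\<^esub>" using u c Q.img_lcs[of "Suc c"] by blast
    obtain i :: nat where "u = z [^] i" using Q.img_eq_one[OF lcs_carrier[OF u] img] by blast
    then show "cm u g \<in> {\<one>}" using g zG Q.z_pow_central[OF g, of i] by (simp add: cm_eq_one_iff)
  qed simp
  then show ?thesis using one_in_lcs[of "Suc (Suc c)"] by blast
qed

lemma lcs_terminates:
  fixes G :: "('a, 'b) monoid_scheme"
  assumes "group G" "finite (lcs G 2)" "powers_central G (p ^ s)" "prime p" "\<exists>m. card (lcs G 2) = p ^ m"
  shows "\<exists>c. lcs G (Suc c) = {\<one>\<^bsub>G\<^esub>}"
  using assms(1-3,5)
proof (induction "card (lcs G 2)" arbitrary: G rule: less_induct)
  case less
  from less.prems(4) obtain m where m: "card (lcs G 2) = p ^ m" ..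
  show ?case
    by (rule group.lcs_terminates_step[OF less.prems(1-3) assms(4) m]) (rule less.hyps)
qed

section \<open>A lower bound for cyclic derived subgroups\<close>
lemma geometric_sum_times:
  "(\<Sum>j<p * i. k ^ j) = (\<Sum>j<p. k ^ j) * (\<Sum>j<i. (k ^ p) ^ j :: nat)"
proof (induction i)
  case (Suc i)
  have "(\<Sum>j<p * Suc i. k ^ j) = (\<Sum>j<p * i. k ^ j) + (\<Sum>j<p. k ^ (p * i + j))"
  proof -
    have "(\<Sum>j<p * i + m. k ^ j) = (\<Sum>j<p * i. k ^ j) + (\<Sum>j<m. k ^ (p * i + j))" for m
      by (induction m) simp_all
    then show ?thesis by (simp add: add.commute)
  qed
  also have "(\<Sum>j<p. k ^ (p * i + j)) = (\<Sum>j<p. k ^ j) * (k ^ p) ^ i"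
  proof -
    have "k ^ (p * i + j) = k ^ j * (k ^ p) ^ i" for j
      by (metis power_add power_mult mult.commute)
    then show ?thesis by (simp only: sum_distrib_right)
  qed
  finally show ?case using Suc by (simp add: distrib_left)
qed simp

lemma one_plus_power_expand: "\<exists>q. (1 + p * t) ^ j = 1 + j * (p * t) + p ^ 2 * (q::nat)"
proof (induction j)
  case (Suc j)
  then obtain q where q: "(1 + p * t) ^ j = 1 + j * (p * t) + p ^ 2 * q" by blast
  have "(1 + p * t) ^ Suc j = 1 + Suc j * (p * t) + p ^ 2 * (j * t ^ 2 + q + q * (p * t))"
    using q by (simp add: algebra_simps power2_eq_square)
  then show ?case by blast
qed (intro exI[of _ 0], simp)

text \<open>Modulo \<open>p^2\<close> the sum is \<open>p + p t (0 + 1 + ... + (p-1))\<close>. For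
  odd \<open>p\<close> the inner sum is divisible by \<open>p\<close>; for \<open>p = 2\<close> it
  is 1, and the parity of \<open>t\<close> has to take its place.\<close>

lemma geometric_sum_not_dvd_square:
  fixes p t :: nat
  assumes p: "prime p" and two: "p = 2 \<Longrightarrow> even t"
  shows "\<exists>a. (\<Sum>j<p. (1 + p * t) ^ j) = p * a \<and> \<not> p dvd a"
proof -
  obtain q where q: "\<And>j. (1 + p * t) ^ j = 1 + j * (p * t) + p ^ 2 * q j"
    using one_plus_power_expand[of p t] by metis
  have "(\<Sum>j<p. (1 + p * t) ^ j) = p + p * t * (\<Sum>j<p. j) + p ^ 2 * (\<Sum>j<p. q j)"
  proof -
    have "(\<Sum>j<p. (1 + p * t) ^ j) = (\<Sum>j<p. 1 + (p * t * j + p ^ 2 * q j))"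
      by (intro sum.cong) (simp_all only: q, simp)
    also have "\<dots> = p + p * t * (\<Sum>j<p. j) + p ^ 2 * (\<Sum>j<p. q j)"
      by (simp only: sum.distrib sum_distrib_left) simp
    finally show ?thesis .
  qed
  then have eq: "(\<Sum>j<p. (1 + p * t) ^ j) = p * (1 + t * (\<Sum>j<p. j) + p * (\<Sum>j<p. q j))"
    by (simp add: algebra_simps power2_eq_square)
  have "p dvd t * (\<Sum>j<p. j)"
  proof (cases "p = 2")
    case True
    then show ?thesis using two by simp
  next
    case False
    then have "odd p" using p prime_odd_nat[OF p] prime_ge_2_nat[OF p] by simp
    have "2 * (\<Sum>j<m. j) = m * (m - 1)" for m :: nat
    proof (induction m)
      case (Suc m)
      then show ?case by (cases m) (simp_all add: algebra_simps)
    qed simp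
    then have "p dvd 2 * (\<Sum>j<p. j)" by simp
    moreover have "coprime p 2" using \<open>odd p\<close> by simp
    ultimately show ?thesis by (simp add: coprime_dvd_mult_right_iff)
  qed
  then have "\<not> p dvd 1 + t * (\<Sum>j<p. j) + p * (\<Sum>j<p. q j)"
    using p by (metis add.assoc dvd_add_left_iff dvd_add dvd_triv_left not_prime_unit)
  then show ?thesis using eq by blast
qed

text \<open>A geometric sum with ratio 1 modulo \<open>p\<close> is no more divisible by
  \<open>p\<close> than its length. Reduction modulo \<open>p\<close> gives \<open>p\<close>
  dividing \<open>i\<close>; then the sum factors into one of length \<open>p\<close>, which
  contains \<open>p\<close> exactly once, and a geometric sum of ratio \<open>k^p\<close> and length
  \<open>i / p\<close>. For \<open>p = 2\<close> the ratio must be 1 modulo 4: \<open>1 + 3\<close>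
  is divisible by 4, but its length is 2.\<close>

lemma prime_power_dvd_geometric_sum:
  fixes p k i n :: nat
  assumes p: "prime p" and "\<exists>t. k = 1 + p * t \<and> (p = 2 \<longrightarrow> even t)"
    and "p ^ n dvd (\<Sum>j<i. k ^ j)"
  shows "p ^ n dvd i"
  using assms(2,3)
proof (induction n arbitrary: i k)
  case (Suc n)
  obtain t where t: "k = 1 + p * t" "p = 2 \<Longrightarrow> even t" using Suc.prems(1) by blast
  obtain q where q: "\<And>j. k ^ j = 1 + j * (p * t) + p ^ 2 * q j"
    using one_plus_power_expand[of p t] t(1) by metis
  have "(\<Sum>j<i. k ^ j) = i + p * (\<Sum>j<i. j * t + p * q j)"
  proof -
    have "(\<Sum>j<i. k ^ j) = (\<Sum>j<i. 1 + p * (j * t + p * q j))"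
      unfolding q by (simp add: algebra_simps power2_eq_square)
    also have "\<dots> = i + p * (\<Sum>j<i. j * t + p * q j)"
      by (simp only: sum.distrib sum_distrib_left distrib_left) simp
    finally show ?thesis .
  qed
  moreover have "p dvd (\<Sum>j<i. k ^ j)" using dvd_trans[OF dvd_power[of "Suc n" p] Suc.prems(2)] by simp
  ultimately have "p dvd i + p * (\<Sum>j<i. j * t + p * q j)" by simp
  then have "p dvd i" using dvd_add_left_iff[OF dvd_triv_left] by blast
  then obtain i' where i': "i = p * i'" by blast
  obtain a where a: "(\<Sum>j<p. k ^ j) = p * a" "\<not> p dvd a"
    using geometric_sum_not_dvd_square[OF p, of t] t by blast
  have "p * p ^ n dvd p * (a * (\<Sum>j<i'. (k ^ p) ^ j))"
    using Suc.prems(2) unfolding i' geometric_sum_times a(1) by (simp add: mult.assoc)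
  then have "p ^ n dvd a * (\<Sum>j<i'. (k ^ p) ^ j)"
    using p by (metis dvd_times_left_cancel_iff not_prime_0)
  moreover have "coprime (p ^ n) a"
    using a(2) p by (meson coprime_power_left_iff prime_imp_coprime)
  ultimately have "p ^ n dvd (\<Sum>j<i'. (k ^ p) ^ j)" by (simp add: coprime_dvd_mult_right_iff)
  moreover have "\<exists>t. k ^ p = 1 + p * t \<and> (p = 2 \<longrightarrow> even t)"
    using q[of p] by (intro exI[of _ "p * t + p * q p"]) (simp add: algebra_simps power2_eq_square)
  ultimately have "p ^ n dvd i'" using Suc.IH by blast
  then show ?case using i' by simp
qed simp

context group
begin

lemma cm_pow_left:
  assumes a: "a \<in> carrier G" "b \<in> carrier G" and k: "b \<otimes> cm b a \<otimes> inv b = cm b a [^] (k::nat)"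
  shows "cm (b [^] i) a = cm b a [^] (\<Sum>j<i. k ^ j)"
proof (induction i)
  case 0
  then show ?case using a by (simp add: cm_def)
next
  case (Suc i)
  let ?c = "cm b a"
  have c: "?c \<in> carrier G" using a by simp
  have conj: "b \<otimes> ?c [^] n \<otimes> inv b = ?c [^] (k * n)" for n :: nat
  proof (induction n)
    case (Suc n)
    have "b \<otimes> ?c [^] Suc n \<otimes> inv b = (b \<otimes> ?c [^] n \<otimes> inv b) \<otimes> (b \<otimes> ?c \<otimes> inv b)"
      using a c by (simp add: m_assoc)
    also have "\<dots> = ?c [^] (k * Suc n)"
      using Suc k c by (simp add: nat_pow_mult add.commute)
    finally show ?case .
  qed (use a in simp)
  have "cm (b [^] Suc i) a = cm (b \<otimes> b [^] i) a" using a nat_pow_Suc2 by simp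
  also have "\<dots> = b \<otimes> cm (b [^] i) a \<otimes> inv b \<otimes> ?c" using a by (simp add: cm_mult_left)
  also have "\<dots> = ?c [^] (k * (\<Sum>j<i. k ^ j) + 1)" using Suc conj c by (simp add: nat_pow_mult)
  also have "k * (\<Sum>j<i. k ^ j) + 1 = (\<Sum>j<Suc i. k ^ j)"
    by (subst sum.lessThan_Suc_shift) (simp add: sum_distrib_left)
  finally show ?case .
qed

text \<open>If \<open>b^i\<close> commutes with \<open>a\<close>, the exponent
  \<open>1 + k + ... + k^(i-1)\<close> of \<open>cm (b^i) a\<close> is divisible by
  \<open>p^n\<close>, hence so is \<open>i\<close>. No \<open>i\<close> with
  \<open>0 < i < p^n\<close> qualifies.\<close>

lemma not_lie_zero_cyclic_aux:
  assumes a: "a \<in> carrier G" "b \<in> carrier G" and k: "b \<otimes> cm b a \<otimes> inv b = cm b a [^] (k::nat)"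
    and p: "prime p" and o: "ord (cm b a) = p ^ n" and t: "\<exists>t. k = 1 + p * t \<and> (p = 2 \<longrightarrow> even t)"
  shows "\<not> lie_zero TYPE('k::field) G (p ^ n - 1)"
proof (rule not_lie_zero_of_noncommuting_powers[OF a])
  fix i assume i: "0 < i" "i \<le> p ^ n - 1"
  show "b [^] i \<otimes> a \<noteq> a \<otimes> b [^] i"
  proof
    assume "b [^] i \<otimes> a = a \<otimes> b [^] i"
    then have "cm b a [^] (\<Sum>j<i. k ^ j) = \<one>"
      using cm_pow_left[OF a k, of i] cm_eq_one_iff[of "b [^] i" a] a by simp
    then have "p ^ n dvd (\<Sum>j<i. k ^ j)" using pow_eq_id[of "cm b a"] a o by simp
    then have "p ^ n dvd i" using prime_power_dvd_geometric_sum[OF p t] by blast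
    then have "p ^ n \<le> i" using i by (intro dvd_imp_le) auto
    then show False using i p by (metis One_nat_def Suc_pred leD less_Suc_eq_le neq0_conv not_prime_0 power_not_zero order.strict_trans2 diff_less zero_less_one)
  qed
qed

lemma conj_pow:
  assumes "g \<in> carrier G" "x \<in> carrier G"
  shows "g \<otimes> x [^] (n::nat) \<otimes> inv g = (g \<otimes> x \<otimes> inv g) [^] n"
proof (induction n)
  case (Suc n)
  have "g \<otimes> x [^] Suc n \<otimes> inv g = (g \<otimes> x [^] n \<otimes> inv g) \<otimes> (g \<otimes> x \<otimes> inv g)"
    using assms by (simp add: m_assoc)
  then show ?case using Suc by simp
qed (use assms in simp)

lemma ord_conj:
  assumes "g \<in> carrier G" "x \<in> carrier G"
  shows "ord (g \<otimes> x \<otimes> inv g) = ord x"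
proof -
  have "(g \<otimes> x \<otimes> inv g) [^] n = \<one> \<longleftrightarrow> x [^] n = \<one>" for n :: nat
  proof
    assume "(g \<otimes> x \<otimes> inv g) [^] n = \<one>"
    then have "inv g \<otimes> (g \<otimes> x [^] n \<otimes> inv g) \<otimes> g = inv g \<otimes> \<one> \<otimes> g"
      using conj_pow[OF assms] by simp
    then show "x [^] n = \<one>" using assms by (simp add: m_assoc)
  qed (use assms in \<open>simp add: conj_pow[symmetric]\<close>)
  then show ?thesis using ord_unique[of "g \<otimes> x \<otimes> inv g" "ord x"] pow_eq_id[of x] assms by simp
qed

text \<open>Some commutator generates \<open>N\<close>, since otherwise all commutators would lie in
  the proper subgroup of elements killed by \<open>p^(n-1)\<close>. Every \<open>g\<close> acts on
  the cyclic \<open>N\<close> as a power map, whose exponent is 1 modulo \<open>p\<close> because a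
  central element of order \<open>p\<close> stays fixed. Only for \<open>p = 2\<close> can the
  exponent violate the condition of the geometric sum, by being 3 modulo 4.\<close>

lemma not_lie_zero_cyclic:
  assumes fin: "finite (lcs G 2)" and pc: "powers_central G (p ^ s)" and p: "prime p"
    and card: "card (lcs G 2) = p ^ n" and y: "y \<in> carrier G" "lcs G 2 = generate G {y}" and n: "n > 0"
  shows "\<not> lie_zero TYPE('k::field) G (p ^ n - 1)"
proof -
  let ?N = "lcs G 2"
  have N: "subgroup ?N G" by (rule lcs_subgroup)
  have oy: "ord y = p ^ n" using generate_pow_card[OF y(1)] y card by simp
  have p0: "p > 0" and p1: "p > 1" using p prime_gt_0_nat prime_gt_1_nat by blast+
  have N_eq: "?N = (\<lambda>i. y [^] (i::nat)) ` {..<p ^ n}"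
    using generate_single_nat[OF y(1)] y oy p0 by simp
  have N_comm: "x \<otimes> x' = x' \<otimes> x" if "x \<in> ?N" "x' \<in> ?N" for x x'
  proof -
    have "x \<in> range (\<lambda>i::nat. y [^] i)" "x' \<in> range (\<lambda>i::nat. y [^] i)"
      using that unfolding N_eq by auto
    then obtain i j :: nat where "x = y [^] i" "x' = y [^] j" by blast
    then show ?thesis using y by (simp add: nat_pow_mult add.commute)
  qed
  have act: "\<exists>k::nat. \<forall>x\<in>?N. g \<otimes> x \<otimes> inv g = x [^] k" if g: "g \<in> carrier G" for g
  proof -
    have "y \<in> ?N" using y generate.incl[of y "{y}"] by simp
    then have "g \<otimes> y \<otimes> inv g \<in> ?N" using lcs_conj g by simp
    then obtain k :: nat where "g \<otimes> y \<otimes> inv g = y [^] k" unfolding N_eq by blast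
    then have "g \<otimes> (y [^] i) \<otimes> inv g = (y [^] i) [^] k" for i :: nat
      using conj_pow[OF g y(1), of i] y by (simp add: nat_pow_pow mult.commute)
    then show ?thesis unfolding N_eq by blast
  qed
  have "?N \<noteq> {\<one>}" using card n p1 by (metis card.empty card_insert_disjoint empty_iff finite.emptyI One_nat_def one_less_power less_irrefl)
  then obtain w where w: "w \<in> ?N" "ord w = p" "\<And>g. g \<in> carrier G \<Longrightarrow> g \<otimes> w = w \<otimes> g"
    using normal_p_subgroup_central_element[OF N lcs_conj fin p _ _ pc, of n] card by (metis dvd_refl)
  have wG: "w \<in> carrier G" using w lcs_carrier by blast
  have act1: "\<exists>t. (\<forall>x\<in>?N. g \<otimes> x \<otimes> inv g = x [^] (1 + p * t))" if g: "g \<in> carrier G" for g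
  proof -
    obtain k :: nat where k: "\<forall>x\<in>?N. g \<otimes> x \<otimes> inv g = x [^] k" using act[OF g] by blast
    have wk: "w [^] k = w" using k w g wG by (metis inv_solve_right' m_closed)
    have "k \<noteq> 0"
    proof
      assume "k = 0"
      then have "w = \<one>" using wk by simp
      then show False using w(2) p1 by simp
    qed
    then obtain j where j: "k = Suc j" by (cases k) auto
    then have "w [^] j = \<one>" using wk wG by (simp add: r_cancel_one)
    then obtain t where "j = p * t" using pow_eq_id[OF wG] w(2) by auto
    then show ?thesis using k j by (intro exI[of _ t]) simp
  qed
  obtain a b where ab: "a \<in> carrier G" "b \<in> carrier G" "cm b a [^] (p ^ (n - 1)) \<noteq> \<one>"
  proof (rule ccontr)
    assume no: "\<not> thesis"
    let ?B = "{x \<in> ?N. x [^] (p ^ (n - 1)) = \<one>}"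
    have "subgroup ?B G"
    proof (rule subgroupI)
      show "?B \<subseteq> carrier G" using lcs_carrier by blast
      show "?B \<noteq> {}" using one_in_lcs[of 2] by (auto intro!: exI[of _ \<one>])
      show "inv x \<in> ?B" if "x \<in> ?B" for x
        using that subgroup.m_inv_closed[OF N] lcs_carrier[of x 2] by (simp add: nat_pow_inv)
      show "x \<otimes> x' \<in> ?B" if "x \<in> ?B" "x' \<in> ?B" for x x'
        using that subgroup.m_closed[OF N] lcs_carrier[of _ 2] N_comm[of x x'] by (simp add: pow_mult_distrib)
    qed
    then have "lcs G (Suc 1) \<subseteq> ?B"
      using no that cm_in_derived by (intro lcs_Suc_least) auto
    then have "y [^] (p ^ (n - 1)) = \<one>"
      using y generate.incl[of y "{y}" G] by (auto simp: numeral_2_eq_2)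
    then have "p ^ n dvd p ^ (n - 1)" using pow_eq_id[OF y(1)] oy by simp
    then have "n \<le> n - 1" using p1 by (simp add: power_dvd_imp_le)
    then show False using n by simp
  qed
  let ?c = "cm b a"
  have cN: "?c \<in> ?N" using cm_in_derived ab by simp
  have cG: "?c \<in> carrier G" using ab by simp
  obtain j where j: "j \<le> n" "ord ?c = p ^ j"
    using ord_dvd_subgroup_card[OF N cN] card divides_primepow_nat[OF p] by metis
  have oc: "ord ?c = p ^ n"
  proof (cases "j = n")
    case False
    then have "p ^ j dvd p ^ (n - 1)" using j by (intro le_imp_power_dvd) simp
    then show ?thesis using ab(3) pow_eq_id[OF cG] j by simp
  qed (use j in simp)
  obtain t where t: "\<forall>x\<in>?N. b \<otimes> x \<otimes> inv b = x [^] (1 + p * t)" using act1[OF ab(2)] by blast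
  obtain t' where t': "\<forall>x\<in>?N. a \<otimes> x \<otimes> inv a = x [^] (1 + p * t')" using act1[OF ab(1)] by blast
  \<comment> \<open>A commutator and its inverse have the same order, so the roles of
    \<open>a\<close> and \<open>b\<close> may be exchanged. If both act with an exponent 3 modulo 4,
    then \<open>a b\<close> acts with an exponent 1 modulo 4, and \<open>cm (a b) a\<close> is a
    conjugate of \<open>cm b a\<close>.\<close>
  consider "p = 2 \<longrightarrow> even t" | "p = 2" "even t'" | "p = 2" "odd t" "odd t'" by blast
  then show ?thesis
  proof cases
    case 1
    then show ?thesis
      using not_lie_zero_cyclic_aux[OF ab(1,2) _ p oc] t cN by blast
  next
    case 2
    have inv: "cm a b = inv ?c" using ab inv_cm by simp
    have "ord (cm a b) = p ^ n" unfolding inv using ord_inv[OF cG] oc by simp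
    moreover have "cm a b \<in> ?N" using cm_in_derived ab by simp
    ultimately show ?thesis
      using not_lie_zero_cyclic_aux[OF ab(2,1) _ p] t' 2 by blast
  next
    case 3
    let ?b = "a \<otimes> b"
    have eq: "cm ?b a = a \<otimes> ?c \<otimes> inv a"
      using ab cm_mult_left[of a b a] by (simp add: cm_def word_simps)
    have o: "ord (cm ?b a) = p ^ n" unfolding eq using ord_conj[OF ab(1) cG] oc by simp
    have mem: "cm ?b a \<in> ?N" using cm_in_derived ab by simp
    have "?b \<otimes> x \<otimes> inv ?b = x [^] ((1 + p * t) * (1 + p * t'))" if x: "x \<in> ?N" for x
    proof -
      have xG: "x \<in> carrier G" using x lcs_carrier by blast
      have "?b \<otimes> x \<otimes> inv ?b = a \<otimes> (b \<otimes> x \<otimes> inv b) \<otimes> inv a"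
        using ab xG by (simp add: word_simps)
      also have "\<dots> = a \<otimes> (x [^] (1 + p * t)) \<otimes> inv a" using t x by simp
      also have "\<dots> = (x [^] (1 + p * t)) [^] (1 + p * t')"
        using t' nat_pow_in_subgroup[OF N x] by blast
      finally show ?thesis using xG by (simp only: nat_pow_pow)
    qed
    then have "?b \<otimes> cm ?b a \<otimes> inv ?b = cm ?b a [^] ((1 + p * t) * (1 + p * t'))" using mem by blast
    moreover have "\<exists>u. (1 + p * t) * (1 + p * t') = 1 + p * u \<and> (p = 2 \<longrightarrow> even u)"
      using 3 by (intro exI[of _ "t + t' + p * t * t'"]) (simp add: algebra_simps)
    ultimately show ?thesis
      using not_lie_zero_cyclic_aux[OF ab(1) _ _ p o] ab by blast
  qed
qed

end

section \<open>Weights and upper bounds\<close>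
text \<open>The conjugate \<open>h u h^-1\<close> in the group algebra.\<close>

definition cj :: "('g, 'b) monoid_scheme \<Rightarrow> 'g \<Rightarrow> ('g \<Rightarrow> 'k::field) \<Rightarrow> 'g \<Rightarrow> 'k" where
  "cj G h u = (\<lambda>x. if x \<in> carrier G then u (inv\<^bsub>G\<^esub> h \<otimes>\<^bsub>G\<^esub> x \<otimes>\<^bsub>G\<^esub> h) else 0)"

text \<open>The factor in front of \<open>h g\<close> in the commutator of \<open>u g\<close> and
  \<open>h\<close>, with \<open>c\<close> in the role of the group commutator of \<open>g\<close>
  and \<open>h\<close>. Keeping \<open>u\<close> apart from the group element means that only a
  function on \<open>N\<close> has to be tracked.\<close>

definition tstep :: "('g, 'b) monoid_scheme \<Rightarrow> 'g \<Rightarrow> 'g \<Rightarrow> ('g \<Rightarrow> 'k::field) \<Rightarrow> 'g \<Rightarrow> 'k" where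
  "tstep G c h u = (\<lambda>x. tr G c u x - cj G h u x)"

text \<open>A decreasing filtration of the group algebra of \<open>N\<close>: weight at least
  \<open>n\<close> means a combination of group elements times factors \<open>d - 1\<close> whose
  weights, prescribed by \<open>A\<close>, add up to at least \<open>n\<close>. As an inductive
  predicate it makes each closure property a rule induction.\<close>

inductive wspan :: "('g, 'b) monoid_scheme \<Rightarrow> 'g set \<Rightarrow> ('g \<times> nat) set \<Rightarrow> ('g \<Rightarrow> 'k::field) \<Rightarrow> nat \<Rightarrow> bool"
  for G N A where
  base: "t \<in> N \<Longrightarrow> wspan G N A (delta t) 0"
| gen: "wspan G N A u n \<Longrightarrow> (d, m) \<in> A \<Longrightarrow> wspan G N A (dif G d u) (n + m)"
| zero: "wspan G N A (\<lambda>_. 0) n"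
| add: "wspan G N A u n \<Longrightarrow> wspan G N A v n \<Longrightarrow> wspan G N A (\<lambda>x. u x + v x) n"
| scale: "wspan G N A u n \<Longrightarrow> wspan G N A (\<lambda>x. c * u x) n"
| weak: "wspan G N A u n \<Longrightarrow> m \<le> n \<Longrightarrow> wspan G N A u m"

lemma wspan_diff: "wspan G N A u n \<Longrightarrow> wspan G N A v n \<Longrightarrow> wspan G N A (\<lambda>x. u x - v x) n"
  using wspan.add[OF _ wspan.scale[of G N A v n "-1"], of u] by simp

lemma tr_add: "tr G t (\<lambda>x. u x + v x) = (\<lambda>x. tr G t u x + tr G t v x)"
  by (auto simp: tr_def)
lemma tr_scale: "tr G t (\<lambda>x. c * u x) = (\<lambda>x. c * tr G t u x)"
  by (auto simp: tr_def)
lemma tr_0: "tr G t (\<lambda>_. 0) = (\<lambda>_. 0)"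
  by (auto simp: tr_def)
lemma cj_diff: "cj G h (\<lambda>x. u x - v x) = (\<lambda>x. cj G h u x - cj G h v x)"
  by (auto simp: cj_def)
lemma cj_add: "cj G h (\<lambda>x. u x + v x) = (\<lambda>x. cj G h u x + cj G h v x)"
  by (auto simp: cj_def)
lemma cj_scale: "cj G h (\<lambda>x. c * u x) = (\<lambda>x. c * cj G h u x)"
  by (auto simp: cj_def)
lemma cj_0: "cj G h (\<lambda>_. 0) = (\<lambda>_. 0)"
  by (auto simp: cj_def)
lemma dif_add: "dif G t (\<lambda>x. u x + v x) = (\<lambda>x. dif G t u x + dif G t v x)"
  by (auto simp: dif_def tr_def)
lemma dif_scale: "dif G t (\<lambda>x. c * u x) = (\<lambda>x. c * dif G t u x)"
  by (auto simp: dif_def tr_def right_diff_distrib)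

lemma fold_dif_add: "fold (dif G) ds (\<lambda>x. u x + v x) = (\<lambda>x. fold (dif G) ds u x + fold (dif G) ds v x)"
  by (induction ds arbitrary: u v) (simp_all add: dif_add)
lemma fold_dif_scale: "fold (dif G) ds (\<lambda>x. c * u x) = (\<lambda>x. c * fold (dif G) ds u x)"
  by (induction ds arbitrary: u) (simp_all add: dif_scale)
lemma fold_dif_0: "fold (dif G) ds (\<lambda>_. 0) = (\<lambda>_. 0)"
  by (induction ds) simp_all

text \<open>Multiplying by the remaining difference operators turns the weight bound into a
  statement about monomials acting on group elements.\<close>

lemma wspan_vanish:
  assumes "wspan G N A u n"
    and mono: "\<And>ds t. set ds \<subseteq> A \<Longrightarrow> L < sum_list (map snd ds) \<Longrightarrow> t \<in> N \<Longrightarrow>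
      fold (dif G) (map fst ds) (delta t) = (\<lambda>_. 0 :: 'k::field)"
    and "set ds \<subseteq> A" "L < sum_list (map snd ds) + n"
  shows "fold (dif G) (map fst ds) u = (\<lambda>_. 0 :: 'k)"
  using assms(1,3,4)
proof (induction arbitrary: ds)
  case (base t)
  then show ?case using mono by simp
next
  case (gen u n d m)
  then show ?case using gen.IH[of "(d, m) # ds"] by simp
qed (simp_all add: fold_dif_0 fold_dif_add fold_dif_scale)

context group
begin

lemma cj_tr:
  assumes "h \<in> carrier G" "t \<in> carrier G"
  shows "cj G h (tr G t u) = tr G (h \<otimes> t \<otimes> inv h) (cj G h u)"
  using assms by (auto simp: cj_def tr_def word_simps)

lemma cj_dif:
  assumes "h \<in> carrier G" "t \<in> carrier G"
  shows "cj G h (dif G t u) = dif G (h \<otimes> t \<otimes> inv h) (cj G h u)"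
  unfolding dif_def cj_diff cj_tr[OF assms] ..

lemma cj_delta:
  assumes "h \<in> carrier G" "t \<in> carrier G"
  shows "cj G h (delta t) = delta (h \<otimes> t \<otimes> inv h)"
proof
  fix x
  have "inv h \<otimes> x \<otimes> h = t \<longleftrightarrow> x = h \<otimes> t \<otimes> inv h" if "x \<in> carrier G"
    using assms that by (metis inv_solve_left inv_solve_right m_assoc m_closed inv_closed)
  then show "cj G h (delta t) x = delta (h \<otimes> t \<otimes> inv h) x"
    using assms by (auto simp: cj_def delta_def)
qed

lemma ad_tr:
  assumes "g \<in> carrier G" "h \<in> carrier G"
  shows "ad G h (tr G g u) = tr G (h \<otimes> g) (tstep G (cm g h) h u)"
  using assms by (auto simp: ad_def tr_def tstep_def cj_def cm_def word_simps)

text \<open>This is \<open>d e - 1 = (d - 1) e + (e - 1)\<close>, the identity that transfers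
  weights from generators to the subgroup they generate.\<close>

lemma dif_mult:
  assumes "d \<in> carrier G" "e \<in> carrier G"
  shows "dif G (d \<otimes> e) u = (\<lambda>x. tr G e (dif G d u) x + dif G e u x)"
  unfolding dif_def tr_diff tr_tr[OF assms] by simp

lemma dif_comm:
  assumes "s \<in> carrier G" "t \<in> carrier G" "s \<otimes> t = t \<otimes> s"
  shows "dif G s (dif G t u) = dif G t (dif G s u)"
proof -
  have "tr G s (tr G t u) = tr G t (tr G s u)" using assms by (simp add: tr_tr)
  then show ?thesis unfolding dif_def tr_diff by (simp add: algebra_simps)
qed

lemma tr_dif_comm:
  assumes "s \<in> carrier G" "t \<in> carrier G" "s \<otimes> t = t \<otimes> s"
  shows "tr G s (dif G t u) = dif G t (tr G s u)"
  unfolding dif_def tr_diff using assms by (simp add: tr_tr)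

end

locale weighted_generators = group G for G (structure) +
  fixes N :: "'a set" and A :: "('a \<times> nat) set"
  assumes N: "subgroup N G" and N_comm: "\<And>s t. s \<in> N \<Longrightarrow> t \<in> N \<Longrightarrow> s \<otimes> t = t \<otimes> s"
    and cm_N: "\<And>g h. g \<in> carrier G \<Longrightarrow> h \<in> carrier G \<Longrightarrow> cm g h \<in> N"
    and A: "\<And>d m. (d, m) \<in> A \<Longrightarrow> d \<in> N"
begin

abbreviation "W \<equiv> wspan G N A"

text \<open>The elements of weight at least \<open>m\<close>, measured by their effect on the
  filtration. In contrast to \<open>A\<close> this is a subgroup, so a weight has to be checked on
  generators only.\<close>

definition good :: "'k::field itself \<Rightarrow> nat \<Rightarrow> 'a set" where
  "good _ m = {d \<in> N. \<forall>(u :: 'a \<Rightarrow> 'k) n. W u n \<longrightarrow> W (dif G d u) (n + m)}"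

lemma N_carrier: "t \<in> N \<Longrightarrow> t \<in> carrier G"
  using subgroup.mem_carrier[OF N] .

lemma wspan_outside: "W u n \<Longrightarrow> x \<notin> carrier G \<Longrightarrow> u x = 0"
  by (induction rule: wspan.induct) (auto simp: delta_def dif_def tr_def dest: N_carrier)

lemma wspan_tr: "W u n \<Longrightarrow> s \<in> N \<Longrightarrow> W (tr G s u) n"
proof (induction rule: wspan.induct)
  case (base t)
  then show ?case using subgroup.m_closed[OF N] by (simp add: tr_delta N_carrier wspan.base)
next
  case (gen u n d m)
  then show ?case using A[OF gen.hyps(2)] by (simp add: tr_dif_comm N_carrier N_comm wspan.gen)
qed (auto simp: tr_0 tr_add tr_scale intro: wspan.intros)

lemma good_generator: "(d, m) \<in> A \<Longrightarrow> d \<in> good TYPE('k::field) m"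
  unfolding good_def using A wspan.gen by auto

lemma good_antimono: "m \<le> m' \<Longrightarrow> good TYPE('k::field) m' \<subseteq> good TYPE('k) m"
  unfolding good_def
proof (intro subsetI CollectI conjI allI impI; elim CollectE conjE)
  fix d and u :: "'a \<Rightarrow> 'k" and n
  assume "m \<le> m'" "\<forall>(u :: 'a \<Rightarrow> 'k) n. W u n \<longrightarrow> W (dif G d u) (n + m')" "W u n"
  then show "W (dif G d u) (n + m)" using wspan.weak[of G N A "dif G d u" "n + m'" "n + m"] by simp
qed

lemma good_subgroup: "subgroup (good TYPE('k::field) m) G"
proof (rule subgroupI)
  show "good TYPE('k) m \<subseteq> carrier G" unfolding good_def using N_carrier by blast
  have "dif G \<one> u = (\<lambda>_. 0)" if "W u n" for u :: "'a \<Rightarrow> 'k" and n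
    unfolding dif_def using tr_one[of u] wspan_outside[OF that] by simp
  then have "\<one> \<in> good TYPE('k) m"
    unfolding good_def using subgroup.one_closed[OF N] by (auto intro: wspan.zero)
  then show "good TYPE('k) m \<noteq> {}" by blast
next
  fix d assume "d \<in> good TYPE('k) m"
  then have d: "d \<in> N" "W (dif G d u) (n + m)" if "W u n" for u :: "'a \<Rightarrow> 'k" and n
    using that unfolding good_def by auto
  have dN: "d \<in> N" using \<open>d \<in> good TYPE('k) m\<close> unfolding good_def by blast
  have "W (dif G (inv d) u) (n + m)" if u: "W u n" for u :: "'a \<Rightarrow> 'k" and n
  proof -
    have "tr G (inv d) (tr G d u) = u"
      using N_carrier[OF dN] tr_one[of u] wspan_outside[OF u] by (simp add: tr_tr)
    then have "dif G (inv d) u = (\<lambda>x. (-1) * tr G (inv d) (dif G d u) x)"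
      unfolding dif_def tr_diff by simp
    then show ?thesis
      using wspan.scale[OF wspan_tr[OF d(2)[OF u] subgroup.m_inv_closed[OF N dN]], of "-1"] by simp
  qed
  then show "inv d \<in> good TYPE('k) m"
    unfolding good_def using subgroup.m_inv_closed[OF N dN] by blast
next
  fix d e assume "d \<in> good TYPE('k) m" "e \<in> good TYPE('k) m"
  then have de: "d \<in> N" "e \<in> N" "\<And>u n. W (u :: 'a \<Rightarrow> 'k) n \<Longrightarrow> W (dif G d u) (n + m)"
    "\<And>u n. W (u :: 'a \<Rightarrow> 'k) n \<Longrightarrow> W (dif G e u) (n + m)"
    unfolding good_def by auto
  then show "d \<otimes> e \<in> good TYPE('k) m"
    unfolding good_def
    by (auto simp: dif_mult N_carrier intro!: wspan.add wspan_tr subgroup.m_closed[OF N])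
qed

text \<open>Conjugation is the identity modulo higher weight. It turns a factor \<open>d - 1\<close>
  into \<open>c d - 1\<close> with \<open>c = cm h d\<close>, which by \<open>gA\<close> is heavier
  than \<open>d\<close>; and it changes a group element of \<open>N\<close> by a commutator, which
  by \<open>gN\<close> has weight at least 1.\<close>

lemma wspan_cj:
  assumes gN: "N \<subseteq> good TYPE('k::field) 1"
    and gA: "\<And>d m h. (d, m) \<in> A \<Longrightarrow> h \<in> carrier G \<Longrightarrow> cm h d \<in> good TYPE('k) (Suc m)"
    and u: "W (u :: 'a \<Rightarrow> 'k) n" and h: "h \<in> carrier G"
  shows "W (\<lambda>x. cj G h u x - u x) (Suc n)"
  using u
proof (induction rule: wspan.induct)
  case (base t)
  have t: "t \<in> carrier G" using base N_carrier by blast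
  let ?e = "cm (inv t) h"
  have e: "?e \<in> N" using cm_N t h by simp
  have "(\<lambda>x. cj G h (delta t) x - delta t x) = (dif G ?e (delta t) :: 'a \<Rightarrow> 'k)"
    using t h e by (simp add: dif_def cj_delta tr_delta conj_eq_cm')
  moreover have "W (dif G ?e (delta t) :: 'a \<Rightarrow> 'k) (0 + 1)"
    using e gN wspan.base[OF base] unfolding good_def by blast
  ultimately show ?case by simp
next
  case (gen u n d m)
  let ?e = "cm h d" and ?v = "cj G h u"
  have d: "d \<in> N" "d \<in> carrier G" using A[OF gen.hyps(2)] N_carrier by auto
  have e: "?e \<in> good TYPE('k) (Suc m)" using gA gen.hyps(2) h by blast
  have v: "W ?v n"
    using wspan.add[OF wspan.weak[OF gen.IH, of n] gen.hyps(1)] by simp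
  have "cj G h (dif G d u) = (\<lambda>x. tr G d (dif G ?e ?v) x + dif G d ?v x)"
    using h d by (simp add: cj_dif conj_eq_cm dif_mult)
  then have "(\<lambda>x. cj G h (dif G d u) x - dif G d u x)
      = (\<lambda>x. tr G d (dif G ?e ?v) x + dif G d (\<lambda>x. ?v x - u x) x)"
    by (simp add: dif_diff add_diff_eq)
  moreover have "W (tr G d (dif G ?e ?v)) (n + Suc m)"
    using e v d unfolding good_def by (blast intro: wspan_tr)
  moreover have "W (dif G d (\<lambda>x. ?v x - u x)) (Suc n + m)"
    by (rule wspan.gen[OF gen.IH gen.hyps(2)])
  ultimately show ?case using wspan.add by fastforce
next
  case (zero n)
  then show ?case by (simp add: cj_0 wspan.zero)
next
  case (add u n v)
  then show ?case using wspan.add[OF add.IH] by (simp add: cj_add algebra_simps)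
next
  case (scale u n c)
  then show ?case using wspan.scale[OF scale.IH, of c] by (simp add: cj_scale algebra_simps)
next
  case (weak u n m)
  then show ?case by (auto intro: wspan.weak)
qed

text \<open>Every commutator raises the weight, because
  \<open>u c - h u h^-1 = u (c - 1) - (h u h^-1 - u)\<close> and both parts are heavier than
  \<open>u\<close>. After \<open>Suc L\<close> of them the weight exceeds that of every nonvanishing
  monomial.\<close>

lemma lie_zero_of_weights:
  assumes gN: "N \<subseteq> good TYPE('k::field) 1"
    and gA: "\<And>d m h. (d, m) \<in> A \<Longrightarrow> h \<in> carrier G \<Longrightarrow> cm h d \<in> good TYPE('k) (Suc m)"
    and mono: "\<And>ds t. set ds \<subseteq> A \<Longrightarrow> L < sum_list (map snd ds) \<Longrightarrow> t \<in> N \<Longrightarrow>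
      fold (dif G) (map fst ds) (delta t) = (\<lambda>_. 0 :: 'k)"
  shows "lie_zero TYPE('k) G (Suc L)"
proof -
  have step: "W (tstep G c h u) (Suc n)" if "W (u :: 'a \<Rightarrow> 'k) n" "c \<in> N" "h \<in> carrier G" for u n c h
  proof -
    have "W (dif G c u) (n + 1)" using gN that unfolding good_def by blast
    moreover have "tstep G c h u = (\<lambda>x. dif G c u x - (cj G h u x - u x))"
      by (simp add: tstep_def dif_def)
    ultimately show ?thesis using wspan_diff wspan_cj[OF gN gA that(1,3)] by fastforce
  qed
  have *: "\<exists>g'\<in>carrier G. \<exists>u'. fold (ad G) hs (tr G g u) = tr G g' u' \<and> W u' (n + length hs)"
    if "set hs \<subseteq> carrier G" "g \<in> carrier G" "W (u :: 'a \<Rightarrow> 'k) n" for hs g u n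
    using that
  proof (induction hs arbitrary: g u n)
    case (Cons h hs)
    then show ?case
      using Cons.IH[of "h \<otimes> g" "tstep G (cm g h) h u" "Suc n"] step[OF Cons.prems(3) cm_N[of g h], of h]
      by (simp add: ad_tr)
  qed auto
  show ?thesis
    unfolding lie_zero_def ad_zero_def
  proof (intro ballI allI impI)
    fix g hs assume g: "g \<in> carrier G" and hs: "set hs \<subseteq> carrier G" "length hs = Suc L"
    have "W (delta \<one> :: 'a \<Rightarrow> 'k) 0" by (intro wspan.base subgroup.one_closed[OF N])
    from *[OF hs(1) g this] obtain g' u' where u': "W u' (Suc L)"
      "fold (ad G) hs (tr G g (delta \<one>)) = (tr G g' u' :: 'a \<Rightarrow> 'k)" using hs(2) by auto
    have "u' = (\<lambda>_. 0)"
      using wspan_vanish[OF u'(1) mono, of L "[]"] by simp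
    then show "fold (ad G) hs (delta g) = (\<lambda>_. 0 :: 'k)"
      using u'(2) g by (simp add: tr_0 tr_delta)
  qed
qed

end

context group
begin

text \<open>The form in which weights are applied. A commutator with a generator is either trivial
  or lies in the group generated by strictly heavier generators, so that conjugation gains weight.
  It is enough that \<open>mono\<close> treats monomials in sorted order, because the factors
  commute.\<close>

lemma lie_zero_of_three_generators:
  assumes N: "subgroup N G" "\<And>s t. s \<in> N \<Longrightarrow> t \<in> N \<Longrightarrow> s \<otimes> t = t \<otimes> s"
    and cm_N: "\<And>g h. g \<in> carrier G \<Longrightarrow> h \<in> carrier G \<Longrightarrow> cm g h \<in> N"
    and xyz: "x \<in> N" "y \<in> N" "z \<in> N" and gens: "N \<subseteq> generate G {x, y, z}"
    and w: "1 \<le> wx" "1 \<le> wy" "1 \<le> wz"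
    and cz: "\<And>h. h \<in> carrier G \<Longrightarrow> cm h z = \<one>"
    and cy: "\<And>h. h \<in> carrier G \<Longrightarrow> cm h y = \<one> \<or> wy < wz \<and> cm h y \<in> generate G {z}"
    and cx: "\<And>h. h \<in> carrier G \<Longrightarrow> cm h x = \<one> \<or> wx < wy \<and> wx < wz \<and> cm h x \<in> generate G {y, z}"
    and mono: "\<And>a b c t. t \<in> N \<Longrightarrow> L < a * wx + b * wy + c * wz \<Longrightarrow>
      (dif G x ^^ a) ((dif G y ^^ b) ((dif G z ^^ c) (delta t))) = (\<lambda>_. 0 :: 'k::field)"
  shows "lie_zero TYPE('k) G (Suc L)"
proof -
  let ?A = "{(x, wx), (y, wy), (z, wz)}"
  interpret weighted_generators G N ?A
    by (intro weighted_generators.intro weighted_generators_axioms.intro is_group N cm_N) (use xyz in auto)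
  note sub = good_subgroup[where ?'k = 'k]
  have gx: "x \<in> good TYPE('k) m" if "m \<le> wx" for m
    using good_generator[of x wx, where ?'k = 'k] good_antimono[OF that, where ?'k = 'k] by auto
  have gy: "y \<in> good TYPE('k) m" if "m \<le> wy" for m
    using good_generator[of y wy, where ?'k = 'k] good_antimono[OF that, where ?'k = 'k] by auto
  have gz: "z \<in> good TYPE('k) m" if "m \<le> wz" for m
    using good_generator[of z wz, where ?'k = 'k] good_antimono[OF that, where ?'k = 'k] by auto
  have one: "\<one> \<in> good TYPE('k) m" for m using subgroup.one_closed[OF sub] .
  show ?thesis
  proof (rule lie_zero_of_weights)
    have "generate G {x, y, z} \<subseteq> good TYPE('k) 1"
      using w gx gy gz by (intro generate_subgroup_incl sub) auto
    then show "N \<subseteq> good TYPE('k) 1" using gens by blast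
  next
    fix d m h assume d: "(d, m) \<in> ?A" and h: "h \<in> carrier G"
    consider "d = x" "m = wx" | "d = y" "m = wy" | "d = z" "m = wz" using d by auto
    then show "cm h d \<in> good TYPE('k) (Suc m)"
    proof cases
      case 1
      show ?thesis
      proof (cases "cm h x = \<one>")
        case False
        then have *: "wx < wy" "wx < wz" "cm h x \<in> generate G {y, z}" using cx[OF h] by auto
        have "generate G {y, z} \<subseteq> good TYPE('k) (Suc wx)"
          using * gy gz by (intro generate_subgroup_incl sub) auto
        then show ?thesis using * 1 by blast
      qed (use 1 one in simp)
    next
      case 2
      show ?thesis
      proof (cases "cm h y = \<one>")
        case False
        then have *: "wy < wz" "cm h y \<in> generate G {z}" using cy[OF h] by auto
        have "generate G {z} \<subseteq> good TYPE('k) (Suc wy)"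
          using * gz by (intro generate_subgroup_incl sub) auto
        then show ?thesis using * 2 by blast
      qed (use 2 one in simp)
    next
      case 3
      then show ?thesis using cz[OF h] one by simp
    qed
  next
    fix ds t assume ds: "set ds \<subseteq> ?A" "L < sum_list (map snd ds)" and t: "t \<in> N"
    have comm: "(dif G s ^^ n) (dif G s' v) = dif G s' ((dif G s ^^ n) v)"
      if "s \<in> N" "s' \<in> N" for s s' n and v :: "'a \<Rightarrow> 'k"
      using that by (induction n) (simp_all add: dif_comm N_carrier N_comm)
    have fs: "(dif G s ^^ n) (dif G s v) = (dif G s ^^ Suc n) v" for s n and v :: "'a \<Rightarrow> 'k"
      by (simp add: funpow_swap1)
    have "\<exists>a b c. sum_list (map snd ds) = a * wx + b * wy + c * wz \<and>
        fold (dif G) (map fst ds) v = (dif G x ^^ a) ((dif G y ^^ b) ((dif G z ^^ c) v))"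
      for v :: "'a \<Rightarrow> 'k"
      using ds(1)
    proof (induction ds arbitrary: v)
      case Nil
      then show ?case by (intro exI[of _ 0]) simp
    next
      case (Cons e ds)
      have "set ds \<subseteq> ?A" using Cons.prems by simp
      from Cons.IH[OF this, of "dif G (fst e) v"] obtain a b c where abc: "sum_list (map snd ds) = a * wx + b * wy + c * wz"
        "fold (dif G) (map fst ds) (dif G (fst e) v) = (dif G x ^^ a) ((dif G y ^^ b) ((dif G z ^^ c) (dif G (fst e) v)))"
        by blast
      consider "e = (x, wx)" | "e = (y, wy)" | "e = (z, wz)" using Cons.prems by auto
      then show ?case
      proof cases
        case 1
        then show ?thesis using abc xyz
          by (intro exI[of _ "Suc a"] exI[of _ b] exI[of _ c]) (simp add: comm[OF xyz(3,1)] comm[OF xyz(2,1)] funpow_swap1)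
      next
        case 2
        then show ?thesis using abc xyz
          by (intro exI[of _ a] exI[of _ "Suc b"] exI[of _ c]) (simp add: comm[OF xyz(3,2)] funpow_swap1)
      next
        case 3
        then show ?thesis using abc xyz
          by (intro exI[of _ a] exI[of _ b] exI[of _ "Suc c"]) (simp add: funpow_swap1)
      qed
    qed
    then obtain a b c where "sum_list (map snd ds) = a * wx + b * wy + c * wz"
      "fold (dif G) (map fst ds) (delta t :: 'a \<Rightarrow> 'k) = (dif G x ^^ a) ((dif G y ^^ b) ((dif G z ^^ c) (delta t)))"
      by blast
    then show "fold (dif G) (map fst ds) (delta t) = (\<lambda>_. 0 :: 'k)"
      using mono[OF t] ds(2) by simp
  qed
qed

lemma funpow_dif_eq_0:
  assumes v: "(v :: 'a \<Rightarrow> 'k::field) \<in> ga_carrier G" and t: "t \<in> carrier G"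
    and p: "CHAR('k) = p" "prime p" and tp: "t [^] p = \<one>" and a: "p \<le> a"
  shows "(dif G t ^^ a) v = (\<lambda>_. 0)"
proof -
  have "(dif G t ^^ p) v = (\<lambda>_. 0)"
    using dif_funpow_prime[OF v t p] tp tr_one[of v] ga_carrier_outside[OF v] by (simp add: dif_def)
  moreover have "(dif G t ^^ a) v = (dif G t ^^ (a - p)) ((dif G t ^^ p) v)"
    using a by (simp add: funpow_add[symmetric, THEN fun_cong, unfolded comp_apply])
  ultimately show ?thesis by simp
qed

end

section \<open>Upper bounds for noncyclic derived subgroups of order \<open>p^2\<close>\<close>

definition derived_cyclic :: "('a, 'b) monoid_scheme \<Rightarrow> bool" where
  "derived_cyclic G \<longleftrightarrow> (\<exists>y\<in>carrier G. lcs G 2 = generate G {y})"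

context group
begin

lemma centralizer_subgroup:
  assumes "T \<subseteq> carrier G"
  shows "subgroup {g \<in> carrier G. \<forall>t\<in>T. g \<otimes> t = t \<otimes> g} G"
proof (rule subgroupI)
  fix a assume a: "a \<in> {g \<in> carrier G. \<forall>t\<in>T. g \<otimes> t = t \<otimes> g}"
  have "inv a \<otimes> t = t \<otimes> inv a" if "t \<in> T" for t
  proof -
    have t: "t \<in> carrier G" "a \<otimes> t = t \<otimes> a" using a that assms by auto
    have "inv a \<otimes> (a \<otimes> t) \<otimes> inv a = inv a \<otimes> (t \<otimes> a) \<otimes> inv a" using t by simp
    then show ?thesis using a t(1) by (simp add: m_assoc)
  qed
  then show "inv a \<in> {g \<in> carrier G. \<forall>t\<in>T. g \<otimes> t = t \<otimes> g}" using a by simp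
next
  fix a b assume a: "a \<in> {g \<in> carrier G. \<forall>t\<in>T. g \<otimes> t = t \<otimes> g}"
    and b: "b \<in> {g \<in> carrier G. \<forall>t\<in>T. g \<otimes> t = t \<otimes> g}"
  have "a \<otimes> b \<otimes> t = t \<otimes> (a \<otimes> b)" if "t \<in> T" for t
  proof -
    have t: "t \<in> carrier G" "a \<otimes> t = t \<otimes> a" "b \<otimes> t = t \<otimes> b" using a b that assms by auto
    have "a \<otimes> b \<otimes> t = a \<otimes> (t \<otimes> b)" using a b t by (simp add: m_assoc)
    also have "\<dots> = (t \<otimes> a) \<otimes> b" using a b t by (simp add: m_assoc[symmetric])
    finally show ?thesis using a b t by (simp add: m_assoc)
  qed
  then show "a \<otimes> b \<in> {g \<in> carrier G. \<forall>t\<in>T. g \<otimes> t = t \<otimes> g}" using a b by simp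
next
  have "\<one> \<in> {g \<in> carrier G. \<forall>t\<in>T. g \<otimes> t = t \<otimes> g}" using assms by auto
  then show "{g \<in> carrier G. \<forall>t\<in>T. g \<otimes> t = t \<otimes> g} \<noteq> {}" by blast
qed auto

lemma generate_commute:
  assumes S: "S \<subseteq> carrier G" "\<And>s t. s \<in> S \<Longrightarrow> t \<in> S \<Longrightarrow> s \<otimes> t = t \<otimes> s"
    and ab: "a \<in> generate G S" "b \<in> generate G S"
  shows "a \<otimes> b = b \<otimes> a"
proof -
  have 1: "generate G S \<subseteq> {g \<in> carrier G. \<forall>t\<in>S. g \<otimes> t = t \<otimes> g}"
    using S by (intro generate_subgroup_incl centralizer_subgroup) auto
  have "S \<subseteq> {g \<in> carrier G. \<forall>t\<in>generate G S. g \<otimes> t = t \<otimes> g}"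
  proof
    fix s assume "s \<in> S"
    then show "s \<in> {g \<in> carrier G. \<forall>t\<in>generate G S. g \<otimes> t = t \<otimes> g}"
      using 1 S(1) by fastforce
  qed
  then have "generate G S \<subseteq> {g \<in> carrier G. \<forall>t\<in>generate G S. g \<otimes> t = t \<otimes> g}"
    using centralizer_subgroup[OF generate_incl[OF S(1)]] by (rule generate_subgroup_incl)
  then show ?thesis using ab by blast
qed

lemma prime_index_eq:
  assumes M: "subgroup M G" and B: "subgroup B G" and N: "subgroup N G" and sub: "M \<subseteq> B" "B \<subseteq> N" "finite N"
    and card: "card N = p * card M" "prime p" and x: "x \<in> B" "x \<notin> M"
  shows "B = N"
proof -
  obtain a where a: "card B = card M * a" using subgroup_card_dvd[OF M B sub(1)] by blast
  have M0: "card M > 0"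
    using sub subgroup.one_closed[OF M] by (metis card_gt_0_iff empty_iff finite_subset)
  have "card M * a dvd card M * p"
    using subgroup_card_dvd[OF B N sub(2)] a card by (simp add: mult.commute)
  then have "a dvd p" using M0 by simp
  moreover have "a \<noteq> 1"
  proof
    assume "a = 1"
    then have "M = B" using a sub by (intro card_subset_eq) (auto intro: finite_subset)
    then show False using x by simp
  qed
  ultimately have "a = p" using card(2) prime_nat_iff by blast
  then have "card B = card N" using a card by simp
  then show ?thesis using sub by (intro card_subset_eq) auto
qed

lemma generate_subset_subgroup: "subgroup H G \<Longrightarrow> S \<subseteq> H \<Longrightarrow> generate G S \<subseteq> H"
  by (rule generate_subgroup_incl)

text \<open>The third generator is taken to be \<open>\<one>\<close>. Its weight only has to exceed
  \<open>wx\<close> and \<open>wy\<close>, since every monomial containing the factor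
  \<open>\<one> - 1\<close> is zero. Commutativity of \<open>N\<close> follows from \<open>y\<close>
  being central.\<close>

lemma lie_zero_of_two_generators:
  assumes N: "subgroup N G"
    and cm_N: "\<And>g h. g \<in> carrier G \<Longrightarrow> h \<in> carrier G \<Longrightarrow> cm g h \<in> N"
    and xy: "x \<in> N" "y \<in> N" and gens: "N \<subseteq> generate G {x, y}"
    and w: "1 \<le> wx" "1 \<le> wy"
    and cy: "\<And>h. h \<in> carrier G \<Longrightarrow> cm h y = \<one>"
    and cx: "\<And>h. h \<in> carrier G \<Longrightarrow> cm h x = \<one> \<or> wx < wy \<and> cm h x \<in> generate G {y}"
    and mono: "\<And>a b t. t \<in> N \<Longrightarrow> L < a * wx + b * wy \<Longrightarrow>
      (dif G x ^^ a) ((dif G y ^^ b) (delta t)) = (\<lambda>_. 0 :: 'k::field)"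
  shows "lie_zero TYPE('k) G (Suc L)"
proof -
  have Nc: "t \<in> carrier G" if "t \<in> N" for t using subgroup.mem_carrier[OF N that] .
  have "x \<otimes> y = y \<otimes> x" using cm_eq_one_iff cy[of x] Nc xy by simp
  then have xy_comm: "s \<otimes> t = t \<otimes> s" if "s \<in> {x, y}" "t \<in> {x, y}" for s t
    using that by (metis insertE singletonD)
  have "{x, y} \<subseteq> carrier G" using Nc xy by simp
  then have comm: "s \<otimes> t = t \<otimes> s" if "s \<in> N" "t \<in> N" for s t
    using gens that by (intro generate_commute[OF \<open>{x, y} \<subseteq> carrier G\<close> xy_comm]) auto
  show ?thesis
  proof (rule lie_zero_of_three_generators[where x = x and y = y and z = \<one> and wx = wx and wy = wy
        and wz = "Suc (wx + wy + L)", OF N comm cm_N xy])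
    show "\<one> \<in> N" using subgroup.one_closed[OF N] .
    show "N \<subseteq> generate G {x, y, \<one>}"
      using gens mono_generate[of "{x, y}" "{x, y, \<one>}"] by blast
    show "cm h \<one> = \<one>" if "h \<in> carrier G" for h using that by (simp add: cm_def)
    show "cm h y = \<one> \<or> wy < Suc (wx + wy + L) \<and> cm h y \<in> generate G {\<one>}" if "h \<in> carrier G" for h
      using cy that by blast
    show "cm h x = \<one> \<or> wx < wy \<and> wx < Suc (wx + wy + L) \<and> cm h x \<in> generate G {y, \<one>}" if "h \<in> carrier G" for h
      using cx[OF that] mono_generate[of "{y}" "{y, \<one>}"] by auto
    fix a b c t assume t: "t \<in> N" and lt: "L < a * wx + b * wy + c * Suc (wx + wy + L)"
    show "(dif G x ^^ a) ((dif G y ^^ b) ((dif G \<one> ^^ c) (delta t))) = (\<lambda>_. 0 :: 'k)"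
    proof (cases c)
      case 0
      then show ?thesis using mono t lt by simp
    next
      case (Suc d)
      have "dif G \<one> (delta t) = (\<lambda>_. 0 :: 'k)"
        using Nc[OF t] by (simp add: dif_def tr_delta)
      then show ?thesis unfolding Suc by (simp add: funpow_swap1)
    qed
  qed (use w in auto)
qed

end

lemma (in central_quotient) derived_cyclic_quotient:
  assumes zN: "z \<in> lcs G 2" and fin: "finite (lcs G 2)" and c: "derived_cyclic H"
  obtains y where "y \<in> lcs G 2" "\<And>x. x \<in> lcs G 2 \<Longrightarrow> \<exists>(i::nat) (j::nat). x = y [^]\<^bsub>G\<^esub> i \<otimes>\<^bsub>G\<^esub> z [^]\<^bsub>G\<^esub> j"
proof -
  obtain y' where y': "y' \<in> carrier H" "lcs H 2 = generate H {y'}" using c unfolding derived_cyclic_def by blast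
  then have "y' \<in> \<phi> ` lcs G 2" using img_lcs[of 2] generate.incl[of y' "{y'}" H] by simp
  then obtain y where y: "y \<in> lcs G 2" "y' = \<phi> y" by blast
  have yG: "y \<in> carrier G" using y G.lcs_carrier by blast
  have "finite (lcs H 2)" using fin img_lcs[of 2] by (metis finite_imageI)
  then have "H.ord y' > 0" using y' generate.incl[of y' "{y'}" H] by (intro H.ord_pos_of_finite[OF H.lcs_subgroup[of 2]]) auto
  then have gen: "lcs H 2 = (\<lambda>i. y' [^]\<^bsub>H\<^esub> (i::nat)) ` {..<H.ord y'}"
    using H.generate_single_nat[OF y'(1)] y'(2) by simp
  show thesis
  proof (rule that[OF y(1)])
    fix x assume x: "x \<in> lcs G 2"
    have xG: "x \<in> carrier G" using x G.lcs_carrier by blast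
    have "\<phi> x \<in> lcs H 2" using x img_lcs[of 2] by blast
    then obtain i :: nat where "\<phi> x = y' [^]\<^bsub>H\<^esub> i" using gen by auto
    then have "\<phi> (y [^]\<^bsub>G\<^esub> i) = \<phi> x" using y yG by (simp add: hom_nat_pow)
    then show "\<exists>(i::nat) (j::nat). x = y [^]\<^bsub>G\<^esub> i \<otimes>\<^bsub>G\<^esub> z [^]\<^bsub>G\<^esub> j"
      using fibre[of "y [^]\<^bsub>G\<^esub> i" x] yG xG by auto
  qed
qed

text \<open>The data pass to the quotient by a central element of order \<open>p\<close> inside
  \<open>N\<close>, with \<open>n\<close> lowered by one and the same \<open>s\<close>, which is
  what the inductions rely on.\<close>

locale p_derived = group G for G (structure) +
  fixes p s n :: nat
  assumes p: "prime p" and fin: "finite (lcs G 2)" and pc: "powers_central G (p ^ s)"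
    and card: "card (lcs G 2) = p ^ n"
begin

lemma p_gt_1: "p > 1" using p prime_gt_1_nat by blast

lemma fin_lcs: "2 \<le> m \<Longrightarrow> finite (lcs G m)"
  using lcs_antimono[of 2 m] fin finite_subset by blast

lemma card_lcs:
  assumes "2 \<le> m"
  obtains k where "card (lcs G m) = p ^ k"
  using subgroup_card_dvd[OF lcs_subgroup lcs_subgroup lcs_antimono[OF assms]] card divides_primepow_nat[OF p] by metis

lemma terminates: "\<exists>c. lcs G (Suc c) = {\<one>}"
  using lcs_terminates[OF is_group fin pc p] card by blast

text \<open>If two consecutive terms agreed, the series would be constant from there on and could
  not reach the trivial subgroup.\<close>

lemma lcs_strict:
  assumes "lcs G m \<noteq> {\<one>}" "1 \<le> m"
  shows "lcs G (Suc m) \<noteq> lcs G m"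
proof
  assume eq: "lcs G (Suc m) = lcs G m"
  have "lcs G (m + j) = lcs G m" for j
  proof (induction j)
    case (Suc j)
    have "lcs G (Suc (m + j)) = lcs G (Suc m)"
      using Suc assms(2) by (simp only: lcs_Suc trans_le_add1)
    then show ?case using eq by simp
  qed simp
  then have "lcs G m = lcs G (m + Suc c)" for c by (simp only:)
  moreover obtain c where "lcs G (Suc c) = {\<one>}" using terminates by blast
  ultimately have "lcs G m = {\<one>}" using lcs_trivial_above[of "Suc c" "m + Suc c"] by simp
  then show False using assms(1) by blast
qed

lemma central_element:
  assumes "subgroup M G" "\<And>g m. g \<in> carrier G \<Longrightarrow> m \<in> M \<Longrightarrow> g \<otimes> m \<otimes> inv g \<in> M" "M \<subseteq> lcs G 2" "M \<noteq> {\<one>}"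
  obtains z where "z \<in> M" "ord z = p" "\<And>g. g \<in> carrier G \<Longrightarrow> g \<otimes> z = z \<otimes> g"
  using normal_p_subgroup_central_element[OF assms(1,2) finite_subset[OF assms(3) fin] p assms(4) _ pc]
    subgroup_card_dvd[OF assms(1) lcs_subgroup assms(3)] card by metis

lemma quotient_exists:
  assumes "z \<in> lcs G 2" "ord z = p" "\<And>g. g \<in> carrier G \<Longrightarrow> g \<otimes> z = z \<otimes> g"
  obtains H :: "('a, 'b) monoid_scheme" and \<phi> where "central_quotient G H \<phi> z p" "p_derived H p s (n - 1)" "n > 0"
    "card (lcs G 2) = p * card (lcs H 2)"
proof -
  have zG: "z \<in> carrier G" using assms lcs_carrier by blast
  obtain H :: "('a, 'b) monoid_scheme" and \<phi> where "central_quotient G H \<phi> z (ord z)"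
    using central_quotient_exists[OF zG assms(3)] assms(2) p_gt_1 by auto
  then interpret Q: central_quotient G H \<phi> z p using assms(2) by simp
  have c: "card (lcs G 2) = p * card (lcs H 2)"
    using Q.card_img[OF lcs_subgroup assms(1) fin] Q.img_lcs[of 2] by simp
  have n0: "n > 0"
  proof (rule gr0I)
    assume "n = 0"
    then have "p * card (lcs H 2) = 1" using c card by simp
    then show False using p_gt_1 by simp
  qed
  then have cn: "card (lcs H 2) = p ^ (n - 1)"
    using c card p_gt_1 by (cases n) auto
  have "p_derived H p s (n - 1)"
  proof (unfold_locales)
    show "finite (lcs H 2)" using fin Q.img_lcs[of 2] by (metis finite_imageI)
    show "powers_central H (p ^ s)" by (rule Q.powers_central_quotient[OF pc])
  qed (use p cn in auto)
  then show thesis using that Q.central_quotient_axioms n0 c by blast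
qed

lemma card_gt_one: "lcs G m \<noteq> {\<one>} \<Longrightarrow> 2 \<le> m \<Longrightarrow> card (lcs G m) > 1"
  using fin_lcs[of m] one_in_lcs[of m]
  by (metis (no_types) card_1_singletonE card_gt_0_iff empty_iff less_one nat_neq_iff singletonD)

lemma exponent_of_noncyclic_square:
  assumes "n = 2" "\<not> derived_cyclic G" "x \<in> lcs G 2"
  shows "x [^] p = \<one>"
proof -
  have xG: "x \<in> carrier G" using assms lcs_carrier by blast
  obtain i where i: "i \<le> 2" "ord x = p ^ i"
    using ord_dvd_subgroup_card[OF lcs_subgroup assms(3)] card assms(1) divides_primepow_nat[OF p] by metis
  have "i \<noteq> 2"
  proof
    assume "i = 2"
    then have "card (generate G {x}) = card (lcs G 2)" using generate_pow_card[OF xG] i card assms(1) by simp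
    then have "generate G {x} = lcs G 2"
      using fin generate_subset_subgroup[OF lcs_subgroup, of "{x}"] assms(3) by (intro card_subset_eq) auto
    then show False using assms(2) xG unfolding derived_cyclic_def by blast
  qed
  then have "ord x dvd p" using i by (cases i) auto
  then show ?thesis using pow_eq_id[OF xG] by simp
qed

lemma central_of_next_trivial:
  assumes "lcs G (Suc m) = {\<one>}" "u \<in> lcs G m" "1 \<le> m" "h \<in> carrier G"
  shows "cm h u = \<one>"
  using cm_in_lcs(2)[OF assms(2,4,3)] assms(1) by simp

text \<open>Both generators are central of order \<open>p\<close> and get weight 1, so the heaviest
  nonzero monomial has weight \<open>2 (p - 1)\<close>, one less than the number of steps.\<close>

lemma lie_zero_square_class_2:
  assumes n: "n = 2" and nc: "\<not> derived_cyclic G" and l3: "lcs G 3 = {\<one>}" and K: "CHAR('k::field) = p"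
  shows "lie_zero TYPE('k) G (2 * p - 1)"
proof -
  let ?N = "lcs G 2"
  have N: "subgroup ?N G" by (rule lcs_subgroup)
  have "card ?N > 1" using card n one_less_power[OF p_gt_1, of 2] by simp
  then have "?N \<noteq> {\<one>}" by auto
  then obtain z where z: "z \<in> ?N" "ord z = p" using central_element[OF N lcs_conj] by blast
  have zG: "z \<in> carrier G" using z lcs_carrier by blast
  have "?N \<noteq> generate G {z}" using nc zG unfolding derived_cyclic_def by blast
  moreover have gz: "generate G {z} \<subseteq> ?N" using z by (intro generate_subset_subgroup N) auto
  ultimately obtain x where x: "x \<in> ?N" "x \<notin> generate G {z}" by blast
  have xG: "x \<in> carrier G" using x lcs_carrier by blast
  have "card ?N = p * card (generate G {z})"
    using card n z generate_pow_card[OF zG] by (simp add: power2_eq_square)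
  then have "generate G {x, z} = ?N"
    using prime_index_eq[OF _ _ N _ _ fin _ p, of "generate G {z}" "generate G {x, z}" x]
      generate_is_subgroup mono_generate[of "{z}" "{x, z}"] generate.incl[of x "{x, z}"] x z xG zG
      generate_subset_subgroup[OF N, of "{x, z}"] by auto
  moreover have cen: "cm h u = \<one>" if "u \<in> ?N" "h \<in> carrier G" for u h
    using central_of_next_trivial[of 2] l3 that by (simp add: numeral_3_eq_3 numeral_2_eq_2)
  moreover have "(dif G x ^^ a) ((dif G z ^^ b) (delta t)) = (\<lambda>_. 0 :: 'k)"
    if t: "t \<in> ?N" and lt: "2 * p - 2 < a * 1 + b * 1" for a b t
  proof (cases "p \<le> b")
    case True
    then have "(dif G z ^^ b) (delta t) = (\<lambda>_. 0 :: 'k)"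
      using exponent_of_noncyclic_square[OF n nc z(1)] delta_in_ga_carrier lcs_carrier[OF t]
      by (intro funpow_dif_eq_0[OF _ zG K p]) auto
    then show ?thesis by simp
  next
    case False
    then have "p \<le> a" using lt by simp
    then show ?thesis
      using exponent_of_noncyclic_square[OF n nc x(1)] delta_in_ga_carrier lcs_carrier[OF t] zG
      by (intro funpow_dif_eq_0[OF _ xG K p]) (auto intro: funpow_dif_in_ga_carrier)
  qed
  ultimately have "lie_zero TYPE('k) G (Suc (2 * p - 2))"
    using x z cm_in_derived
    by (intro lie_zero_of_two_generators[where N = ?N and x = x and y = z and wx = 1 and wy = 1, OF N]) auto
  moreover have "Suc (2 * p - 2) = 2 * p - 1" using p_gt_1 by simp
  ultimately show ?thesis by simp
qed

text \<open>Between \<open>N\<close> of order \<open>p^2\<close> and the trivial group the strictly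
  descending series has room for a single term.\<close>

lemma square_third_term:
  assumes n: "n = 2" and nc: "\<not> derived_cyclic G" and l3: "lcs G 3 \<noteq> {\<one>}"
  shows "card (lcs G 3) = p" "lcs G 4 = {\<one>}"
proof -
  let ?N = "lcs G 2" and ?M = "lcs G 3"
  have N: "subgroup ?N G" and M: "subgroup ?M G" by (rule lcs_subgroup)+
  have MN: "?M \<subseteq> ?N" using lcs_antimono[of 2 3] by simp
  have "?N \<noteq> {\<one>}" using MN l3 one_in_lcs[of 3] by auto
  then have ne: "?M \<noteq> ?N" using lcs_strict[of 2] by (simp add: numeral_3_eq_3 numeral_2_eq_2)
  obtain k where k: "card ?M = p ^ k" using card_lcs[of 3] by auto
  have "card ?M < p ^ 2" using psubset_card_mono[OF fin, of ?M] MN ne card n by auto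
  then have "k < 2" using k p_gt_1 by simp
  moreover have "k \<noteq> 0" using card_gt_one[OF l3] k by (auto intro: gr0I)
  ultimately have "k = 1" by linarith
  then show cM: "card ?M = p" using k by simp
  have M4: "lcs G 4 \<subseteq> ?M" using lcs_antimono[of 3 4] by simp
  have "lcs G 4 \<noteq> ?M" using lcs_strict[OF l3] by (simp add: eval_nat_numeral)
  show l4: "lcs G 4 = {\<one>}"
  proof (rule ccontr)
    assume "lcs G 4 \<noteq> {\<one>}"
    then have "card (lcs G 4) > 1" using card_gt_one by simp
    moreover have "card (lcs G 4) dvd p" using subgroup_card_dvd[OF lcs_subgroup M M4] cM by simp
    ultimately have "card (lcs G 4) = card ?M" using p cM by (metis nat_neq_iff prime_nat_iff)
    then have "lcs G 4 = ?M" using M4 fin_lcs[of 3] by (intro card_subset_eq) auto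
    then show False using \<open>lcs G 4 \<noteq> ?M\<close> by blast
  qed
qed

text \<open>The commutators of \<open>x\<close> lie in \<open>gamma_3 = <z>\<close>, so
  \<open>z\<close> needs weight 2, and the heaviest nonzero monomial has weight
  \<open>(p - 1) + 2 (p - 1)\<close>.\<close>

lemma lie_zero_square_class_3:
  assumes n: "n = 2" and nc: "\<not> derived_cyclic G" and l3: "lcs G 3 \<noteq> {\<one>}" and K: "CHAR('k::field) = p"
  shows "lie_zero TYPE('k) G (3 * p - 2)"
proof -
  let ?N = "lcs G 2" and ?M = "lcs G 3"
  have N: "subgroup ?N G" and M: "subgroup ?M G" by (rule lcs_subgroup)+
  have MN: "?M \<subseteq> ?N" using lcs_antimono[of 2 3] by simp
  note cM = square_third_term(1)[OF n nc l3] and l4 = square_third_term(2)[OF n nc l3]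
  have ne: "?M \<noteq> ?N"
  proof
    assume "?M = ?N"
    then have "p ^ 2 = p" using cM card n by simp
    then show False using p_gt_1 by (simp add: power2_eq_square)
  qed
  obtain z where z: "z \<in> ?M" "ord z = p" using central_element[OF M lcs_conj MN l3] by blast
  have zG: "z \<in> carrier G" using z lcs_carrier by blast
  have gM: "generate G {z} = ?M"
    using generate_subset_subgroup[OF M, of "{z}"] z generate_pow_card[OF zG] cM fin_lcs[of 3]
    by (intro card_subset_eq) auto
  obtain x where x: "x \<in> ?N" "x \<notin> ?M" using ne MN by blast
  have xG: "x \<in> carrier G" using x lcs_carrier by blast
  have zN: "z \<in> ?N" using z MN by blast
  have "card ?N = p * card ?M" using card n cM by (simp add: power2_eq_square)
  then have "generate G {x, z} = ?N"
    using prime_index_eq[OF M _ N _ _ fin _ p, of "generate G {x, z}" x]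
      generate_is_subgroup mono_generate[of "{z}" "{x, z}"] generate.incl[of x "{x, z}"] x z xG zG gM MN zN
      generate_subset_subgroup[OF N, of "{x, z}"] by auto
  moreover have "cm h z = \<one>" if "h \<in> carrier G" for h
    using central_of_next_trivial[of 3] l4 that z by (simp add: eval_nat_numeral)
  moreover have "cm h x \<in> generate G {z}" if "h \<in> carrier G" for h
    using cm_in_lcs(2)[OF x(1) that] gM by (simp add: eval_nat_numeral)
  moreover have "(dif G x ^^ a) ((dif G z ^^ b) (delta t)) = (\<lambda>_. 0 :: 'k)"
    if t: "t \<in> ?N" and lt: "3 * p - 3 < a * 1 + b * 2" for a b t
  proof (cases "p \<le> b")
    case True
    then have "(dif G z ^^ b) (delta t) = (\<lambda>_. 0 :: 'k)"
      using exponent_of_noncyclic_square[OF n nc] z MN delta_in_ga_carrier lcs_carrier[OF t]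
      by (intro funpow_dif_eq_0[OF _ zG K p]) auto
    then show ?thesis by simp
  next
    case False
    then have "p \<le> a" using lt by simp
    then show ?thesis
      using exponent_of_noncyclic_square[OF n nc x(1)] delta_in_ga_carrier lcs_carrier[OF t] zG
      by (intro funpow_dif_eq_0[OF _ xG K p]) (auto intro: funpow_dif_in_ga_carrier)
  qed
  ultimately have "lie_zero TYPE('k) G (Suc (3 * p - 3))"
    using x z MN cm_in_derived
    by (intro lie_zero_of_two_generators[where N = ?N and x = x and y = z and wx = 1 and wy = 2, OF N]) auto
  moreover have "Suc (3 * p - 3) = 3 * p - 2" using p_gt_1 by simp
  ultimately show "lie_zero TYPE('k) G (3 * p - 2)" by simp
qed

end

section \<open>Subgroups of index two and monomials in characteristic 2\<close>

context group
begin

lemma index_two_cosets: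
  assumes M: "subgroup M G" and N: "subgroup N G" and sub: "M \<subseteq> N" "finite N" "card N = 2 * card M"
    and x: "x \<in> N" "x \<notin> M" and y: "y \<in> N" "y \<notin> M"
  obtains m where "m \<in> M" "y = x \<otimes> m"
proof -
  have c: "t \<in> carrier G" if "t \<in> N" for t using subgroup.mem_carrier[OF N that] .
  let ?X = "(\<lambda>m. x \<otimes> m) ` M"
  have "inj_on (\<lambda>m. x \<otimes> m) M" by (rule inj_onI) (metis c l_cancel sub(1) subsetD x(1))
  then have cX: "card ?X = card M" by (rule card_image)
  have "M \<inter> ?X = {}"
  proof (rule ccontr)
    assume "M \<inter> ?X \<noteq> {}"
    then obtain m where m: "m \<in> M" "x \<otimes> m \<in> M" by auto
    have "x = (x \<otimes> m) \<otimes> inv m" using c x m sub by (simp add: m_assoc subset_iff)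
    then show False using x m subgroup.m_closed[OF M m(2) subgroup.m_inv_closed[OF M m(1)]] by simp
  qed
  then have "card (M \<union> ?X) = card N"
    using cX sub finite_subset[OF sub(1,2)] by (simp add: card_Un_disjoint)
  moreover have "M \<union> ?X \<subseteq> N" using sub x subgroup.m_closed[OF N] by auto
  ultimately have "M \<union> ?X = N" using sub by (intro card_subset_eq) auto
  then show thesis using that y by auto
qed

lemma index_two_square:
  assumes M: "subgroup M G" and N: "subgroup N G" and sub: "M \<subseteq> N" "finite N" "card N = 2 * card M"
    and x: "x \<in> N"
  shows "x \<otimes> x \<in> M"
proof (cases "x \<in> M")
  case True
  then show ?thesis using subgroup.m_closed[OF M] by blast
next
  case False
  have c: "t \<in> carrier G" if "t \<in> N" for t using subgroup.mem_carrier[OF N that] .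
  show ?thesis
  proof (rule ccontr)
    assume "x \<otimes> x \<notin> M"
    then obtain m where "m \<in> M" "x \<otimes> x = x \<otimes> m"
      using index_two_cosets[OF M N sub x False, of "x \<otimes> x"] subgroup.m_closed[OF N x x] by blast
    then show False using False c x sub by (metis l_cancel subsetD)
  qed
qed

text \<open>In characteristic 2, \<open>(x - 1)^2 = x^2 - 1\<close>. As \<open>x^2\<close> is a
  product of \<open>y\<close> and \<open>z\<close>, this factor annihilates
  \<open>(y - 1) (z - 1)\<close>; and \<open>(x - 1)^4 = x^4 - 1 = 0\<close>. Without the last
  alternative of \<open>abc\<close> the weight bounds for order 8 would come out too large.\<close>

lemma monomials_vanish:
  assumes K: "CHAR('k::field) = 2" and v: "(v :: 'a \<Rightarrow> 'k) \<in> ga_carrier G"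
    and xyz: "x \<in> carrier G" "y \<in> carrier G" "z \<in> carrier G" "y \<otimes> z = z \<otimes> y"
    and sq: "y \<otimes> y = \<one>" "z \<otimes> z = \<one>" "x \<otimes> x \<in> {\<one>, y, z, y \<otimes> z}"
    and abc: "2 \<le> b \<or> 2 \<le> c \<or> 4 \<le> a \<or> 2 \<le> a \<and> b = 1 \<and> c = 1"
  shows "(dif G x ^^ a) ((dif G y ^^ b) ((dif G z ^^ c) v)) = (\<lambda>_. 0)"
proof -
  have two: "prime (2::nat)" by simp
  have pow2: "t [^] (2::nat) = t \<otimes> t" if "t \<in> carrier G" for t
    using that by (simp add: numeral_2_eq_2)
  have dd: "dif G t (dif G t f) = dif G (t \<otimes> t) f" if "f \<in> ga_carrier G" "t \<in> carrier G"
    for t and f :: "'a \<Rightarrow> 'k"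
    using dif_funpow_prime[OF that K two] pow2[OF that(2)] by (simp add: numeral_2_eq_2)
  have d1: "dif G \<one> f = (\<lambda>_. 0)" if "f \<in> ga_carrier G" for f :: "'a \<Rightarrow> 'k"
    using tr_one[of f] ga_carrier_outside[OF that] by (simp add: dif_def)
  have z0: "(dif G z ^^ c) v = (\<lambda>_. 0)" if "2 \<le> c"
    using funpow_dif_eq_0[OF v xyz(3) K two _ that] pow2 xyz sq by simp
  have y0: "(dif G y ^^ b) w = (\<lambda>_. 0)" if "2 \<le> b" "w \<in> ga_carrier G" for w :: "'a \<Rightarrow> 'k"
    using funpow_dif_eq_0[OF that(2) xyz(2) K two _ that(1)] pow2 xyz sq by simp
  let ?w = "(dif G z ^^ c) v" let ?u = "(dif G y ^^ b) ?w"
  have w: "?w \<in> ga_carrier G" using v xyz by (simp add: funpow_dif_in_ga_carrier)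
  have u: "?u \<in> ga_carrier G" using w xyz by (simp add: funpow_dif_in_ga_carrier)
  have red: "(dif G x ^^ a) f = (dif G x ^^ (a - 2)) (dif G (x \<otimes> x) f)" if "2 \<le> a" "f \<in> ga_carrier G"
    for a and f :: "'a \<Rightarrow> 'k"
  proof -
    have "(dif G x ^^ a) f = (dif G x ^^ (a - 2 + 2)) f" using that by (simp only: le_add_diff_inverse2)
    also have "\<dots> = (dif G x ^^ (a - 2)) ((dif G x ^^ 2) f)" by (simp only: funpow_add comp_apply)
    finally show ?thesis using dd[OF that(2) xyz(1)] by (simp add: numeral_2_eq_2)
  qed
  have x4: "x \<otimes> x \<otimes> (x \<otimes> x) = \<one>"
  proof -
    have "(y \<otimes> z) \<otimes> (y \<otimes> z) = (y \<otimes> y) \<otimes> (z \<otimes> z)"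
      using xyz by (metis m_assoc m_closed)
    then show ?thesis using sq xyz by auto
  qed
  consider "2 \<le> b" | "2 \<le> c" | "4 \<le> a" | "2 \<le> a" "b = 1" "c = 1" using abc by blast
  then show ?thesis
  proof cases
    case 1
    then show ?thesis using y0[OF _ w] by simp
  next
    case 2
    then show ?thesis using z0 by simp
  next
    case 3
    have "(dif G x ^^ a) ?u = (dif G x ^^ (a - 2)) (dif G (x \<otimes> x) ?u)" using red 3 u by simp
    also have "\<dots> = (dif G x ^^ (a - 2 - 2)) (dif G (x \<otimes> x) (dif G (x \<otimes> x) ?u))"
      using 3 u xyz by (intro red) (auto intro: dif_in_ga_carrier)
    also have "dif G (x \<otimes> x) (dif G (x \<otimes> x) ?u) = (\<lambda>_. 0)"
      using dd[OF u, of "x \<otimes> x"] d1[OF u] x4 xyz by simp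
    finally show ?thesis by simp
  next
    case 4
    have u': "?u = dif G y (dif G z v)" using 4 by simp
    have dyu: "dif G y ?u = (\<lambda>_. 0)"
      unfolding u' using dd[of "dif G z v" y] d1 v xyz sq by (simp add: dif_in_ga_carrier)
    have "dif G z (dif G y (dif G z v)) = dif G y (dif G z (dif G z v))"
      using xyz by (intro dif_comm) auto
    also have "\<dots> = (\<lambda>_. 0)" using dd[OF v xyz(3)] d1[OF v] sq by simp
    finally have dzu: "dif G z ?u = (\<lambda>_. 0)" unfolding u' .
    have "dif G (y \<otimes> z) ?u = (\<lambda>_. 0)"
      using dif_mult[OF xyz(2,3), of ?u] dyu dzu by (simp add: tr_0)
    then have "dif G (x \<otimes> x) ?u = (\<lambda>_. 0)" using sq(3) dyu dzu d1[OF u] by auto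
    then show ?thesis using red[OF 4(1) u] by simp
  qed
qed

end

section \<open>Central quotients that keep the derived subgroup noncyclic\<close>

context p_derived
begin

text \<open>If \<open>N/<z>\<close> is cyclic, then \<open>N = <y> <z>\<close> with \<open>y\<close>
  of order at least \<open>p^2\<close>. The power \<open>w\<close> of \<open>y\<close> of order
  \<open>p\<close> spans a normal subgroup, which contains a central \<open>z'\<close> of order
  \<open>p\<close>. If \<open>N/<z'>\<close> were generated by the image of \<open>u\<close>, then
  \<open>w\<close>, a \<open>p\<close>-th power in \<open>N\<close>, would lie in
  \<open><u>\<close>; so would \<open>z'\<close>, and \<open>N = <u>\<close> would be
  cyclic.\<close>

lemma noncyclic_quotient_exists:
  assumes n: "3 \<le> n" and nc: "\<not> derived_cyclic G"
  obtains H :: "('a, 'b) monoid_scheme" and \<phi> z where "central_quotient G H \<phi> z p" "p_derived H p s (n - 1)"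
    "\<not> derived_cyclic H"
proof -
  let ?N = "lcs G 2"
  have N: "subgroup ?N G" by (rule lcs_subgroup)
  have "card ?N > 1" using card n one_less_power[OF p_gt_1, of n] by simp
  then have N1: "?N \<noteq> {\<one>}" by auto
  obtain z where z: "z \<in> ?N" "ord z = p" "\<And>g. g \<in> carrier G \<Longrightarrow> g \<otimes> z = z \<otimes> g"
    using central_element[OF N lcs_conj _ N1] by blast
  have zG: "z \<in> carrier G" using z lcs_carrier by blast
  obtain H :: "('a, 'b) monoid_scheme" and \<phi> where H: "central_quotient G H \<phi> z p" "p_derived H p s (n - 1)"
    using quotient_exists[OF z] by blast
  interpret Q: central_quotient G H \<phi> z p by fact
  show thesis
  proof (cases "derived_cyclic H")
    case False
    then show ?thesis using that H by blast
  next
    case True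
    obtain y where y: "y \<in> ?N" "\<And>x. x \<in> ?N \<Longrightarrow> \<exists>(i::nat) (j::nat). x = y [^] i \<otimes> z [^] j"
      using Q.derived_cyclic_quotient[OF z(1) fin True] by blast
    have yG: "y \<in> carrier G" using y lcs_carrier by blast
    have oy: "ord y > 0" using ord_pos_of_finite[OF N fin y(1)] .
    have "?N \<subseteq> (\<lambda>(i, j). y [^] i \<otimes> z [^] j) ` ({..<ord y} \<times> {..<p})"
    proof
      fix x assume "x \<in> ?N"
      then obtain i j :: nat where ij: "x = y [^] i \<otimes> z [^] j" using y by blast
      then have "x = y [^] (i mod ord y) \<otimes> z [^] (j mod p)"
        using pow_mod_ord[OF yG] pow_mod_ord[OF zG] z(2) by simp
      then show "x \<in> (\<lambda>(i, j). y [^] i \<otimes> z [^] j) ` ({..<ord y} \<times> {..<p})"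
        using oy p_gt_1 by (intro image_eqI[of _ _ "(i mod ord y, j mod p)"]) auto
    qed
    then have "card ?N \<le> card ({..<ord y} \<times> {..<p})"
      by (intro surj_card_le) auto
    then have le: "p ^ n \<le> ord y * p" using card by simp
    obtain k where k: "ord y = p ^ k"
      using ord_dvd_subgroup_card[OF N y(1)] card divides_primepow_nat[OF p] by metis
    have "p ^ n \<le> p ^ Suc k" using le k by (simp add: mult.commute)
    then have "n \<le> Suc k" using power_le_imp_le_exp[OF p_gt_1] by blast
    \<comment> \<open>Here \<open>n \<ge> 3\<close> enters: for \<open>k \<ge> 2\<close> the element
      \<open>w\<close> of order \<open>p\<close> is the \<open>p\<close>-th power of another element
      \<open>v\<close> of \<open>N\<close>.\<close>
    then have k2: "2 \<le> k" using n by simp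
    then obtain l where l: "k = Suc (Suc l)" by (metis Suc_le_D numeral_2_eq_2 Suc_le_mono)
    let ?v = "y [^] (p ^ l)" let ?w = "y [^] (p ^ Suc l)"
    have vN: "?v \<in> ?N" and wN: "?w \<in> ?N" using nat_pow_in_subgroup[OF N y(1)] by auto
    have wG: "?w \<in> carrier G" using yG by simp
    have w_v: "?w = ?v [^] p" using yG by (simp add: nat_pow_pow mult.commute)
    have ow: "ord ?w = p" using ord_pow[OF yG, of "p ^ Suc l"] k l p_gt_1 by simp
    let ?M = "generate G {?w}"
    have M: "subgroup ?M G" using wG by (intro generate_is_subgroup) auto
    have M_N: "?M \<subseteq> ?N" using wN by (intro generate_subset_subgroup[OF N]) auto
    \<comment> \<open>The \<open>z\<close>-part of the conjugate of \<open>y\<close> disappears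
      under a power divisible by \<open>p\<close>, so conjugation sends \<open>w\<close> to a power
      of \<open>w\<close>.\<close>
    have w_conj: "g \<otimes> ?w \<otimes> inv g \<in> ?M" if g: "g \<in> carrier G" for g
    proof -
      have "g \<otimes> y \<otimes> inv g \<in> ?N" using lcs_conj[OF y(1) g] .
      then obtain i j :: nat where ij: "g \<otimes> y \<otimes> inv g = y [^] i \<otimes> z [^] j" using y by blast
      have "g \<otimes> ?w \<otimes> inv g = (y [^] i \<otimes> z [^] j) [^] (p ^ Suc l)"
        using conj_pow[OF g yG] ij by simp
      also have "\<dots> = (y [^] i) [^] (p ^ Suc l) \<otimes> (z [^] j) [^] (p ^ Suc l)"
        using yG zG Q.z_pow_central by (intro pow_mult_distrib) auto
      also have "(z [^] j) [^] (p ^ Suc l) = \<one>"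
      proof -
        have "(z [^] j) [^] (p ^ Suc l) = (z [^] p) [^] (j * p ^ l)"
          using zG by (simp add: nat_pow_pow mult_ac)
        then show ?thesis using Q.z_pow_n by simp
      qed
      also have "(y [^] i) [^] (p ^ Suc l) \<otimes> \<one> = ?w [^] i"
        using yG by (simp add: nat_pow_pow mult.commute)
      finally show ?thesis using nat_pow_in_subgroup[OF M, of ?w i] generate.incl[of ?w "{?w}" G] by simp
    qed
    have M_eq: "?M = (\<lambda>i. ?w [^] (i::nat)) ` {..<p}" using generate_single_nat[OF wG] ow p_gt_1 by simp
    have M_conj: "g \<otimes> m \<otimes> inv g \<in> ?M" if g: "g \<in> carrier G" and m: "m \<in> ?M" for g m
    proof -
      obtain i :: nat where "m = ?w [^] i" using m M_eq by auto
      then have "g \<otimes> m \<otimes> inv g = (g \<otimes> ?w \<otimes> inv g) [^] i" using conj_pow[OF g wG] by simp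
      then show ?thesis using nat_pow_in_subgroup[OF M w_conj[OF g]] by simp
    qed
    have "?w \<noteq> \<one>" using ow p_gt_1 by auto
    then have M1: "?M \<noteq> {\<one>}" using generate.incl[of ?w "{?w}" G] by auto
    obtain z' where z': "z' \<in> ?M" "ord z' = p" "\<And>g. g \<in> carrier G \<Longrightarrow> g \<otimes> z' = z' \<otimes> g"
      using central_element[OF M M_conj M_N M1] by blast
    have z'N: "z' \<in> ?N" using z' M_N by blast
    have z'G: "z' \<in> carrier G" using z'N lcs_carrier by blast
    obtain H' :: "('a, 'b) monoid_scheme" and \<phi>' where H': "central_quotient G H' \<phi>' z' p" "p_derived H' p s (n - 1)"
      using quotient_exists[OF z'N z'(2,3)] by blast
    interpret Q': central_quotient G H' \<phi>' z' p by fact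
    have "\<not> derived_cyclic H'"
    proof
      assume "derived_cyclic H'"
      then obtain u where u: "u \<in> ?N" "\<And>x. x \<in> ?N \<Longrightarrow> \<exists>(i::nat) (j::nat). x = u [^] i \<otimes> z' [^] j"
        using Q'.derived_cyclic_quotient[OF z'N fin] by blast
      have uG: "u \<in> carrier G" using u lcs_carrier by blast
      let ?U = "generate G {u}"
      have U: "subgroup ?U G" using uG by (intro generate_is_subgroup) auto
      have uU: "u \<in> ?U" by (rule generate.incl) simp
      obtain a b :: nat where ab: "?v = u [^] a \<otimes> z' [^] b" using u(2)[OF vN] by blast
      have "?w = (u [^] a) [^] p \<otimes> (z' [^] b) [^] p"
        unfolding w_v ab using uG z'G Q'.z_pow_central by (intro pow_mult_distrib) auto
      also have "(z' [^] b) [^] p = \<one>"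
      proof -
        have "(z' [^] b) [^] p = (z' [^] p) [^] b" using z'G by (simp add: nat_pow_pow mult.commute)
        then show ?thesis using Q'.z_pow_n by simp
      qed
      finally have "?w \<in> ?U" using nat_pow_in_subgroup[OF U nat_pow_in_subgroup[OF U uU]] uG by simp
      then have "?M \<subseteq> ?U" by (intro generate_subset_subgroup[OF U]) simp
      then have "z' \<in> ?U" using z' by blast
      have "?N \<subseteq> ?U"
      proof
        fix x assume "x \<in> ?N"
        then obtain i j :: nat where "x = u [^] i \<otimes> z' [^] j" using u by blast
        then show "x \<in> ?U"
          using nat_pow_in_subgroup[OF U uU] nat_pow_in_subgroup[OF U \<open>z' \<in> ?U\<close>] subgroup.m_closed[OF U] by simp
      qed
      moreover have "?U \<subseteq> ?N" using u by (intro generate_subset_subgroup[OF N]) auto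
      ultimately show False using nc uG unfolding derived_cyclic_def by blast
    qed
    then show ?thesis using that H' by blast
  qed
qed

end

context group
begin

text \<open>Conjugation by \<open>g\<close> sends \<open>u\<close> to \<open>c u\<close> with
  \<open>c = cm g u\<close>, hence \<open>u^2\<close> to \<open>c^2 u^2\<close>, which must be
  \<open>u^2\<close> again.\<close>

lemma cm_square_eq_one:
  assumes gu: "g \<in> carrier G" "u \<in> carrier G" and c: "cm g u \<otimes> u = u \<otimes> cm g u"
    and u2: "g \<otimes> (u \<otimes> u) = (u \<otimes> u) \<otimes> g"
  shows "cm g u \<otimes> cm g u = \<one>"
proof -
  let ?c = "cm g u"
  have cG: "?c \<in> carrier G" using gu by simp
  have "(u \<otimes> u) = g \<otimes> (u \<otimes> u) \<otimes> inv g" using u2 gu by (simp add: m_assoc)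
  also have "\<dots> = (g \<otimes> u \<otimes> inv g) \<otimes> (g \<otimes> u \<otimes> inv g)" using gu by (simp add: m_assoc)
  also have "\<dots> = (?c \<otimes> u) \<otimes> (?c \<otimes> u)" using gu by (simp only: conj_eq_cm)
  also have "\<dots> = ?c \<otimes> (u \<otimes> ?c) \<otimes> u" using gu cG by (simp add: m_assoc)
  also have "\<dots> = ?c \<otimes> (?c \<otimes> u) \<otimes> u" using c by simp
  also have "\<dots> = (?c \<otimes> ?c) \<otimes> (u \<otimes> u)" using gu cG by (simp add: m_assoc)
  finally have "(?c \<otimes> ?c) \<otimes> (u \<otimes> u) = \<one> \<otimes> (u \<otimes> u)" using gu by simp
  then show ?thesis using gu cG by (metis m_closed one_closed r_cancel)
qed

lemma lcs_eq_one_of_card: "card (lcs G m) = 1 \<Longrightarrow> lcs G m = {\<one>}"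
  using one_in_lcs[of m] by (elim card_1_singletonE) simp

text \<open>For fixed \<open>u\<close>, the map sending \<open>g\<close> to \<open>cm g u\<close> is a homomorphism into the centre,
  so it kills commutators.\<close>

lemma derived_centralizes:
  assumes u: "u \<in> carrier G"
    and cen: "\<And>g h. g \<in> carrier G \<Longrightarrow> h \<in> carrier G \<Longrightarrow> h \<otimes> cm g u = cm g u \<otimes> h"
    and t: "t \<in> lcs G 2"
  shows "t \<otimes> u = u \<otimes> t"
proof -
  have hom: "cm (g \<otimes> h) u = cm g u \<otimes> cm h u" if "g \<in> carrier G" "h \<in> carrier G" for g h
  proof -
    have "cm (g \<otimes> h) u = (g \<otimes> cm h u) \<otimes> inv g \<otimes> cm g u" using that u by (simp add: cm_mult_left)
    also have "\<dots> = (cm h u \<otimes> g) \<otimes> inv g \<otimes> cm g u" using that cen by simp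
    also have "\<dots> = cm h u \<otimes> cm g u" using that u by (simp add: m_assoc)
    finally show ?thesis using cen[of g "cm h u"] that u by simp
  qed
  have "lcs G (Suc 1) \<subseteq> {g \<in> carrier G. \<forall>t\<in>{u}. g \<otimes> t = t \<otimes> g}"
  proof (rule lcs_Suc_least)
    show "subgroup {g \<in> carrier G. \<forall>t\<in>{u}. g \<otimes> t = t \<otimes> g} G" using u by (intro centralizer_subgroup) auto
    fix b c assume "b \<in> lcs G 1" and c: "c \<in> carrier G"
    then have b: "b \<in> carrier G" by simp
    let ?k = "cm b c"
    have k: "?k \<in> carrier G" using b c by simp
    have "cm b u \<otimes> cm c u = cm (?k \<otimes> (c \<otimes> b)) u" using hom[OF b c] b c by (simp add: cm_mult)
    also have "\<dots> = cm ?k u \<otimes> (cm c u \<otimes> cm b u)" using hom[OF k, of "c \<otimes> b"] hom[OF c b] b c by simp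
    also have "cm c u \<otimes> cm b u = cm b u \<otimes> cm c u" using cen[of b "cm c u"] b c u by simp
    finally have "cm ?k u = \<one>" using b c u k by (metis cm_closed m_closed l_cancel_one one_closed r_cancel l_one)
    then show "cm b c \<in> {g \<in> carrier G. \<forall>t\<in>{u}. g \<otimes> t = t \<otimes> g}" using k u by (simp add: cm_eq_one_iff)
  qed simp
  then show ?thesis using t by (auto simp: numeral_2_eq_2)
qed

end

section \<open>Upper bounds for derived subgroups of order 8\<close>

context p_derived
begin

lemma subgroup_eq_of_card:
  "subgroup A G \<Longrightarrow> A \<subseteq> B \<Longrightarrow> finite B \<Longrightarrow> card B \<le> card A \<Longrightarrow> A = B"
  by (metis card_mono card_subset_eq le_antisym)

lemma card_next_lt:
  assumes "2 \<le> m" "lcs G m \<noteq> {\<one>}"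
  shows "card (lcs G (Suc m)) < card (lcs G m)"
  using psubset_card_mono[OF fin_lcs[OF assms(1)], of "lcs G (Suc m)"] lcs_strict[OF assms(2)] lcs_Suc_subset[of m] assms(1)
  by auto

lemma order_8_pow_4:
  assumes "p = 2" "n = 3" "\<not> derived_cyclic G" "x \<in> lcs G 2"
  shows "x \<otimes> x \<otimes> (x \<otimes> x) = \<one>"
proof -
  have xG: "x \<in> carrier G" using assms lcs_carrier by blast
  obtain k where k: "k \<le> 3" "ord x = 2 ^ k"
    using ord_dvd_subgroup_card[OF lcs_subgroup assms(4)] unfolding card assms(1,2)
      divides_primepow_nat[OF two_is_prime_nat] by blast
  have "k \<noteq> 3"
  proof
    assume "k = 3"
    then have "generate G {x} = lcs G 2"
      using generate_pow_card[OF xG] k card assms fin xG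
      by (intro subgroup_eq_of_card generate_is_subgroup generate_subset_subgroup[OF lcs_subgroup]) auto
    then show False using assms(3) xG unfolding derived_cyclic_def by metis
  qed
  then have "ord x dvd 2 ^ 2" using k by (simp only: le_imp_power_dvd)
  then have "x [^] (4::nat) = \<one>" using pow_eq_id[OF xG] by simp
  then show ?thesis using xG by (simp add: numeral_eq_Suc m_assoc)
qed

text \<open>A noncyclic quotient of order 4 has class at most 2 here and needs 3 steps; lifting
  doubles that number.\<close>

lemma order_8_class_2:
  assumes pn: "p = 2" "n = 3" and nc: "\<not> derived_cyclic G" and l3: "lcs G 3 = {\<one>}" and K: "CHAR('k::field) = 2"
  shows "lie_zero TYPE('k) G 6"
proof -
  obtain H :: "('a, 'b) monoid_scheme" and \<phi> z where H: "central_quotient G H \<phi> z p" "p_derived H p s (n - 1)" "\<not> derived_cyclic H"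
    using noncyclic_quotient_exists[OF _ nc] pn by auto
  interpret Q: central_quotient G H \<phi> z p by fact
  interpret H: p_derived H p s 2 using H(2) pn by simp
  have "lcs H 3 = {\<one>\<^bsub>H\<^esub>}" using Q.img_lcs[of 3] l3 by simp
  then have "lie_zero TYPE('k) H (2 * 2 - 1)" using H.lie_zero_square_class_2[OF _ H(3), where ?'k = 'k] K pn by simp
  then have "lie_zero TYPE('k) G ((2 * 2 - 1) * 2)" using Q.lie_zero_lift[OF _ K, of "2 * 2 - 1"] pn by simp
  then show ?thesis by simp
qed

text \<open>Divide by the generator \<open>y\<close> of \<open>gamma_3\<close>. If the quotient is
  noncyclic, 3 steps suffice there and lifting doubles them. Otherwise \<open>N\<close> is generated
  by \<open>x\<close> and \<open>y\<close> with weights 1 and 2, and exponents below 4 and 2 allow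
  the weight \<open>3 + 2\<close> at most.\<close>

lemma order_8_third_2:
  assumes pn: "p = 2" "n = 3" and nc: "\<not> derived_cyclic G" and c3: "card (lcs G 3) = 2" and K: "CHAR('k::field) = 2"
  shows "lie_zero TYPE('k) G 6"
proof -
  let ?N = "lcs G 2" and ?M = "lcs G 3"
  have N: "subgroup ?N G" and M: "subgroup ?M G" by (rule lcs_subgroup)+
  have MN: "?M \<subseteq> ?N" using lcs_antimono[of 2 3] by simp
  have "?M \<noteq> {\<one>}" using c3 by auto
  then obtain y where y: "y \<in> ?M" "ord y = p" "\<And>g. g \<in> carrier G \<Longrightarrow> g \<otimes> y = y \<otimes> g"
    using central_element[OF M lcs_conj MN] by blast
  have yG: "y \<in> carrier G" and yN: "y \<in> ?N" using y lcs_carrier MN by blast+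
  have gM: "generate G {y} = ?M"
    using generate_pow_card[OF yG] y c3 pn fin_lcs[of 3] yG
    by (intro subgroup_eq_of_card generate_is_subgroup generate_subset_subgroup[OF M]) auto
  obtain H :: "('a, 'b) monoid_scheme" and \<phi> where H: "central_quotient G H \<phi> y p" "p_derived H p s (n - 1)"
    using quotient_exists[OF yN y(2,3)] by blast
  interpret Q: central_quotient G H \<phi> y p by fact
  interpret H: p_derived H p s 2 using H(2) pn by simp
  have "lcs H 3 = {\<one>\<^bsub>H\<^esub>}"
  proof -
    have "lcs H 3 = \<phi> ` generate G {y}" using Q.img_lcs[of 3] gM by simp
    also have "\<dots> = {\<one>\<^bsub>H\<^esub>}"
      using generate_single_nat[OF yG] y(2) p_gt_1 by (auto simp: image_image)
    finally show ?thesis .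
  qed
  show ?thesis
  proof (cases "derived_cyclic H")
    case False
    then have "lie_zero TYPE('k) H (2 * 2 - 1)"
      using H.lie_zero_square_class_2[OF _ False \<open>lcs H 3 = {\<one>\<^bsub>H\<^esub>}\<close>, where ?'k = 'k] K pn by simp
    then have "lie_zero TYPE('k) G ((2 * 2 - 1) * 2)" using Q.lie_zero_lift[OF _ K, of "2 * 2 - 1"] pn by simp
    then show ?thesis by simp
  next
    case True
    obtain x where x: "x \<in> ?N" "\<And>t. t \<in> ?N \<Longrightarrow> \<exists>(i::nat) (j::nat). t = x [^] i \<otimes> y [^] j"
      using Q.derived_cyclic_quotient[OF yN fin True] by blast
    have xG: "x \<in> carrier G" using x lcs_carrier by blast
    have sub: "subgroup (generate G {x, y}) G" using xG yG by (intro generate_is_subgroup) auto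
    have "x \<in> generate G {x, y}" "y \<in> generate G {x, y}" by (auto intro: generate.incl)
    then have gens: "?N \<subseteq> generate G {x, y}"
      using x(2) nat_pow_in_subgroup[OF sub] subgroup.m_closed[OF sub] by fastforce
    have y2: "y \<otimes> y = \<one>" using pow_eq_id[OF yG, of 2] y(2) pn yG by (simp add: numeral_2_eq_2)
    have two: "prime (2::nat)" by simp
    have pw: "t [^] (2::nat) = t \<otimes> t" if "t \<in> carrier G" for t using that by (simp add: numeral_2_eq_2)
    have mono: "(dif G x ^^ a) ((dif G y ^^ b) (delta t)) = (\<lambda>_. 0 :: 'k)"
      if t: "t \<in> ?N" and lt: "5 < a * 1 + b * 2" for a b t
    proof (cases "2 \<le> b")
      case True
      then have "(dif G y ^^ b) (delta t) = (\<lambda>_. 0 :: 'k)"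
        using y2 pw[OF yG] delta_in_ga_carrier lcs_carrier[OF t]
        by (intro funpow_dif_eq_0[OF _ yG K two]) auto
      then show ?thesis by simp
    next
      case False
      then have a: "4 \<le> a" using lt by linarith
      let ?f = "(dif G y ^^ b) (delta t) :: 'a \<Rightarrow> 'k"
      have f: "?f \<in> ga_carrier G" using delta_in_ga_carrier lcs_carrier[OF t] yG by (intro funpow_dif_in_ga_carrier) auto
      have "(dif G x ^^ a) ?f = (dif G x ^^ (a - 4 + 2 + 2)) ?f"
      proof -
        have "a - 4 + 2 + 2 = a" using a by simp
        then show ?thesis by (simp only:)
      qed
      also have "\<dots> = (dif G x ^^ (a - 4)) ((dif G x ^^ 2) ((dif G x ^^ 2) ?f))"
        by (simp only: funpow_add comp_apply)
      also have "(dif G x ^^ 2) ((dif G x ^^ 2) ?f) = dif G (x \<otimes> x) (dif G (x \<otimes> x) ?f)"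
        using f xG by (simp only: dif_funpow_prime[OF _ xG K two] pw[OF xG] dif_in_ga_carrier m_closed)
      also have "\<dots> = (dif G (x \<otimes> x) ^^ 2) ?f" by (simp add: numeral_2_eq_2)
      also have "\<dots> = (\<lambda>_. 0)"
        using order_8_pow_4[OF pn nc x(1)] pw[of "x \<otimes> x"] xG
        by (intro funpow_dif_eq_0[OF f _ K two]) auto
      finally show ?thesis by simp
    qed
    have "lie_zero TYPE('k) G (Suc 5)"
    proof (rule lie_zero_of_two_generators[where N = ?N and x = x and y = y and wx = 1 and wy = 2, OF N cm_in_derived x(1) yN gens _ _ _ _ mono])
      show "cm h y = \<one>" if "h \<in> carrier G" for h using that y(3) yG by (simp add: cm_eq_one_iff)
      show "cm h x = \<one> \<or> 1 < (2::nat) \<and> cm h x \<in> generate G {y}" if "h \<in> carrier G" for h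
        using cm_in_lcs(2)[OF x(1) that] gM by (simp add: eval_nat_numeral)
    qed auto
    then show ?thesis by (simp add: eval_nat_numeral)
  qed
qed

text \<open>With \<open>gamma_3\<close> spanned by \<open>y\<close> and \<open>z\<close>, the
  weights are 1, 2, 2 if \<open>gamma_4\<close> is trivial and 1, 2, 3 otherwise; by
  \<open>monomials_vanish\<close> the heaviest monomials have weight 5 and 6. The exponent of
  \<open>gamma_3\<close> and the commutativity of \<open>N\<close> are part of the conclusion
  because the lower bound and the isomorphism types need them.\<close>

lemma order_8_third_4:
  assumes pn: "p = 2" "n = 3" and nc: "\<not> derived_cyclic G" and c3: "card (lcs G 3) = 4" and K: "CHAR('k::field) = 2"
  shows "card (lcs G 4) = 1 \<and> lie_zero TYPE('k) G 6 \<or>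
    card (lcs G 4) = 2 \<and> lie_zero TYPE('k) G 7"
    "\<And>t. t \<in> lcs G 3 \<Longrightarrow> t \<otimes> t = \<one>"
    "\<And>a b. a \<in> lcs G 2 \<Longrightarrow> b \<in> lcs G 2 \<Longrightarrow> a \<otimes> b = b \<otimes> a"
proof -
  let ?N = "lcs G 2" and ?M = "lcs G 3" and ?P = "lcs G 4"
  have N: "subgroup ?N G" and M: "subgroup ?M G" and P: "subgroup ?P G" by (rule lcs_subgroup)+
  have MN: "?M \<subseteq> ?N" and PM: "?P \<subseteq> ?M" using lcs_antimono[of 2 3] lcs_antimono[of 3 4] by simp_all
  have cN: "card ?N = 8" using card pn by simp
  have finM: "finite ?M" and finP: "finite ?P" using fin_lcs by auto
  have "?M \<noteq> {\<one>}" using c3 by auto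
  then have "card ?P < 4" using card_next_lt[of 3] c3 by (simp add: eval_nat_numeral)
  moreover have "card ?P dvd 4" using subgroup_card_dvd[OF P M PM] c3 by simp
  ultimately have "card ?P \<in> {1, 2}"
  proof -
    obtain k where k: "card ?P = 2 ^ k" using card_lcs[of 4] pn by auto
    then have "(2::nat) ^ k < 2 ^ 2" using \<open>card ?P < 4\<close> by simp
    then have "k < 2" by (rule power_less_imp_less_exp[rotated]) simp
    then show ?thesis using k by (cases k) auto
  qed
  have P5: "lcs G 5 = {\<one>}"
  proof (rule ccontr)
    assume ne: "lcs G 5 \<noteq> {\<one>}"
    then have "card (lcs G 5) > 1" using card_gt_one by simp
    moreover have "?P \<noteq> {\<one>}" using ne lcs_trivial_above[of 4 5] by auto
    then have "card (lcs G 5) < card ?P" using card_next_lt[of 4] by (simp add: eval_nat_numeral)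
    ultimately show False using \<open>card ?P \<in> {1, 2}\<close> by auto
  qed
  have Pc: "h \<otimes> t = t \<otimes> h" if "t \<in> ?P" "h \<in> carrier G" for t h
    using central_of_next_trivial[of 4 t h] P5 that lcs_carrier[OF that(1)] by (simp add: eval_nat_numeral cm_eq_one_iff)
  have cmM: "cm h u \<in> ?M" if "u \<in> ?N" "h \<in> carrier G" for h u
    using cm_in_lcs(2)[OF that] by (simp add: eval_nat_numeral)
  have cmP: "cm h u \<in> ?P" if "u \<in> ?M" "h \<in> carrier G" for h u
    using cm_in_lcs(2)[OF that] by (simp add: eval_nat_numeral)
  \<comment> \<open>Commutators with an element of \<open>gamma_3\<close> lie in the central
    \<open>gamma_4\<close>, and a homomorphism to an abelian group is trivial on
    \<open>N\<close>.\<close>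
  have NM: "t \<otimes> u = u \<otimes> t" if "t \<in> ?N" "u \<in> ?M" for t u
    by (rule derived_centralizes[OF lcs_carrier[OF that(2)] _ that(1)]) (rule Pc[OF cmP[OF that(2)]])
  have idx: "card ?N = 2 * card ?M" using cN c3 by simp
  show N_comm: "a \<otimes> b = b \<otimes> a" if ab: "a \<in> ?N" "b \<in> ?N" for a b
  proof (cases "a \<in> ?M \<or> b \<in> ?M")
    case True
    then show ?thesis using NM ab by metis
  next
    case False
    then obtain m where m: "m \<in> ?M" "b = a \<otimes> m" using index_two_cosets[OF M N MN fin idx ab(1) _ ab(2)] by blast
    have "a \<otimes> b = a \<otimes> (m \<otimes> a)" using NM[OF ab(1) m(1)] m(2) by simp
    moreover have "b \<otimes> a = a \<otimes> (m \<otimes> a)"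
      unfolding m(2) by (rule m_assoc[OF lcs_carrier[OF ab(1)] lcs_carrier[OF m(1)] lcs_carrier[OF ab(1)]])
    ultimately show ?thesis by simp
  qed
  have sqM: "u \<otimes> u \<in> ?M" if "u \<in> ?N" for u
    using index_two_square[OF M N MN fin idx that] .
  \<comment> \<open>These commutators generate \<open>gamma_3\<close>. If \<open>u^2\<close> is
    central the claim is immediate, and this covers a trivial \<open>gamma_4\<close>. Otherwise
    \<open>u^2\<close> and \<open>cm g u\<close> lie in the same nontrivial coset of
    \<open>gamma_4\<close> in \<open>gamma_3\<close>, so \<open>u^4 = 1\<close> forces the square of
    \<open>cm g u\<close> to be trivial.\<close>
  have cm_sq: "cm g u \<otimes> cm g u = \<one>" if ug: "u \<in> ?N" "g \<in> carrier G" "cm g u \<notin> ?P" for g u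
  proof (cases "u \<otimes> u \<in> ?P")
    case True
    have "cm g u \<in> ?N" using cmM[OF ug(1,2)] MN by blast
    then show ?thesis
      by (rule cm_square_eq_one[OF ug(2) lcs_carrier[OF ug(1)] N_comm[OF _ ug(1)] Pc[OF True ug(2)]])
  next
    case False
    have uG: "u \<in> carrier G" using ug lcs_carrier by blast
    show ?thesis
    proof (cases "card ?P = 2")
      case True
      then have idx': "card ?M = 2 * card ?P" using c3 by simp
      obtain w where w: "w \<in> ?P" "u \<otimes> u = cm g u \<otimes> w"
        using index_two_cosets[OF P M PM finM idx' cmM[OF ug(1,2)] ug(3) sqM[OF ug(1)] False] by blast
      have wG: "w \<in> carrier G" using w lcs_carrier by blast
      have w2: "w \<otimes> w = \<one>" using pow_card_eq_one[OF P w(1)] True wG by (simp add: numeral_2_eq_2)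
      have cG: "cm g u \<in> carrier G" using ug uG by simp
      have "\<one> = (u \<otimes> u) \<otimes> (u \<otimes> u)" using order_8_pow_4[OF pn nc ug(1)] by simp
      also have "\<dots> = cm g u \<otimes> (w \<otimes> cm g u) \<otimes> w" using w wG cG by (simp add: m_assoc)
      also have "w \<otimes> cm g u = cm g u \<otimes> w" using Pc[OF w(1) cG] by simp
      also have "cm g u \<otimes> (cm g u \<otimes> w) \<otimes> w = cm g u \<otimes> cm g u" using w2 wG cG by (simp add: m_assoc)
      finally show ?thesis by simp
    next
      case False
      then have "card ?P = 1" using \<open>card ?P \<in> {1, 2}\<close> by simp
      then have "?P = {\<one>}" by (rule lcs_eq_one_of_card)
      then have "cm g (u \<otimes> u) = \<one>" using cmP[OF sqM[OF ug(1)] ug(2)] by simp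
      then have "g \<otimes> (u \<otimes> u) = (u \<otimes> u) \<otimes> g"
        using cm_eq_one_iff[OF ug(2), of "u \<otimes> u"] uG by simp
      then show ?thesis
        using cm_square_eq_one[OF ug(2) uG] N_comm[OF _ ug(1)] cmM[OF ug(1,2)] MN by blast
    qed
  qed
  have P_sq: "t \<otimes> t = \<one>" if "t \<in> ?P" for t
  proof -
    have "t [^] card ?P = \<one>" using pow_card_eq_one[OF P that] .
    then show ?thesis using \<open>card ?P \<in> {1, 2}\<close> lcs_carrier[OF that] by (auto simp: numeral_2_eq_2)
  qed
  have "subgroup {t \<in> ?M. t \<otimes> t = \<one>} G"
  proof (rule subgroupI)
    fix a b assume ab: "a \<in> {t \<in> ?M. t \<otimes> t = \<one>}" "b \<in> {t \<in> ?M. t \<otimes> t = \<one>}"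
    then have abG: "a \<in> carrier G" "b \<in> carrier G" using lcs_carrier by blast+
    have "a \<otimes> b \<otimes> (a \<otimes> b) = a \<otimes> (b \<otimes> a) \<otimes> b" using abG by (simp add: m_assoc)
    also have "b \<otimes> a = a \<otimes> b" using ab MN N_comm by blast
    also have "a \<otimes> (a \<otimes> b) \<otimes> b = (a \<otimes> a) \<otimes> (b \<otimes> b)" using abG by (simp add: m_assoc)
    finally show "a \<otimes> b \<in> {t \<in> ?M. t \<otimes> t = \<one>}" using ab subgroup.m_closed[OF M] by simp
  next
    fix a assume a: "a \<in> {t \<in> ?M. t \<otimes> t = \<one>}"
    then have "inv a = a" using lcs_carrier[of a 3] by (intro inv_equality) auto
    then show "inv a \<in> {t \<in> ?M. t \<otimes> t = \<one>}" using a by simp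
  next
    show "{t \<in> ?M. t \<otimes> t = \<one>} \<subseteq> carrier G" using lcs_carrier by blast
    have "\<one> \<in> {t \<in> ?M. t \<otimes> t = \<one>}" using one_in_lcs[of 3] by simp
    then show "{t \<in> ?M. t \<otimes> t = \<one>} \<noteq> {}" by blast
  qed
  then have "lcs G (Suc 2) \<subseteq> {t \<in> ?M. t \<otimes> t = \<one>}"
  proof (rule lcs_Suc_least)
    fix u g assume ug: "u \<in> ?N" "g \<in> carrier G"
    have c: "cm g u \<in> ?M" "cm u g \<in> ?M" using cm_in_lcs[OF ug] by (auto simp: eval_nat_numeral)
    have "cm g u \<otimes> cm g u = \<one>" using cm_sq[OF ug] P_sq by blast
    then have "inv (cm g u) \<otimes> inv (cm g u) = \<one>"
      using lcs_carrier[OF c(1)] by (metis inv_mult_group inv_one)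
    then show "cm u g \<in> {t \<in> ?M. t \<otimes> t = \<one>}" using c inv_cm[OF ug(2) lcs_carrier[OF ug(1)]] by simp
  qed simp
  then show M_sq: "t \<otimes> t = \<one>" if "t \<in> ?M" for t using that by (auto simp: eval_nat_numeral)
  have M_ord: "ord t = 2" if "t \<in> ?M" "t \<noteq> \<one>" for t
  proof -
    have tG: "t \<in> carrier G" using that lcs_carrier by blast
    have "ord t dvd 2" using pow_eq_id[OF tG, of 2] M_sq[OF that(1)] tG by (simp add: numeral_2_eq_2)
    moreover have "ord t \<noteq> 1" using ord_eq_1[OF tG] that by simp
    ultimately show ?thesis by (metis prime_nat_iff two_is_prime_nat)
  qed
  have gen2: "generate G {t} = {\<one>, t}" if "t \<in> ?M" "t \<noteq> \<one>" for t
  proof -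
    have tG: "t \<in> carrier G" using that lcs_carrier by blast
    have "{..<2::nat} = {0, 1}" by auto
    then show ?thesis using generate_single_nat[OF tG] M_ord[OF that] tG by auto
  qed
  \<comment> \<open>If \<open>gamma_4\<close> is nontrivial, \<open>z\<close> is chosen inside it,
    because the generator of largest weight must absorb the commutators of \<open>y\<close>.\<close>
  have "\<exists>z\<in>?M. z \<noteq> \<one> \<and> (card ?P = 2 \<longrightarrow> z \<in> ?P)"
  proof (cases "card ?P = 2")
    case True
    then have "?P \<noteq> {\<one>}" by auto
    then obtain z where "z \<in> ?P" "z \<noteq> \<one>" using one_in_lcs[of 4] by blast
    then show ?thesis using PM by blast
  next
    case False
    obtain z where "z \<in> ?M" "z \<noteq> \<one>" using \<open>?M \<noteq> {\<one>}\<close> one_in_lcs[of 3] by blast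
    then show ?thesis using False by blast
  qed
  then obtain z where z: "z \<in> ?M" "z \<noteq> \<one>" "card ?P = 2 \<Longrightarrow> z \<in> ?P" by blast
  have zG: "z \<in> carrier G" using z lcs_carrier by blast
  have Z: "subgroup {\<one>, z} G" using generate_is_subgroup[of "{z}"] gen2[OF z(1,2)] zG by simp
  have Z_M: "{\<one>, z} \<subseteq> ?M" using z one_in_lcs[of 3] by auto
  have cZ: "card {\<one>, z} = 2" using z by simp
  have "{\<one>, z} \<noteq> ?M" using cZ c3 by auto
  then obtain y where y: "y \<in> ?M" "y \<notin> {\<one>, z}" using Z_M by blast
  have yG: "y \<in> carrier G" using y lcs_carrier by blast
  have M_elems: "t \<in> {\<one>, y, z, y \<otimes> z}" if t: "t \<in> ?M" for t
  proof (cases "t \<in> {\<one>, z}")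
    case False
    have "card ?M = 2 * card {\<one>, z}" using c3 cZ by simp
    then obtain m where "m \<in> {\<one>, z}" "t = y \<otimes> m"
      using index_two_cosets[OF Z M Z_M finM _ y t False] by blast
    then show ?thesis using yG by auto
  qed auto
  have gyz: "?M \<subseteq> generate G {y, z}"
    using M_elems generate.one[of G "{y, z}"] generate.incl[of y "{y, z}" G] generate.incl[of z "{y, z}" G] generate.eng[of y G "{y, z}" z] by blast
  have "?M \<noteq> ?N" using cN c3 by auto
  then obtain x where x: "x \<in> ?N" "x \<notin> ?M" using MN by blast
  have xG: "x \<in> carrier G" using x lcs_carrier by blast
  have yN: "y \<in> ?N" and zN: "z \<in> ?N" using y z MN by auto
  have gens: "?N \<subseteq> generate G {x, y, z}"
  proof -
    have "generate G {x, y, z} = ?N"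
    proof (rule prime_index_eq[OF M _ N _ _ fin])
      show "subgroup (generate G {x, y, z}) G" using xG yG zG by (intro generate_is_subgroup) auto
      show "?M \<subseteq> generate G {x, y, z}" using gyz mono_generate[of "{y, z}" "{x, y, z}"] by blast
      show "generate G {x, y, z} \<subseteq> ?N" using x yN zN by (intro generate_subset_subgroup[OF N]) auto
      show "card ?N = 2 * card ?M" by (rule idx)
      show "x \<in> generate G {x, y, z}" by (rule generate.incl) simp
    qed (use x in auto)
    then show ?thesis by simp
  qed
  have yz: "y \<otimes> z = z \<otimes> y" using N_comm yN zN by blast
  have cm_one: "cm h t = \<one>" if "?P = {\<one>}" "t \<in> ?M" "h \<in> carrier G" for t h
    using cmP[OF that(2,3)] that(1) by blast
  have vanish: "(dif G x ^^ a) ((dif G y ^^ b) ((dif G z ^^ c) (delta t))) = (\<lambda>_. 0 :: 'k)"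
    if "t \<in> ?N" "2 \<le> b \<or> 2 \<le> c \<or> 4 \<le> a \<or> 2 \<le> a \<and> b = 1 \<and> c = 1" for a b c t
    by (rule monomials_vanish[OF K _ xG yG zG yz])
      (use that M_sq y z M_elems[OF sqM[OF x(1)]] lcs_carrier[OF that(1)] in \<open>auto intro: delta_in_ga_carrier\<close>)
  show "card ?P = 1 \<and> lie_zero TYPE('k) G 6 \<or> card ?P = 2 \<and> lie_zero TYPE('k) G 7"
  proof (cases "card ?P = 2")
    case False
    then have P1: "card ?P = 1" using \<open>card ?P \<in> {1, 2}\<close> by simp
    from this have triv: "?P = {\<one>}" by (rule lcs_eq_one_of_card)
    have "lie_zero TYPE('k) G (Suc 5)"
    proof (rule lie_zero_of_three_generators[where wx = 1 and wy = 2 and wz = 2, OF N N_comm cm_in_derived x(1) yN zN gens])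
      show "cm h z = \<one>" if "h \<in> carrier G" for h using cm_one[OF triv z(1) that] .
      show "cm h y = \<one> \<or> 2 < (2::nat) \<and> cm h y \<in> generate G {z}" if "h \<in> carrier G" for h using cm_one[OF triv y(1) that] by simp
      show "cm h x = \<one> \<or> 1 < (2::nat) \<and> 1 < (2::nat) \<and> cm h x \<in> generate G {y, z}" if "h \<in> carrier G" for h
        using cmM[OF x(1) that] gyz by auto
      show "(dif G x ^^ a) ((dif G y ^^ b) ((dif G z ^^ c) (delta t))) = (\<lambda>_. 0 :: 'k)"
        if "t \<in> ?N" "5 < a * 1 + b * 2 + c * 2" for a b c t
        using that by (intro vanish) linarith+
    qed auto
    then show ?thesis using P1 by (simp add: eval_nat_numeral)
  next
    case True
    have gz: "?P \<subseteq> generate G {z}"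
    proof -
      have "{\<one>, z} = ?P"
        using z(3)[OF True] True cZ finP one_in_lcs[of 4] by (intro card_subset_eq) auto
      then show ?thesis using gen2[OF z(1,2)] by simp
    qed
    have "lie_zero TYPE('k) G (Suc 6)"
    proof (rule lie_zero_of_three_generators[where wx = 1 and wy = 2 and wz = 3, OF N N_comm cm_in_derived x(1) yN zN gens])
      show "cm h z = \<one>" if "h \<in> carrier G" for h using Pc[OF z(3)[OF True] that] that zG by (simp add: cm_eq_one_iff)
      show "cm h y = \<one> \<or> 2 < (3::nat) \<and> cm h y \<in> generate G {z}" if "h \<in> carrier G" for h using cmP[OF y(1) that] gz by auto
      show "cm h x = \<one> \<or> 1 < (2::nat) \<and> 1 < (3::nat) \<and> cm h x \<in> generate G {y, z}" if "h \<in> carrier G" for h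
        using cmM[OF x(1) that] gyz by auto
      show "(dif G x ^^ a) ((dif G y ^^ b) ((dif G z ^^ c) (delta t))) = (\<lambda>_. 0 :: 'k)"
        if "t \<in> ?N" "6 < a * 1 + b * 2 + c * 3" for a b c t
        using that by (intro vanish) linarith+
    qed auto
    then show ?thesis using True by (simp add: eval_nat_numeral)
  qed
qed

end

section \<open>The general upper bound\<close>
lemma (in p_derived) order_8_cases:
  assumes pn: "p = 2" "n = 3" and nc: "\<not> derived_cyclic G" and K: "CHAR('k::field) = 2"
  shows "lie_zero TYPE('k) G 6 \<or> card (lcs G 3) = 4 \<and> card (lcs G 4) = 2 \<and> lie_zero TYPE('k) G 7"
proof -
  obtain k where k: "card (lcs G 3) = 2 ^ k" using card_lcs[of 3] pn by auto
  have "lcs G 2 \<noteq> {\<one>}" using card pn by auto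
  then have "card (lcs G 3) < card (lcs G 2)" using card_next_lt[of 2] by (simp add: eval_nat_numeral)
  then have "(2::nat) ^ k < 2 ^ 3" using k card pn by simp
  then have "k < 3" by (rule power_less_imp_less_exp[rotated]) simp
  then consider "k = 0" | "k = 1" | "k = 2" by linarith
  then show ?thesis
  proof cases
    case 1
    then have "lcs G 3 = {\<one>}" using k by (intro lcs_eq_one_of_card) simp
    then show ?thesis using order_8_class_2[OF pn nc _ K] by blast
  next
    case 2
    then show ?thesis using order_8_third_2[OF pn nc _ K] k by simp
  next
    case 3
    then show ?thesis using order_8_third_4(1)[OF pn nc _ K] k by auto
  qed
qed

text \<open>The two bounds are proved together: for \<open>p = 2\<close> and \<open>n = 3\<close>
  only the weaker one is available, and it still suffices for the step to \<open>n = 4\<close>,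
  since lifting turns \<open>p^m - p + 1\<close> steps into at most \<open>p^(m+1) - p\<close>. For
  odd \<open>p\<close> the induction starts at order \<open>p^2\<close>, using
  \<open>(3 p - 2) p \<le> p^3 - p\<close>.\<close>

lemma lie_zero_noncyclic_large:
  fixes G :: "('a, 'b) monoid_scheme"
  assumes "p_derived G p s n" "3 \<le> n" "\<not> derived_cyclic G" and K: "CHAR('k::field) = p"
  shows "lie_zero TYPE('k) G (p ^ n - p + 1) \<and> (\<not> (p = 2 \<and> n = 3) \<longrightarrow> lie_zero TYPE('k) G (p ^ n - p))"
  using assms(1-3)
proof (induction n arbitrary: G)
  case 0
  then show ?case by simp
next
  case (Suc m)
  interpret p_derived G p s "Suc m" by fact
  obtain H :: "('a, 'b) monoid_scheme" and \<phi> z where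
    H: "central_quotient G H \<phi> z p" "p_derived H p s (Suc m - 1)" "\<not> derived_cyclic H"
    using noncyclic_quotient_exists[OF Suc.prems(2,3)] by blast
  interpret Q: central_quotient G H \<phi> z p by fact
  interpret H: p_derived H p s m using H(2) by simp
  have main: "lie_zero TYPE('k) G (p ^ Suc m - p)" if "\<not> (p = 2 \<and> Suc m = 3)"
  proof (cases "m = 2")
    case True
    then have "p \<noteq> 2" using that by simp
    then have p3: "3 \<le> p" using p_gt_1 by linarith
    have "lie_zero TYPE('k) H (3 * p - 2)"
    proof (cases "lcs H 3 = {\<one>\<^bsub>H\<^esub>}")
      case True
      have "lie_zero TYPE('k) H (2 * p - 1)"
        using H.lie_zero_square_class_2[OF \<open>m = 2\<close> H(3) True K] .
      then show ?thesis using p_gt_1 by (elim lie_zero_mono) simp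
    next
      case False
      then show ?thesis using H.lie_zero_square_class_3[OF True H(3) False K] by blast
    qed
    then have "lie_zero TYPE('k) G ((3 * p - 2) * p)" using Q.lie_zero_lift[OF _ K p] by blast
    moreover have "(3 * p - 2) * p \<le> p ^ Suc m - p"
    proof -
      obtain q where q: "p = q + 3" using p3 by (metis add.commute le_Suc_ex)
      have "(3 * p - 2) * p + p = (3 * p - 1) * p" using p3 by (simp add: algebra_simps diff_mult_distrib)
      also have "\<dots> \<le> (p * p) * p" unfolding q by (intro mult_right_mono) (auto simp: algebra_simps)
      also have "\<dots> = p ^ Suc m" using True by (simp add: eval_nat_numeral)
      finally show ?thesis by simp
    qed
    ultimately show ?thesis by (rule lie_zero_mono)
  next
    case False
    then have m3: "3 \<le> m" using Suc.prems(2) by simp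
    have "lie_zero TYPE('k) H (p ^ m - p + 1)" using Suc.IH[OF H.p_derived_axioms m3 H(3)] by blast
    then have "lie_zero TYPE('k) G ((p ^ m - p + 1) * p)" using Q.lie_zero_lift[OF _ K p] by blast
    moreover have "(p ^ m - p + 1) * p \<le> p ^ Suc m - p"
    proof -
      have "p * 2 \<le> p * p" using p_gt_1 by (intro mult_left_mono) auto
      moreover obtain r where "p ^ m = p + r"
        using self_le_power[of p m] p_gt_1 m3 by (metis le_Suc_ex less_imp_le gr0I not_numeral_le_zero)
      ultimately have "(p ^ m - p + 1) * p + p \<le> p ^ m * p"
        by (simp only: diff_add_inverse distrib_right mult_1 mult_2_right)
      then show ?thesis by (simp add: mult.commute)
    qed
    ultimately show ?thesis by (rule lie_zero_mono)
  qed
  show ?case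
  proof (cases "p = 2 \<and> Suc m = 3")
    case True
    then have "lie_zero TYPE('k) G 6 \<or> lie_zero TYPE('k) G 7"
      using order_8_cases[OF _ _ Suc.prems(3), where ?'k = 'k] K by auto
    then have "lie_zero TYPE('k) G 7" using lie_zero_mono[of G 6 7, where ?'k = 'k] by auto
    then show ?thesis using True by simp
  next
    case False
    then show ?thesis using main lie_zero_mono[OF main[OF False], of "p ^ Suc m - p + 1"] by simp
  qed
qed

section \<open>Ingredients of the lower bounds, and nonvanishing for order
  \<open>p^2\<close>\<close>

context group
begin

text \<open>Conjugation by \<open>a\<close> multiplies \<open>b\<close> and \<open>c\<close> by
  factors from \<open>gamma_3\<close>, and such factors change \<open>cm b c\<close> only by
  elements of \<open>gamma_4\<close>. The use is contrapositive: if \<open>a\<close> acts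
  nontrivially on \<open>N\<close> modulo \<open>gamma_4\<close>, there is \<open>b\<close> with
  \<open>cm a b\<close> outside \<open>gamma_3\<close>.\<close>

lemma centralizes_mod_lcs:
  assumes a: "a \<in> carrier G" and triv: "\<And>b. b \<in> carrier G \<Longrightarrow> cm a b \<in> lcs G 3" and t: "t \<in> lcs G 2"
  shows "cm a t \<in> lcs G 4"
proof -
  let ?P = "lcs G 4"
  have P: "subgroup ?P G" by (rule lcs_subgroup)
  have cm4: "cm h u \<in> ?P" "cm u h \<in> ?P" if "u \<in> lcs G 3" "h \<in> carrier G" for h u
    using cm_in_lcs[OF that] by (simp_all add: eval_nat_numeral)
  have left: "\<exists>p\<in>?P. cm (u \<otimes> b) w = p \<otimes> cm b w" if u: "u \<in> lcs G 3" and bw: "b \<in> carrier G" "w \<in> carrier G" for u b w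
  proof -
    have uG: "u \<in> carrier G" using u lcs_carrier by blast
    have "cm (u \<otimes> b) w = u \<otimes> cm b w \<otimes> inv u \<otimes> cm u w" using uG bw by (simp add: cm_mult_left)
    also have "\<dots> = cm u (cm b w) \<otimes> (cm b w \<otimes> cm u w \<otimes> inv (cm b w)) \<otimes> cm b w"
      using uG bw conj_eq_cm[of u "cm b w"] by (simp add: m_assoc)
    finally show ?thesis
      using cm4(2)[OF u] bw lcs_conj[OF cm4(2)[OF u bw(2)]] subgroup.m_closed[OF P] by (intro bexI) auto
  qed
  have "subgroup {k \<in> carrier G. cm a k \<in> ?P} G"
  proof (rule subgroupI)
    have "\<one> \<in> {k \<in> carrier G. cm a k \<in> ?P}" using a by (simp add: cm_def)
    then show "{k \<in> carrier G. cm a k \<in> ?P} \<noteq> {}" by blast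
    fix k assume k: "k \<in> {k \<in> carrier G. cm a k \<in> ?P}"
    have "cm a (inv k) = inv k \<otimes> inv (cm a k) \<otimes> inv (inv k)" using a k by (simp add: cm_def word_simps)
    moreover have "inv k \<otimes> inv (cm a k) \<otimes> inv (inv k) \<in> ?P"
      using k by (intro lcs_conj subgroup.m_inv_closed[OF P]) auto
    ultimately have "cm a (inv k) \<in> ?P" by simp
    then show "inv k \<in> {k \<in> carrier G. cm a k \<in> ?P}" using k by simp
    fix l assume l: "l \<in> {k \<in> carrier G. cm a k \<in> ?P}"
    have "cm a (k \<otimes> l) = cm a k \<otimes> (k \<otimes> cm a l \<otimes> inv k)" using a k l by (simp add: cm_def word_simps)
    then show "k \<otimes> l \<in> {k \<in> carrier G. cm a k \<in> ?P}" using k l lcs_conj subgroup.m_closed[OF P] by simp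
  qed auto
  then have "lcs G (Suc 1) \<subseteq> {k \<in> carrier G. cm a k \<in> ?P}"
  proof (rule lcs_Suc_least)
    fix b c assume "b \<in> lcs G 1" and c: "c \<in> carrier G"
    then have b: "b \<in> carrier G" by simp
    have bc: "a \<otimes> b \<otimes> inv a = cm a b \<otimes> b" "a \<otimes> c \<otimes> inv a = cm a c \<otimes> c" using a b c conj_eq_cm by auto
    let ?b = "cm a b \<otimes> b" and ?c = "cm a c \<otimes> c"
    have bcG: "?b \<in> carrier G" "?c \<in> carrier G" using a b c by auto
    obtain p1 where p1: "p1 \<in> ?P" "cm ?b ?c = p1 \<otimes> cm b ?c" using left[OF triv[OF b] b bcG(2)] by blast
    obtain p2 where p2: "p2 \<in> ?P" "cm ?c b = p2 \<otimes> cm c b" using left[OF triv[OF c] c b] by blast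
    have p12G: "p1 \<in> carrier G" "p2 \<in> carrier G" using p1 p2 lcs_carrier by blast+
    have "cm b ?c = inv (p2 \<otimes> cm c b)" using inv_cm[OF bcG(2) b] p2 by simp
    also have "\<dots> = cm b c \<otimes> inv p2" using p12G b c by (simp add: inv_mult_group inv_cm)
    finally have 3: "cm b ?c = cm b c \<otimes> inv p2" .
    have "a \<otimes> cm b c \<otimes> inv a = cm (a \<otimes> b \<otimes> inv a) (a \<otimes> c \<otimes> inv a)"
      using a b c by (simp add: cm_def word_simps)
    also have "\<dots> = p1 \<otimes> (cm b c \<otimes> inv p2)" using bc p1 3 by simp
    finally have "cm a (cm b c) \<otimes> cm b c = p1 \<otimes> (cm b c \<otimes> inv p2)" using a b c conj_eq_cm by simp
    then have "cm a (cm b c) = p1 \<otimes> (cm b c \<otimes> inv p2) \<otimes> inv (cm b c)"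
      using a b c p12G by (metis cm_closed inv_solve_right m_closed inv_closed)
    also have "\<dots> = p1 \<otimes> (cm b c \<otimes> inv p2 \<otimes> inv (cm b c))" using b c p12G by (simp add: m_assoc)
    finally have "cm a (cm b c) \<in> ?P"
      using subgroup.m_closed[OF P p1(1) lcs_conj[OF subgroup.m_inv_closed[OF P p2(1)]]] b c by simp
    then show "cm b c \<in> {k \<in> carrier G. cm a k \<in> ?P}" using b c by simp
  qed simp
  then show ?thesis using t by (auto simp: numeral_2_eq_2)
qed

text \<open>Bookkeeping for explicit commutators: the group element and its coefficient function are
  advanced separately, and \<open>c\<close> and \<open>v\<close> can be given in normal
  form.\<close>

lemma ad_step:
  assumes "g \<in> carrier G" "h \<in> carrier G" "cm g h = c" "tstep G c h u = v"
  shows "ad G h (tr G g u) = tr G (h \<otimes> g) v"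
  unfolding ad_tr[OF assms(1,2)] assms(3,4) ..

lemma tr_at: "g \<in> carrier G \<Longrightarrow> x \<in> carrier G \<Longrightarrow> tr G g u (x \<otimes> g) = u x"
  by (simp add: tr_def m_assoc)

lemma tr_zeroD:
  assumes "tr G g u = (\<lambda>_. 0)" "g \<in> carrier G" "x \<in> carrier G"
  shows "u x = 0"
  using tr_at[OF assms(2,3), of u] assms(1) by simp

lemma tstep_delta:
  assumes "c \<in> carrier G" "h \<in> carrier G" "t \<in> carrier G"
  shows "tstep G c h (delta t) = (\<lambda>x. delta (t \<otimes> c) x - delta (h \<otimes> t \<otimes> inv h) x)"
  using assms by (simp add: tstep_def tr_delta cj_delta)

lemma cm_self [simp]: "a \<in> carrier G \<Longrightarrow> cm a a = \<one>"
  by (simp add: cm_def m_assoc)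

lemma delta_one_tr: "g \<in> carrier G \<Longrightarrow> tr G g (delta \<one>) = delta g"
  by (simp add: tr_delta)

end

context p_derived
begin

text \<open>Here \<open>N\<close> is central of exponent 2, so \<open>cm\<close> is symmetric and
  multiplicative in each argument. If every \<open>[g, h, k]\<close> vanished, then
  \<open>(c - 1) (d - 1) = 0\<close> for \<open>c = cm g h\<close> and
  \<open>d = cm (h g) k\<close>. This would confine all commutators of a given element to one group
  of order 2, which fails for a product of elements from two pairs with different
  commutators.\<close>

lemma not_lie_zero_square_class_2:
  assumes pn: "p = 2" "n = 2" and nc: "\<not> derived_cyclic G" and l3: "lcs G 3 = {\<one>}"
  shows "\<not> lie_zero TYPE('k::field) G 2"
proof
  assume L: "lie_zero TYPE('k) G 2"
  let ?N = "lcs G 2"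
  have N: "subgroup ?N G" by (rule lcs_subgroup)
  have cN: "card ?N = 4" using card pn by simp
  have cen: "h \<otimes> u = u \<otimes> h" if "u \<in> ?N" "h \<in> carrier G" for u h
    using central_of_next_trivial[of 2 u h] l3 that lcs_carrier[OF that(1)] by (simp add: eval_nat_numeral cm_eq_one_iff)
  have sq: "t \<otimes> t = \<one>" if "t \<in> ?N" for t
    using exponent_of_noncyclic_square[OF pn(2) nc that] pn lcs_carrier[OF that] by (simp add: numeral_2_eq_2)
  have inv_N: "inv t = t" if "t \<in> ?N" for t
    using sq[OF that] lcs_carrier[OF that] by (intro inv_equality) auto
  have cmN: "cm g h \<in> ?N" if "g \<in> carrier G" "h \<in> carrier G" for g h using cm_in_derived that by blast
  have sym: "cm h g = cm g h" if "g \<in> carrier G" "h \<in> carrier G" for g h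
    using inv_cm[OF that] inv_N[OF cmN[OF that]] by simp
  have left: "cm (a \<otimes> b) c = cm b c \<otimes> cm a c" if "a \<in> carrier G" "b \<in> carrier G" "c \<in> carrier G" for a b c
    using that cm_mult_left[of a b c] cen[OF cmN[OF that(2,3)] that(1)] by (simp add: m_assoc)
  \<comment> \<open>The coefficient of \<open>(c - 1) (d - 1)\<close> at the identity is 1 unless
    \<open>c = 1\<close>, \<open>d = 1\<close> or \<open>c d = 1\<close>, and the last means
    \<open>d = c\<close>.\<close>
  have key: "cm (h \<otimes> g) k \<in> {\<one>, cm g h}"
    if ghk: "g \<in> carrier G" "h \<in> carrier G" "k \<in> carrier G" and ne: "cm g h \<noteq> \<one>" for g h k
  proof (rule ccontr)
    assume no: "cm (h \<otimes> g) k \<notin> {\<one>, cm g h}"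
    let ?c = "cm g h" and ?d = "cm (h \<otimes> g) k"
    have cd: "?c \<in> carrier G" "?d \<in> carrier G" "?c \<in> ?N" "?d \<in> ?N" using ghk cmN by auto
    have "fold (ad G) [h, k] (delta g) = (\<lambda>_. 0 :: 'k)" using lie_zeroD[OF L ghk(1), of "[h, k]"] ghk by simp
    then have z: "ad G k (ad G h (tr G g (delta \<one>))) = (\<lambda>_. 0 :: 'k)" using ghk by (simp add: delta_one_tr)
    have "tstep G ?c h (delta \<one>) = (\<lambda>x. delta ?c x - delta \<one> x :: 'k)" using ghk cd by (simp add: tstep_delta)
    note s1 = ad_step[OF ghk(1,2) refl this]
    have "tstep G ?d k (\<lambda>x. delta ?c x - delta \<one> x) = (\<lambda>x. (delta (?c \<otimes> ?d) x - delta ?d x) - (delta ?c x - delta \<one> x) :: 'k)"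
    proof -
      have "k \<otimes> ?c \<otimes> inv k = ?c" using cen[OF cd(3) ghk(3)] ghk cd by (simp add: m_assoc)
      then show ?thesis using ghk cd(1,2) by (simp add: tstep_def tr_diff cj_diff tr_delta cj_delta)
    qed
    note s2 = ad_step[OF _ ghk(3) refl this]
    have "?c \<otimes> ?d \<noteq> \<one>"
    proof
      assume "?c \<otimes> ?d = \<one>"
      then have "inv ?d = ?c" using cd by (intro inv_equality) auto
      then show False using inv_N[OF cd(4)] no by simp
    qed
    then have neq: "\<one> \<noteq> ?c \<otimes> ?d" "\<one> \<noteq> ?c" "\<one> \<noteq> ?d" using no ne by auto
    have "tr G (k \<otimes> (h \<otimes> g)) (\<lambda>x. (delta (?c \<otimes> ?d) x - delta ?d x) - (delta ?c x - delta \<one> x) :: 'k) = (\<lambda>_. 0)"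
      using z unfolding s1 s2[OF m_closed[OF ghk(2,1)]] .
    from tr_zeroD[OF this _ one_closed] show False using ghk neq by (simp add: delta_def)
  qed
  \<comment> \<open>Replacing \<open>h\<close> by \<open>h g^-1\<close> leaves \<open>cm g h\<close>
    unchanged and turns the product \<open>h g\<close> of \<open>key\<close> into
    \<open>h\<close>.\<close>
  have key2: "cm h k \<in> {\<one>, cm g h}"
    if ghk: "g \<in> carrier G" "h \<in> carrier G" "k \<in> carrier G" and ne: "cm g h \<noteq> \<one>" for g h k
  proof -
    have gi: "inv g \<in> carrier G" using ghk by simp
    have "cm (inv g) g = \<one>" using ghk by (simp add: cm_def)
    then have "cm (h \<otimes> inv g) g = cm h g" using left[OF ghk(2) gi ghk(1)] ghk by simp
    then have "cm g (h \<otimes> inv g) = cm g h" using sym ghk by simp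
    then have "cm ((h \<otimes> inv g) \<otimes> g) k \<in> {\<one>, cm g h}" using key[OF ghk(1) _ ghk(3), of "h \<otimes> inv g"] ne ghk by simp
    then show ?thesis using ghk by (simp add: m_assoc)
  qed
  have "?N \<noteq> {\<one>}" using cN by auto
  have "\<exists>a\<in>carrier G. \<exists>b\<in>carrier G. cm a b \<noteq> \<one>"
  proof (rule ccontr)
    assume "\<not> ?thesis"
    then have "lcs G (Suc 1) \<subseteq> {\<one>}" by (intro lcs_Suc_least triv_subgroup) auto
    then show False using \<open>?N \<noteq> {\<one>}\<close> one_in_lcs[of 2] by (auto simp: numeral_2_eq_2)
  qed
  then obtain a b where ab: "a \<in> carrier G" "b \<in> carrier G" "cm a b \<noteq> \<one>" by blast
  let ?c = "cm a b"
  have c: "?c \<in> ?N" using cmN ab by blast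
  have "\<exists>e\<in>carrier G. \<exists>f\<in>carrier G. cm e f \<notin> {\<one>, ?c}"
  proof (rule ccontr)
    assume no: "\<not> ?thesis"
    have "subgroup {\<one>, ?c} G"
      using sq[OF c] inv_N[OF c] ab by (intro subgroupI) auto
    then have "lcs G (Suc 1) \<subseteq> {\<one>, ?c}" using no by (intro lcs_Suc_least) auto
    then have "card ?N \<le> card {\<one>, ?c}" by (intro card_mono) (auto simp: numeral_2_eq_2)
    also have "\<dots> \<le> 2" by (simp add: card_insert_if)
    finally show False using cN by simp
  qed
  then obtain e f where ef: "e \<in> carrier G" "f \<in> carrier G" "cm e f \<notin> {\<one>, ?c}" by blast
  let ?d = "cm e f"
  have ac: "cm a k \<in> {\<one>, ?c}" "cm b k \<in> {\<one>, ?c}" if "k \<in> carrier G" for k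
    using key2[OF ab(1,2) that ab(3)] key2[OF ab(2,1) that] sym ab by auto
  have ed: "cm e k \<in> {\<one>, ?d}" "cm f k \<in> {\<one>, ?d}" if "k \<in> carrier G" for k
    using key2[OF ef(1,2) that] key2[OF ef(2,1) that] sym[OF ef(1,2)] ef by auto
  have 1: "cm u v = \<one>" if "u \<in> {a, b}" "v \<in> {e, f}" for u v
  proof -
    have uv: "u \<in> carrier G" "v \<in> carrier G" using that ab ef by auto
    have "cm u v \<in> {\<one>, ?c}" using that ac uv by auto
    moreover have "cm v u \<in> {\<one>, ?d}" using that ed uv by auto
    ultimately show ?thesis using sym[OF uv] ef(3) by auto
  qed
  \<comment> \<open>The product \<open>a e\<close> has the commutator \<open>c\<close> with
    \<open>b\<close> and the different commutator \<open>d\<close> with \<open>f\<close>.\<close>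
  have "cm (a \<otimes> e) b = ?c" using left[OF ab(1) ef(1) ab(2)] 1[of b e] sym[OF ab(2) ef(1)] ab by simp
  then have "cm (a \<otimes> e) f \<in> {\<one>, ?c}" using key2[OF ab(2) _ ef(2), of "a \<otimes> e"] sym[of b "a \<otimes> e"] ab ef by simp
  moreover have "cm (a \<otimes> e) f = ?d" using left[OF ab(1) ef(1,2)] 1[of a f] ef by simp
  ultimately show False using ef by simp
qed

text \<open>Some \<open>a\<close> acts nontrivially on \<open>N\<close>. As \<open>gamma_4\<close>
  is trivial, \<open>centralizes_mod_lcs\<close> provides \<open>b\<close> with
  \<open>x = cm a b\<close> outside \<open>gamma_3\<close>. If \<open>a\<close> commuted with
  \<open>x\<close>, it would centralize \<open>N\<close>, because \<open>gamma_3\<close> is central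
  and has prime index in \<open>N\<close>.\<close>

lemma class_3_data:
  assumes n: "n = 2" and nc: "\<not> derived_cyclic G" and l3: "lcs G 3 \<noteq> {\<one>}"
  obtains a b where "a \<in> carrier G" "b \<in> carrier G" "cm a b \<notin> lcs G 3" "cm a (cm a b) \<noteq> \<one>"
    "\<And>t h. t \<in> lcs G 3 \<Longrightarrow> h \<in> carrier G \<Longrightarrow> h \<otimes> t = t \<otimes> h"
    "generate G {cm a (cm a b)} = lcs G 3" "cm a (cm a b) \<in> lcs G 3"
proof -
  let ?N = "lcs G 2" and ?M = "lcs G 3"
  have N: "subgroup ?N G" and M: "subgroup ?M G" by (rule lcs_subgroup)+
  have MN: "?M \<subseteq> ?N" using lcs_antimono[of 2 3] by simp
  have cM: "card ?M = p" and l4: "lcs G 4 = {\<one>}"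
    using square_third_term[OF n nc l3] by blast+
  have cen: "h \<otimes> t = t \<otimes> h" if "t \<in> ?M" "h \<in> carrier G" for t h
    using central_of_next_trivial[of 3 t h] l4 that lcs_carrier[OF that(1)] by (simp add: eval_nat_numeral cm_eq_one_iff)
  have c3: "cm h t \<in> ?M" if "t \<in> ?N" "h \<in> carrier G" for h t
    using cm_in_lcs(2)[OF that] by (simp add: eval_nat_numeral)
  have "\<exists>a\<in>carrier G. \<exists>t\<in>?N. cm t a \<noteq> \<one>"
  proof (rule ccontr)
    assume "\<not> ?thesis"
    then have "lcs G (Suc 2) \<subseteq> {\<one>}" by (intro lcs_Suc_least triv_subgroup) auto
    then show False using l3 one_in_lcs[of 3] by (auto simp: eval_nat_numeral)
  qed
  then obtain a t where a: "a \<in> carrier G" and t: "t \<in> ?N" "cm t a \<noteq> \<one>" by blast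
  have tG: "t \<in> carrier G" using t lcs_carrier by blast
  have at: "a \<otimes> t \<noteq> t \<otimes> a" using t(2) cm_eq_one_iff[OF tG a] by metis
  then have "cm a t \<noteq> \<one>" using cm_eq_one_iff[OF a tG] by simp
  then have "cm a t \<notin> lcs G 4" using l4 by simp
  then obtain b where b: "b \<in> carrier G" "cm a b \<notin> ?M" using centralizes_mod_lcs[OF a _ t(1)] by blast
  let ?x = "cm a b"
  have x: "?x \<in> ?N" using cm_in_derived a b by simp
  have xG: "?x \<in> carrier G" using a b by simp
  let ?z = "cm a ?x"
  have z: "?z \<in> ?M" using c3[OF x a] .
  have zG: "?z \<in> carrier G" using a b by simp
  have "?z \<noteq> \<one>"
  proof
    assume "?z = \<one>"
    then have ax: "?x \<otimes> a = a \<otimes> ?x" using cm_eq_one_iff[OF a xG] by simp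
    let ?C = "{g \<in> carrier G. \<forall>u\<in>{a}. g \<otimes> u = u \<otimes> g} \<inter> ?N"
    have C: "subgroup ?C G" using a by (intro subgroups_Inter_pair centralizer_subgroup N) auto
    have "?C = ?N"
    proof (rule prime_index_eq[OF M C N _ _ fin _ p])
      show "?M \<subseteq> ?C" using MN cen[OF _ a] lcs_carrier by auto
      show "card ?N = p * card ?M" using card n cM by (simp add: power2_eq_square)
      show "?x \<in> ?C" using x xG ax by simp
      show "?x \<notin> ?M" using b by simp
    qed auto
    then have "t \<in> ?C" using t(1) by blast
    then show False using at by simp
  qed
  moreover have "generate G {?z} = ?M"
  proof (rule subgroup_eq_of_card)
    have "ord ?z dvd p" using ord_dvd_subgroup_card[OF M z] cM by simp
    moreover have "ord ?z \<noteq> 1" using ord_eq_1[OF zG] \<open>?z \<noteq> \<one>\<close> by simp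
    ultimately have "ord ?z = p" using p by (metis prime_nat_iff)
    then show "card ?M \<le> card (generate G {?z})" using generate_pow_card[OF zG] cM by simp
    show "subgroup (generate G {?z}) G" using zG by (intro generate_is_subgroup) simp
    show "generate G {?z} \<subseteq> ?M" using z by (intro generate_subset_subgroup[OF M]) simp
  qed (simp add: fin_lcs)
  ultimately show thesis using that[OF a b] cen z by blast
qed

end

section \<open>Lower bounds for the exceptional groups\<close>
context group
begin

lemma tstep_at:
  "t \<in> carrier G \<Longrightarrow> tstep G c h u t = u (t \<otimes> inv c) - u (inv h \<otimes> t \<otimes> h)"
  by (simp add: tstep_def tr_def cj_def)

text \<open>The nonvanishing commutator is \<open>[a, b, b, a, b, a^2, b]\<close>; its coefficients on the
  elements \<open>x ^ i z ^ j\<close> are tracked step by step.\<close>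

lemma not_lie_zero_elementary_9:
  assumes a: "a \<in> carrier G" and b: "b \<in> carrier G"
    and x: "x \<in> carrier G" "cm a b = x" and z: "z \<in> carrier G" "cm a x = z"
    and comm: "a \<otimes> z = z \<otimes> a" "b \<otimes> x = x \<otimes> b" "b \<otimes> z = z \<otimes> b" "x \<otimes> z = z \<otimes> x"
    and exp: "x [^] (3::nat) = \<one>" "z [^] (3::nat) = \<one>"
    and ind: "\<And>i j. x [^] (i::nat) \<otimes> z [^] (j::nat) = \<one> \<Longrightarrow> 3 dvd i \<and> 3 dvd j"
    and K: "CHAR('k::field) = 3"
  shows "\<not> lie_zero TYPE('k) G 6"
proof
  assume L: "lie_zero TYPE('k) G 6"
  \<comment> \<open>Elements of \<open><x, z>\<close> in coordinates. Exponents are natural numbers,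
    so inverses are expressed by \<open>-1 = 2\<close> modulo 3.\<close>
  define E where "E i j = x [^] (i::nat) \<otimes> z [^] (j::nat)" for i j
  have E_closed [simp]: "E i j \<in> carrier G" for i j using x z by (simp add: E_def)
  have xz_pow: "z [^] (j::nat) \<otimes> x [^] (i::nat) = x [^] i \<otimes> z [^] j" for i j
    using x z comm(4) by (metis group_commutes_pow nat_pow_closed)
  have E_mult: "E i j \<otimes> E k l = E (i + k) (j + l)" for i j k l
  proof -
    have "E i j \<otimes> E k l = x [^] i \<otimes> (z [^] j \<otimes> x [^] k) \<otimes> z [^] l"
      using x z by (simp add: E_def m_assoc)
    also have "\<dots> = (x [^] i \<otimes> x [^] k) \<otimes> (z [^] j \<otimes> z [^] l)"
      unfolding xz_pow using x z by (simp add: m_assoc)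
    finally show ?thesis using x z by (simp add: E_def nat_pow_mult)
  qed
  have pow_mod3: "t [^] (i mod 3) = t [^] (i::nat)" if "t \<in> carrier G" "t [^] (3::nat) = \<one>" for t i
  proof -
    have "t [^] i = t [^] (3 * (i div 3) + i mod 3)" by simp
    also have "\<dots> = (t [^] (3::nat)) [^] (i div 3) \<otimes> t [^] (i mod 3)"
      using that(1) by (simp only: nat_pow_mult nat_pow_pow nat_pow_closed)
    finally show ?thesis using that by simp
  qed
  have E_mod: "E i j = E (i mod 3) (j mod 3)" for i j
    unfolding E_def using pow_mod3[OF x(1) exp(1)] pow_mod3[OF z(1) exp(2)] by simp
  have E00: "E 0 0 = \<one>" by (simp add: E_def)
  have E_inv: "inv (E i j) = E (2 * i) (2 * j)" for i j
  proof (rule inv_equality)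
    show "E (2 * i) (2 * j) \<otimes> E i j = \<one>" unfolding E_mult using E_mod[of "2 * i + i" "2 * j + j"] E00 by simp
  qed simp_all
  have xE: "x = E 1 0" and zE: "z = E 0 1" using x z by (simp_all add: E_def)
  have conj_a: "a \<otimes> E i j \<otimes> inv a = E i (i + j)" for i j
  proof -
    have "a \<otimes> E i j \<otimes> inv a = (a \<otimes> x [^] i \<otimes> inv a) \<otimes> (a \<otimes> z [^] j \<otimes> inv a)"
      using a x z by (simp add: E_def m_assoc)
    also have "a \<otimes> x [^] i \<otimes> inv a = (z \<otimes> x) [^] i"
      using conj_pow[OF a x(1)] conj_eq_cm[OF a x(1)] z by simp
    also have "(z \<otimes> x) [^] i = z [^] i \<otimes> x [^] i"
      using x z comm by (intro pow_mult_distrib) auto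
    also have "a \<otimes> z [^] j \<otimes> inv a = z [^] j"
    proof -
      have "a \<otimes> z \<otimes> inv a = z" using comm(1) a z by (simp add: m_assoc)
      then show ?thesis using conj_pow[OF a z(1)] by simp
    qed
    finally show ?thesis using x z xz_pow by (simp add: E_def m_assoc nat_pow_mult)
  qed
  have conj_ai: "inv a \<otimes> E i j \<otimes> a = E i (2 * i + j)" for i j
  proof -
    have "inv a \<otimes> (a \<otimes> E i (2 * i + j) \<otimes> inv a) \<otimes> a = E i (2 * i + j)" using a by (simp add: m_assoc)
    moreover have "a \<otimes> E i (2 * i + j) \<otimes> inv a = E i j"
      unfolding conj_a by (subst E_mod, subst (2) E_mod) (simp add: mod_mult_self3 add.assoc[symmetric])
    ultimately show ?thesis by simp
  qed
  have b_comm: "b \<otimes> E i j = E i j \<otimes> b" for i j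
  proof -
    have "b \<otimes> x [^] i = x [^] i \<otimes> b" "b \<otimes> z [^] j = z [^] j \<otimes> b"
      using comm b x z by (metis group_commutes_pow)+
    then show ?thesis using b x z by (simp add: E_def m_assoc[symmetric]) (simp add: m_assoc)
  qed
  have conj_b: "b \<otimes> E i j \<otimes> inv b = E i j" and conj_bi: "inv b \<otimes> E i j \<otimes> b = E i j" for i j
    using b_comm[of i j] b by (simp_all add: m_assoc) (simp flip: b_comm)
  have E_eqI: "E i j = E k l" if "i mod 3 = k mod 3" "j mod 3 = l mod 3" for i j k l
    using E_mod[of i j] E_mod[of k l] that by simp
  \<comment> \<open>The rules \<open>cm_b\<close> and \<open>cm_a\<close> compute commutators of the
    growing words \<open>b w\<close> and \<open>a w\<close> letter by letter, as arithmetic with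
    exponents modulo 3.\<close>
  have cm_b: "cm (b \<otimes> w) v = E m n"
    if "cm w v = E i j" "cm b v = E k l" "w \<in> carrier G" "v \<in> carrier G"
      "(i + k) mod 3 = m mod 3" "(j + l) mod 3 = n mod 3" for w v i j k l m n
    using cm_mult_left[OF b that(3,4)] that(1,2) conj_b E_eqI[OF that(5,6)] by (simp add: E_mult)
  have cm_a: "cm (a \<otimes> w) v = E m n"
    if "cm w v = E i j" "cm a v = E k l" "w \<in> carrier G" "v \<in> carrier G"
      "(i + k) mod 3 = m mod 3" "(i + j + l) mod 3 = n mod 3" for w v i j k l m n
    using cm_mult_left[OF a that(3,4)] that(1,2) conj_a E_eqI[OF that(5,6)] by (simp add: E_mult)
  let ?aa = "a \<otimes> a"
  have aa: "?aa \<in> carrier G" using a by simp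
  let ?g1 = "b \<otimes> a" let ?g2 = "b \<otimes> ?g1" let ?g3 = "a \<otimes> ?g2" let ?g4 = "b \<otimes> ?g3" let ?g5 = "?aa \<otimes> ?g4"
  have gc: "?g1 \<in> carrier G" "?g2 \<in> carrier G" "?g3 \<in> carrier G" "?g4 \<in> carrier G" "?g5 \<in> carrier G"
    using a b by auto
  have bb: "cm b b = E 0 0" "cm a a = E 0 0" using a b E00 by simp_all
  have c0: "cm a b = E 1 0" using x xE by simp
  have c1: "cm ?g1 b = E 1 0" by (rule cm_b[OF c0 bb(1) a b]) simp_all
  have ba: "cm b a = E 2 0" using inv_cm[OF a b] E_inv[of 1 0] unfolding c0 by simp
  have "cm ?g1 a = E 2 0" by (rule cm_b[OF bb(2) ba a a]) simp_all
  from cm_b[OF this ba gc(1) a, of 1 0] have c2: "cm ?g2 a = E 1 0" by simp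
  have g2b: "cm ?g2 b = E 1 0" by (rule cm_b[OF c1 bb(1) gc(1) b]) simp_all
  have c3: "cm ?g3 b = E 2 1" by (rule cm_a[OF g2b c0 gc(2) b]) simp_all
  have aab: "cm ?aa b = E 2 1" by (rule cm_a[OF c0 c0 a b]) simp_all
  have baa: "cm b ?aa = E 1 2"
    using inv_cm[OF aa b] E_inv[of 2 1] E_eqI[of "2 * 2" 1 "2 * 1" 2] unfolding aab by simp
  have a_aa: "cm a ?aa = E 0 0" using cm_eq_one_iff[OF a aa] a E00 by (simp add: m_assoc)
  have "cm ?g1 ?aa = E 1 2" by (rule cm_b[OF a_aa baa a aa]) simp_all
  from cm_b[OF this baa gc(1) aa, of 2 1] have "cm ?g2 ?aa = E 2 1" by simp
  from cm_a[OF this a_aa gc(2) aa, of 2 0] have "cm ?g3 ?aa = E 2 0" by simp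
  from cm_b[OF this baa gc(3) aa, of 0 2] have c4: "cm ?g4 ?aa = E 0 2" by simp
  have "cm ?g4 b = E 2 1" by (rule cm_b[OF c3 bb(1) gc(3) b]) simp_all
  from cm_a[OF this c0 gc(4) b, of 0 0] have "cm (a \<otimes> ?g4) b = E 0 0" by simp
  from cm_a[OF this c0 _ b, of 1 0] have "cm (a \<otimes> (a \<otimes> ?g4)) b = E 1 0" using a gc by simp
  then have c5: "cm ?g5 b = E 1 0" using a gc by (simp add: m_assoc)
  have conj_aai: "inv ?aa \<otimes> E i j \<otimes> ?aa = E i (i + j)" for i j
  proof -
    have "inv ?aa \<otimes> E i j \<otimes> ?aa = inv a \<otimes> (inv a \<otimes> E i j \<otimes> a) \<otimes> a"
      using a by (simp add: word_simps)
    also have "\<dots> = E i (3 * i + (i + j))" unfolding conj_ai by (simp add: algebra_simps)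
    also have "\<dots> = E i (i + j)" by (rule E_eqI) (simp, presburger)
    finally show ?thesis .
  qed
  \<comment> \<open>Here \<open>u1\<close>, ..., \<open>u6\<close> are the coefficient functions
    after each of the six commutators. The group elements passed to \<open>tstep\<close> are the
    commutators \<open>c0\<close>, ..., \<open>c5\<close> of the current word with the next
    argument.\<close>
  define u0 u1 u2 u3 u4 u5 u6 where
    "u0 = (delta \<one> :: 'a \<Rightarrow> 'k)" and "u1 = tstep G (E 1 0) b u0" and "u2 = tstep G (E 1 0) b u1"
    and "u3 = tstep G (E 1 0) a u2" and "u4 = tstep G (E 2 1) b u3"
    and "u5 = tstep G (E 0 2) ?aa u4" and "u6 = tstep G (E 1 0) b u5"
  have e0: "u0 (E i j) = of_bool (3 dvd i \<and> 3 dvd j)" for i j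
  proof -
    have "E i j = \<one> \<longleftrightarrow> 3 dvd i \<and> 3 dvd j"
    proof
      assume "E i j = \<one>"
      then show "3 dvd i \<and> 3 dvd j" unfolding E_def by (rule ind)
    next
      assume "3 dvd i \<and> 3 dvd j"
      then show "E i j = \<one>" using E_eqI[of i 0 j 0] E00 by (simp add: dvd_eq_mod_eq_0)
    qed
    then show ?thesis by (simp add: u0_def delta_def)
  qed
  have e1: "u1 (E i j) = u0 (E (i + 2) j) - u0 (E i j)" and e2: "u2 (E i j) = u1 (E (i + 2) j) - u1 (E i j)"
    and e3: "u3 (E i j) = u2 (E (i + 2) j) - u2 (E i (2 * i + j))"
    and e4: "u4 (E i j) = u3 (E (i + 4) (j + 2)) - u3 (E i j)"
    and e5: "u5 (E i j) = u4 (E i (j + 4)) - u4 (E i (i + j))"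
    and e6: "u6 (E i j) = u5 (E (i + 2) j) - u5 (E i j)" for i j
    by (simp_all add: u1_def u2_def u3_def u4_def u5_def u6_def tstep_at E_inv E_mult conj_bi conj_ai conj_aai del: One_nat_def)
  have "(\<lambda>_. 0) = fold (ad G) [b, b, a, b, ?aa, b] (delta a :: 'a \<Rightarrow> 'k)"
    using lie_zeroD[OF L a, of "[b, b, a, b, ?aa, b]"] a b by simp
  also have "\<dots> = ad G b (ad G ?aa (ad G b (ad G a (ad G b (ad G b (tr G a u0))))))"
    using a by (simp add: u0_def delta_one_tr)
  also have "ad G b (tr G a u0) = tr G ?g1 u1" by (rule ad_step[OF a b c0]) (simp add: u1_def)
  also have "ad G b \<dots> = tr G ?g2 u2" by (rule ad_step[OF gc(1) b c1]) (simp add: u2_def)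
  also have "ad G a \<dots> = tr G ?g3 u3" by (rule ad_step[OF gc(2) a c2]) (simp add: u3_def)
  also have "ad G b \<dots> = tr G ?g4 u4" by (rule ad_step[OF gc(3) b c3]) (simp add: u4_def)
  also have "ad G ?aa \<dots> = tr G ?g5 u5" by (rule ad_step[OF gc(4) aa c4]) (simp add: u5_def)
  also have "ad G b \<dots> = tr G (b \<otimes> ?g5) u6" by (rule ad_step[OF gc(5) b c5]) (simp add: u6_def)
  finally have "u6 (E 1 0) = 0"
    using tr_zeroD[of "b \<otimes> ?g5" u6 "E 1 0"] gc b by simp
  \<comment> \<open>The recursions expand this one coefficient into a signed sum of values of
    \<open>u0\<close> at explicit exponents, each of them 0 or 1.\<close>
  moreover have "u6 (E 1 0) = 1"
    unfolding e6 e5 e4 e3 e2 e1 e0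
    by (simp del: One_nat_def add_2_eq_Suc add_2_eq_Suc' add: dvd_eq_mod_eq_0)
  ultimately show False by simp
qed

end

context group
begin

text \<open>In characteristic 2 the commutator \<open>[a b, a, a, b, a, a, b]\<close> equals
  \<open>[a b, a^2, b, a^2, b]\<close>, which is computed on the elements \<open>x ^ i y ^ j z ^ k\<close>.\<close>

lemma not_lie_zero_order_8:
  assumes a: "a \<in> carrier G" and b: "b \<in> carrier G"
    and x: "x \<in> carrier G" "cm a b = x" and y: "y \<in> carrier G" "cm a x = y" and z: "z \<in> carrier G" "cm a y = z"
    and comm: "a \<otimes> z = z \<otimes> a" "b \<otimes> x = x \<otimes> b" "b \<otimes> y = y \<otimes> b" "b \<otimes> z = z \<otimes> b"
      "x \<otimes> y = y \<otimes> x" "x \<otimes> z = z \<otimes> x" "y \<otimes> z = z \<otimes> y"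
    and sq: "x \<otimes> x \<in> {\<one>, z}" "y \<otimes> y = \<one>" "z \<otimes> z = \<one>"
    and ne: "z \<noteq> \<one>" "y \<notin> {\<one>, z}" "x \<notin> {\<one>, y, z, y \<otimes> z}"
    and K: "CHAR('k::field) = 2"
  shows "\<not> lie_zero TYPE('k) G 6"
proof
  assume L: "lie_zero TYPE('k) G 6"
  \<comment> \<open>Exponents are compared modulo 4, 2, 2 although \<open>x^2\<close> may coincide
    with \<open>z\<close> or be trivial; the resulting ambiguity is resolved only in
    \<open>e0\<close>, where \<open>u0\<close> is evaluated.\<close>
  define E where "E i j k = x [^] (i::nat) \<otimes> (y [^] (j::nat) \<otimes> z [^] (k::nat))" for i j k
  have E_closed [simp]: "E i j k \<in> carrier G" for i j k using x y z by (simp add: E_def)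
  have yx_pow: "y [^] (j::nat) \<otimes> x [^] (i::nat) = x [^] i \<otimes> y [^] j" for i j
    using x y comm(5) by (metis group_commutes_pow nat_pow_closed)
  have zx_pow: "z [^] (j::nat) \<otimes> x [^] (i::nat) = x [^] i \<otimes> z [^] j" for i j
    using x z comm(6) by (metis group_commutes_pow nat_pow_closed)
  have zy_pow: "z [^] (j::nat) \<otimes> y [^] (i::nat) = y [^] i \<otimes> z [^] j" for i j
    using y z comm(7) by (metis group_commutes_pow nat_pow_closed)
  have E_mult: "E i j k \<otimes> E i' j' k' = E (i + i') (j + j') (k + k')" for i j k i' j' k'
  proof -
    have "E i j k \<otimes> E i' j' k' = x [^] i \<otimes> y [^] j \<otimes> (z [^] k \<otimes> x [^] i') \<otimes> y [^] j' \<otimes> z [^] k'"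
      using x y z by (simp add: E_def m_assoc)
    also have "\<dots> = x [^] i \<otimes> (y [^] j \<otimes> x [^] i') \<otimes> (z [^] k \<otimes> y [^] j') \<otimes> z [^] k'"
      unfolding zx_pow using x y z by (simp add: m_assoc)
    also have "\<dots> = (x [^] i \<otimes> x [^] i') \<otimes> ((y [^] j \<otimes> y [^] j') \<otimes> (z [^] k \<otimes> z [^] k'))"
      unfolding yx_pow zy_pow using x y z by (simp add: m_assoc)
    finally show ?thesis using x y z by (simp add: E_def nat_pow_mult)
  qed
  have pow_mod: "t [^] (i mod m) = t [^] (i::nat)" if "t \<in> carrier G" "t [^] (m::nat) = \<one>" for t i m
  proof -
    have "t [^] i = t [^] (m * (i div m) + i mod m)" by simp
    also have "\<dots> = (t [^] m) [^] (i div m) \<otimes> t [^] (i mod m)"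
      using that(1) by (simp only: nat_pow_mult nat_pow_pow nat_pow_closed)
    finally show ?thesis using that by simp
  qed
  have y2: "y [^] (2::nat) = \<one>" and z2: "z [^] (2::nat) = \<one>" using sq y z by (simp_all add: numeral_2_eq_2)
  \<comment> \<open>The number \<open>e\<close> treats both isomorphism types of
    \<open><x, y, z>\<close> at once: elementary abelian for \<open>e = 0\<close>, and
    \<open>C_4 x C_2\<close> for \<open>e = 1\<close>.\<close>
  obtain e :: nat where e: "e \<in> {0, 1}" "x \<otimes> x = z [^] e"
    using sq(1) z by (metis insertCI insertE nat_pow_0 nat_pow_eone singletonD)
  have x4: "x [^] (4::nat) = \<one>"
  proof -
    have "x [^] (4::nat) = (x \<otimes> x) \<otimes> (x \<otimes> x)" using x by (simp add: eval_nat_numeral m_assoc)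
    then show ?thesis using sq z by auto
  qed
  have E_eqI: "E i j k = E i' j' k'" if "i mod 4 = i' mod 4" "j mod 2 = j' mod 2" "k mod 2 = k' mod 2" for i j k i' j' k'
    using pow_mod[OF x(1) x4, of i] pow_mod[OF x(1) x4, of i'] pow_mod[OF y(1) y2, of j] pow_mod[OF y(1) y2, of j']
      pow_mod[OF z(1) z2, of k] pow_mod[OF z(1) z2, of k'] that unfolding E_def by simp
  have E0: "E 0 0 0 = \<one>" by (simp add: E_def)
  have E_inv: "inv (E i j k) = E (3 * i) j k" for i j k
  proof (rule inv_equality)
    show "E (3 * i) j k \<otimes> E i j k = \<one>"
      unfolding E_mult E0[symmetric] by (rule E_eqI) simp_all
  qed simp_all
  have ex: "x = E 1 0 0" and ey: "y = E 0 1 0" and ez: "z = E 0 0 1" using x y z by (simp_all add: E_def)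
  have conj_a: "a \<otimes> E i j k \<otimes> inv a = E i (i + j) (j + k)" for i j k
  proof -
    have "a \<otimes> E i j k \<otimes> inv a = (a \<otimes> x [^] i \<otimes> inv a) \<otimes> ((a \<otimes> y [^] j \<otimes> inv a) \<otimes> (a \<otimes> z [^] k \<otimes> inv a))"
      using a x y z by (simp add: E_def m_assoc)
    also have "a \<otimes> x [^] i \<otimes> inv a = (y \<otimes> x) [^] i"
      using conj_pow[OF a x(1)] conj_eq_cm[OF a x(1)] y by simp
    also have "(y \<otimes> x) [^] i = y [^] i \<otimes> x [^] i" using x y comm by (intro pow_mult_distrib) auto
    also have "\<dots> = E i i 0" unfolding yx_pow using x y by (simp add: E_def)
    also have "a \<otimes> y [^] j \<otimes> inv a = (z \<otimes> y) [^] j"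
      using conj_pow[OF a y(1)] conj_eq_cm[OF a y(1)] z by simp
    also have "(z \<otimes> y) [^] j = z [^] j \<otimes> y [^] j" using y z comm by (intro pow_mult_distrib) auto
    also have "\<dots> = E 0 j j" unfolding zy_pow using y z by (simp add: E_def)
    also have "a \<otimes> z [^] k \<otimes> inv a = E 0 0 k"
    proof -
      have "a \<otimes> z \<otimes> inv a = z" using comm(1) a z by (simp add: m_assoc)
      then show ?thesis using conj_pow[OF a z(1)] z by (simp add: E_def)
    qed
    finally show ?thesis by (simp add: E_mult)
  qed
  let ?aa = "a \<otimes> a"
  have aa: "?aa \<in> carrier G" using a by simp
  have conj_aai: "inv ?aa \<otimes> E i j k \<otimes> ?aa = E i j (i + k)" for i j k
  proof -
    have "a \<otimes> (a \<otimes> E i j (i + k) \<otimes> inv a) \<otimes> inv a = E i j k"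
      unfolding conj_a by (rule E_eqI) (simp_all, presburger+)
    moreover have "inv ?aa \<otimes> (a \<otimes> (a \<otimes> E i j (i + k) \<otimes> inv a) \<otimes> inv a) \<otimes> ?aa = E i j (i + k)"
      using a by (simp add: word_simps)
    ultimately show ?thesis by simp
  qed
  have b_comm: "b \<otimes> E i j k = E i j k \<otimes> b" for i j k
  proof -
    have "b \<otimes> x [^] i = x [^] i \<otimes> b" "b \<otimes> y [^] j = y [^] j \<otimes> b" "b \<otimes> z [^] k = z [^] k \<otimes> b"
      using comm b x y z by (metis group_commutes_pow)+
    then have "E i j k \<in> {g \<in> carrier G. \<forall>t\<in>{b}. g \<otimes> t = t \<otimes> g}"
      unfolding E_def using b x y z by (intro subgroup.m_closed[OF centralizer_subgroup]) auto
    then show ?thesis by simp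
  qed
  have conj_b: "b \<otimes> E i j k \<otimes> inv b = E i j k" for i j k
    using b b_comm[of i j k] by (simp add: m_assoc)
  have conj_bi: "inv b \<otimes> E i j k \<otimes> b = E i j k" for i j k
    using b b_comm[of i j k, symmetric] by (simp add: m_assoc)
  have cm_b: "cm (b \<otimes> w) v = E l m n"
    if "cm w v = E i j k" "cm b v = E i' j' k'" "w \<in> carrier G" "v \<in> carrier G"
      "(i + i') mod 4 = l mod 4" "(j + j') mod 2 = m mod 2" "(k + k') mod 2 = n mod 2" for w v i j k i' j' k' l m n
    using cm_mult_left[OF b that(3,4)] that(1,2) conj_b E_eqI[OF that(5-7)] by (simp add: E_mult)
  have cm_a: "cm (a \<otimes> w) v = E l m n"
    if "cm w v = E i j k" "cm a v = E i' j' k'" "w \<in> carrier G" "v \<in> carrier G"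
      "(i + i') mod 4 = l mod 4" "(i + j + j') mod 2 = m mod 2" "(j + k + k') mod 2 = n mod 2" for w v i j k i' j' k' l m n
    using cm_mult_left[OF a that(3,4)] that(1,2) conj_a E_eqI[OF that(5-7)] by (simp add: E_mult)
  \<comment> \<open>The words \<open>g1\<close>, \<open>g2\<close>, \<open>g3\<close> arise from
    \<open>g0\<close> by the successive commutators with \<open>a^2\<close>, \<open>b\<close>,
    \<open>a^2\<close>; \<open>h1\<close> and \<open>h3\<close> are the halfway points, so that the
    letterwise rules apply to each factor \<open>a\<close>.\<close>
  let ?g0 = "a \<otimes> b" let ?h1 = "a \<otimes> ?g0" let ?g1 = "a \<otimes> ?h1" let ?g2 = "b \<otimes> ?g1" let ?h3 = "a \<otimes> ?g2" let ?g3 = "a \<otimes> ?h3"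
  have gc: "?g0 \<in> carrier G" "?h1 \<in> carrier G" "?g1 \<in> carrier G" "?g2 \<in> carrier G" "?h3 \<in> carrier G" "?g3 \<in> carrier G"
    using a b by auto
  have c: "cm a b = E 1 0 0" using x ex by simp
  have bb: "cm b b = E 0 0 0" using b E0 by simp
  have a_aa: "cm a ?aa = E 0 0 0" using cm_eq_one_iff[OF a aa] a E0 by (simp add: m_assoc)
  have aab: "cm ?aa b = E 2 1 0" by (rule cm_a[OF c c a b]) simp_all
  have "cm b ?aa = E (3 * 2) 1 0" using inv_cm[OF aa b] E_inv[of 2 1 0] unfolding aab by simp
  also have "\<dots> = E 2 1 0" by (rule E_eqI) simp_all
  finally have baa: "cm b ?aa = E 2 1 0" .
  have c0: "cm ?g0 ?aa = E 2 1 1" by (rule cm_a[OF baa a_aa b aa]) simp_all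
  have g0b: "cm ?g0 b = E 1 0 0" by (rule cm_a[OF bb c b b]) simp_all
  have h1b: "cm ?h1 b = E 2 1 0" by (rule cm_a[OF g0b c gc(1) b]) simp_all
  have c1: "cm ?g1 b = E 3 1 1" by (rule cm_a[OF h1b c gc(2) b]) simp_all
  have h1aa: "cm ?h1 ?aa = E 2 1 0" by (rule cm_a[OF c0 a_aa gc(1) aa]) simp_all
  have g1aa: "cm ?g1 ?aa = E 2 1 1" by (rule cm_a[OF h1aa a_aa gc(2) aa]) simp_all
  have c2: "cm ?g2 ?aa = E 0 0 1" by (rule cm_b[OF g1aa baa gc(3) aa]) simp_all
  have g2b: "cm ?g2 b = E 3 1 1" by (rule cm_b[OF c1 bb gc(3) b]) simp_all
  have h3b: "cm ?h3 b = E 0 0 0" by (rule cm_a[OF g2b c gc(4) b]) simp_all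
  have c3: "cm ?g3 b = E 1 0 0" by (rule cm_a[OF h3b c gc(5) b]) simp_all
  have g_aa: "?aa \<otimes> ?g0 = ?g1" "?aa \<otimes> ?g2 = ?g3" using a b by (simp_all add: m_assoc)
  define u0 u1 u2 u3 u4 where
    "u0 = (delta \<one> :: 'a \<Rightarrow> 'k)" and "u1 = tstep G (E 2 1 1) ?aa u0" and "u2 = tstep G (E 3 1 1) b u1"
    and "u3 = tstep G (E 0 0 1) ?aa u2" and "u4 = tstep G (E 1 0 0) b u3"
  \<comment> \<open>The square of \<open>x\<close> is traded for \<open>z^e\<close>, which reduces
    every element to exponents below 2; by \<open>ne\<close> the eight reduced words differ from
    \<open>\<one>\<close> unless all exponents vanish.\<close>
  have e0: "u0 (E i j k) = of_bool (i mod 2 = 0 \<and> j mod 2 = 0 \<and> (e * (i div 2) + k) mod 2 = 0)" for i j k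
  proof -
    have red: "E i j k = E (i mod 2) (j mod 2) ((e * (i div 2) + k) mod 2)"
    proof -
      have "x [^] i = x [^] (2 * (i div 2) + i mod 2)" by simp
      also have "\<dots> = (x [^] (2::nat)) [^] (i div 2) \<otimes> x [^] (i mod 2)"
        using x by (simp only: nat_pow_mult nat_pow_pow nat_pow_closed)
      also have "x [^] (2::nat) = z [^] e" using e x by (simp add: numeral_2_eq_2)
      also have "(z [^] e) [^] (i div 2) \<otimes> x [^] (i mod 2) = E (i mod 2) 0 (e * (i div 2))"
        using x y z zx_pow by (simp add: E_def nat_pow_pow)
      finally have "E i j k = E (i mod 2) 0 (e * (i div 2)) \<otimes> E 0 j k"
        using x y z unfolding E_def[of i j k] by (simp add: E_def)
      also have "\<dots> = E (i mod 2) j (e * (i div 2) + k)" by (simp add: E_mult)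
      also have "\<dots> = E (i mod 2) (j mod 2) ((e * (i div 2) + k) mod 2)" by (rule E_eqI) simp_all
      finally show ?thesis .
    qed
    have small: "E i j k = \<one> \<longleftrightarrow> i = 0 \<and> j = 0 \<and> k = 0" if ijk: "i < 2" "j < 2" "k < 2" for i j k
    proof
      assume one: "E i j k = \<one>"
      have eqs: "t = t'" if "t \<otimes> t' = \<one>" "t' \<otimes> t' = \<one>" "t \<in> carrier G" "t' \<in> carrier G" for t t'
        using that by (metis r_cancel)
      have ijk': "i = 0 \<or> i = 1" "j = 0 \<or> j = 1" "k = 0 \<or> k = 1" using ijk by auto
      have yz2: "(y \<otimes> z) \<otimes> (y \<otimes> z) = \<one>"
      proof -
        have "(y \<otimes> z) \<otimes> (y \<otimes> z) = y \<otimes> (z \<otimes> y) \<otimes> z" using y z by (simp add: m_assoc)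
        also have "z \<otimes> y = y \<otimes> z" using comm by simp
        also have "y \<otimes> (y \<otimes> z) \<otimes> z = (y \<otimes> y) \<otimes> (z \<otimes> z)" using y z by (simp add: m_assoc)
        finally show ?thesis using sq by simp
      qed
      show "i = 0 \<and> j = 0 \<and> k = 0"
      proof (rule ccontr)
        assume "\<not> (i = 0 \<and> j = 0 \<and> k = 0)"
        then show False
          using one ijk' x y z ne sq yz2 eqs[of y z] eqs[of x y] eqs[of x z] eqs[of x "y \<otimes> z"]
          by (elim disjE) (simp_all add: E_def)
      qed
    qed (simp add: E0)
    have "E i j k = \<one> \<longleftrightarrow> i mod 2 = 0 \<and> j mod 2 = 0 \<and> (e * (i div 2) + k) mod 2 = 0"
      unfolding red by (rule small) simp_all
    then show ?thesis by (simp add: u0_def delta_def)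
  qed
  have e1: "u1 (E i j k) = u0 (E (i + 6) (j + 1) (k + 1)) - u0 (E i j (i + k))"
    and e2: "u2 (E i j k) = u1 (E (i + 9) (j + 1) (k + 1)) - u1 (E i j k)"
    and e3: "u3 (E i j k) = u2 (E i j (k + 1)) - u2 (E i j (i + k))"
    and e4: "u4 (E i j k) = u3 (E (i + 3) j k) - u3 (E i j k)" for i j k
    by (simp_all add: u1_def u2_def u3_def u4_def tstep_at E_inv E_mult conj_bi conj_aai del: One_nat_def)
  have two: "prime (2::nat)" by simp
  \<comment> \<open>In characteristic 2 two applications of \<open>ad\<close> with \<open>a\<close>
    equal one with \<open>a^2\<close>, so only four steps have to be followed instead of
    six.\<close>
  have ad2: "ad G a (ad G a f) = ad G ?aa f" if "f \<in> ga_carrier G" for f :: "'a \<Rightarrow> 'k"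
    using ad_funpow_prime[OF that a K two] a by (simp add: numeral_2_eq_2)
  have d0: "(delta ?g0 :: 'a \<Rightarrow> 'k) \<in> ga_carrier G" by (rule delta_in_ga_carrier[OF gc(1)])
  have d2: "ad G b (ad G ?aa (delta ?g0 :: 'a \<Rightarrow> 'k)) \<in> ga_carrier G"
    by (intro ad_in_ga_carrier d0 aa b)
  have "(\<lambda>_. 0) = fold (ad G) [a, a, b, a, a, b] (delta ?g0 :: 'a \<Rightarrow> 'k)"
    using lie_zeroD[OF L gc(1), of "[a, a, b, a, a, b]"] a b by simp
  also have "\<dots> = ad G b (ad G ?aa (ad G b (ad G ?aa (tr G ?g0 u0))))"
    using ad2[OF d0] ad2[OF d2] gc by (simp add: u0_def delta_one_tr)
  also have "ad G ?aa (tr G ?g0 u0) = tr G ?g1 u1" unfolding g_aa(1)[symmetric] by (rule ad_step[OF gc(1) aa c0]) (simp add: u1_def)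
  also have "ad G b \<dots> = tr G ?g2 u2" by (rule ad_step[OF gc(3) b c1]) (simp add: u2_def)
  also have "ad G ?aa \<dots> = tr G ?g3 u3" unfolding g_aa(2)[symmetric] by (rule ad_step[OF gc(4) aa c2]) (simp add: u3_def)
  also have "ad G b \<dots> = tr G (b \<otimes> ?g3) u4" by (rule ad_step[OF gc(6) b c3]) (simp add: u4_def)
  finally have "u4 (E 0 0 0) = 0"
    using tr_zeroD[of "b \<otimes> ?g3" u4 "E 0 0 0"] gc b by simp
  moreover have "u4 (E 0 0 0) = 1"
    unfolding e4 e3 e2 e1 e0 using e(1)
    by (auto simp del: One_nat_def add_2_eq_Suc add_2_eq_Suc')
  ultimately show False by simp
qed

end

section \<open>Choosing elements that satisfy the relations of the explicit computations\<close>

lemma (in group) cm_mult_right: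
  "a \<in> carrier G \<Longrightarrow> k \<in> carrier G \<Longrightarrow> l \<in> carrier G \<Longrightarrow> cm a (k \<otimes> l) = cm a k \<otimes> (k \<otimes> cm a l \<otimes> inv k)"
  by (simp add: cm_def word_simps)

context p_derived
begin

text \<open>The commutators of \<open>a\<close>, \<open>a^2\<close>, \<open>a^3\<close> with
  \<open>b\<close> are \<open>x\<close>, \<open>z\<close> and \<open>z x\<close>, none of them
  trivial. So the index is at least \<open>|N| + 1 = 5\<close>, too large for the value 4 in
  question.\<close>

lemma not_lie_zero_square_class_3_two:
  assumes pn: "p = 2" "n = 2" and nc: "\<not> derived_cyclic G" and l3: "lcs G 3 \<noteq> {\<one>}"
  shows "\<not> lie_zero TYPE('k::field) G 3"
proof -
  obtain a b where ab: "a \<in> carrier G" "b \<in> carrier G" and x: "cm a b \<notin> lcs G 3" and z: "cm a (cm a b) \<noteq> \<one>"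
    and zM: "cm a (cm a b) \<in> lcs G 3" and cen: "\<And>t h. t \<in> lcs G 3 \<Longrightarrow> h \<in> carrier G \<Longrightarrow> h \<otimes> t = t \<otimes> h"
    using class_3_data[OF pn(2) nc l3] by metis
  let ?x = "cm a b" and ?z = "cm a (cm a b)"
  have c: "?x \<in> carrier G" "?z \<in> carrier G" using ab by auto
  have "?x [^] p = \<one>" using exponent_of_noncyclic_square[OF pn(2) nc cm_in_derived[OF ab]] .
  then have x2: "?x \<otimes> ?x = \<one>" using pn c by (simp add: numeral_2_eq_2)
  have cj: "a \<otimes> ?x \<otimes> inv a = ?z \<otimes> ?x" using conj_eq_cm[OF ab(1) c(1)] .
  have "cm (a \<otimes> a) b = ?z \<otimes> ?x \<otimes> ?x" using cm_mult_left[OF ab(1) ab(1) ab(2)] cj by simp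
  then have 2: "cm (a \<otimes> a) b = ?z" using x2 c by (simp add: m_assoc)
  have "a \<otimes> ?z \<otimes> inv a = ?z" using cen[OF zM ab(1)] ab c by (simp add: m_assoc)
  then have 3: "cm (a \<otimes> (a \<otimes> a)) b = ?z \<otimes> ?x" using cm_mult_left[OF ab(1) _ ab(2), of "a \<otimes> a"] 2 ab by simp
  show ?thesis
  proof (rule not_lie_zero_of_noncommuting_powers[OF ab(2,1)])
    fix i :: nat assume "0 < i" "i \<le> 3"
    then consider "i = 1" | "i = 2" | "i = 3" by linarith
    then have "cm (a [^] i) b \<noteq> \<one>"
    proof cases
      case 1
      then show ?thesis using x one_in_lcs[of 3] ab by auto
    next
      case 2
      then have "a [^] i = a \<otimes> a" using ab by (simp add: numeral_2_eq_2)
      then show ?thesis using \<open>cm (a \<otimes> a) b = ?z\<close> z by simp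
    next
      case 3
      then have "a [^] i = a \<otimes> (a \<otimes> a)" using ab by (simp add: eval_nat_numeral m_assoc)
      moreover have "?z \<otimes> ?x \<noteq> \<one>"
      proof
        assume "?z \<otimes> ?x = \<one>"
        then have "inv ?x = ?z" using c by (intro inv_equality) auto
        then have "?x = inv ?z" using c by (metis inv_inv)
        then show False using x subgroup.m_inv_closed[OF lcs_subgroup zM] by simp
      qed
      ultimately show ?thesis using \<open>cm (a \<otimes> (a \<otimes> a)) b = ?z \<otimes> ?x\<close> by simp
    qed
    then show "a [^] i \<otimes> b \<noteq> b \<otimes> a [^] i" using cm_eq_one_iff[of "a [^] i" b] ab by simp
  qed
qed

text \<open>The pair from \<open>class_3_data\<close> need not have \<open>b\<close> commuting with
  \<open>x\<close>. Multiplying \<open>b\<close> by a power of \<open>a\<close> corrects this and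
  leaves \<open>cm a b\<close> unchanged.\<close>

lemma not_lie_zero_square_class_3_three:
  assumes pn: "p = 3" "n = 2" and nc: "\<not> derived_cyclic G" and l3: "lcs G 3 \<noteq> {\<one>}" and K: "CHAR('k::field) = 3"
  shows "\<not> lie_zero TYPE('k) G 6"
proof -
  let ?N = "lcs G 2" and ?M = "lcs G 3"
  obtain a b where ab: "a \<in> carrier G" "b \<in> carrier G" and xM: "cm a b \<notin> ?M" and z1: "cm a (cm a b) \<noteq> \<one>"
    and zM: "cm a (cm a b) \<in> ?M" and gz: "generate G {cm a (cm a b)} = ?M"
    and cen: "\<And>t h. t \<in> ?M \<Longrightarrow> h \<in> carrier G \<Longrightarrow> h \<otimes> t = t \<otimes> h"
    using class_3_data[OF pn(2) nc l3] by metis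
  define x where "x = cm a b"
  define z where "z = cm a x"
  have x: "x \<in> ?N" "x \<in> carrier G" using ab cm_in_derived by (simp_all add: x_def)
  have zN: "z \<in> ?N" and z: "z \<in> ?M" "z \<in> carrier G" "z \<noteq> \<one>"
    using zM z1 lcs_carrier[OF zM] lcs_antimono[of 2 3] by (auto simp: x_def z_def)
  have exp: "t [^] (3::nat) = \<one>" if "t \<in> ?N" for t
    using exponent_of_noncyclic_square[OF pn(2) nc that] pn by simp
  have oz: "ord z dvd 3" using pow_eq_id[OF z(2)] exp[OF zN] by simp
  have "ord z \<noteq> 1" using ord_eq_1[OF z(2)] z(3) by simp
  then have oz: "ord z = 3" using oz prime_nat_iff[of 3] by auto
  have M_eq: "?M = (\<lambda>i. z [^] (i::nat)) ` {..<3}"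
    using generate_single_nat[OF z(2)] oz gz by (simp add: x_def z_def)
  have cm3: "cm b x \<in> ?M" using cm_in_lcs(2)[OF x(1) ab(2)] by (simp add: eval_nat_numeral)
  then obtain j :: nat where j: "cm b x = z [^] j" using M_eq by auto
  have zc: "h \<otimes> z [^] (i::nat) = z [^] i \<otimes> h" if "h \<in> carrier G" for h i
    using cen[OF nat_pow_in_subgroup[OF lcs_subgroup z(1)] that] .
  \<comment> \<open>Against \<open>x\<close>, the factor \<open>b\<close> contributes
    \<open>z^j\<close> and \<open>a^i\<close> contributes \<open>z^i\<close>; with
    \<open>i = 2 j\<close> the total is \<open>z^(3 j) = \<one>\<close>.\<close>
  let ?i = "2 * j"
  let ?b = "b \<otimes> a [^] ?i"
  have b: "?b \<in> carrier G" using ab by simp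
  have "a \<otimes> cm a x \<otimes> inv a = cm a x [^] (1::nat)"
    using cen[OF z(1) ab(1)] ab z by (simp add: z_def[symmetric] m_assoc)
  from cm_pow_left[OF x(2) ab(1) this, of ?i] have "cm (a [^] ?i) x = z [^] ?i" by (simp add: z_def)
  then have "cm ?b x = b \<otimes> z [^] ?i \<otimes> inv b \<otimes> z [^] j"
    using cm_mult_left[OF ab(2) _ x(2), of "a [^] ?i"] j ab by simp
  also have "b \<otimes> z [^] ?i \<otimes> inv b = z [^] ?i" using zc[OF ab(2), of ?i] ab z by (simp add: m_assoc)
  also have "z [^] ?i \<otimes> z [^] j = (z [^] (3::nat)) [^] j" using z by (simp add: nat_pow_mult nat_pow_pow)
  also have "\<dots> = \<one>" using exp[OF zN] by simp
  finally have bx: "?b \<otimes> x = x \<otimes> ?b" using cm_eq_one_iff[OF b x(2)] by simp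
  have x_b: "cm a ?b = x"
  proof -
    have "cm a (a [^] ?i) = \<one>"
      using cm_eq_one_iff[of a "a [^] ?i"] ab nat_pow_Suc2[of a ?i] by simp
    then show ?thesis using cm_mult_right[OF ab(1,2), of "a [^] ?i"] ab by (simp add: x_def)
  qed
  have ind: "3 dvd i \<and> 3 dvd j" if eq: "x [^] (i::nat) \<otimes> z [^] (j::nat) = \<one>" for i j
  proof -
    have "x [^] i = inv (z [^] j)" using eq x z by (metis inv_equality inv_inv nat_pow_closed)
    then have xi: "x [^] i \<in> ?M"
      using nat_pow_in_subgroup[OF lcs_subgroup z(1)] subgroup.m_inv_closed[OF lcs_subgroup] by simp
    have 1: "3 dvd i"
    proof (rule ccontr)
      assume "\<not> 3 dvd i"
      moreover have "ord x dvd 3" using pow_eq_id[OF x(2)] exp[OF x(1)] by simp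
      then have "ord x = 1 \<or> ord x = 3" using prime_nat_iff[of 3] by auto
      then have "ord x = 3" using ord_eq_1[OF x(2)] xM one_in_lcs[of 3] by (auto simp: x_def)
      ultimately have "coprime i (ord x)" using prime_imp_coprime[of 3 i] by (simp add: coprime_commute)
      then obtain u :: nat where "x = (x [^] i) [^] u"
        using power_generates_of_coprime[OF x(2)] \<open>ord x = 3\<close> by auto
      then show False using xM nat_pow_in_subgroup[OF lcs_subgroup xi, of u] by (simp add: x_def)
    qed
    then have "x [^] i = \<one>" using pow_eq_id[OF x(2)] exp[OF x(1)] by (metis dvd_trans)
    then have "z [^] j = \<one>" using eq z by simp
    then show ?thesis using 1 pow_eq_id[OF z(2)] oz by simp
  qed
  show ?thesis
    by (rule not_lie_zero_elementary_9[OF ab(1) b x(2) x_b z(2) z_def[symmetric] _ bx _ _ exp[OF x(1)] exp[OF zN] ind K])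
      (use cen[OF z(1)] ab b x in auto)
qed

text \<open>Elements \<open>a\<close>, \<open>b\<close> are needed such that
  \<open>x = cm a b\<close>, \<open>y = cm a x\<close>, \<open>z = cm a y\<close> descend through
  \<open>gamma_2\<close>, \<open>gamma_3\<close>, \<open>gamma_4\<close> one term at a time while
  \<open>b\<close> centralizes them. The element \<open>a\<close> is picked by its action on
  \<open>gamma_3\<close>; this determines enough of its action on \<open>N\<close>, because the
  actions of any two elements of \<open>G\<close> on the abelian group \<open>N\<close> commute.
  Finally \<open>b\<close> is corrected by powers of \<open>a\<close>.\<close>

lemma not_lie_zero_order_8_class_4:
  assumes pn: "p = 2" "n = 3" and nc: "\<not> derived_cyclic G" and c3: "card (lcs G 3) = 4" and c4: "card (lcs G 4) = 2"
    and K: "CHAR('k::field) = 2"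
  shows "\<not> lie_zero TYPE('k) G 6"
proof -
  let ?N = "lcs G 2" and ?M = "lcs G 3" and ?P = "lcs G 4"
  have N: "subgroup ?N G" and M: "subgroup ?M G" and P: "subgroup ?P G" by (rule lcs_subgroup)+
  have MN: "?M \<subseteq> ?N" and PM: "?P \<subseteq> ?M" using lcs_antimono[of 2 3] lcs_antimono[of 3 4] by simp_all
  have finM: "finite ?M" using fin_lcs by auto
  note M_sq = order_8_third_4(2)[OF pn nc c3 K] and N_comm = order_8_third_4(3)[OF pn nc c3 K]
  have idx: "card ?N = 2 * card ?M" and idx': "card ?M = 2 * card ?P" using card pn c3 c4 by simp_all
  have Nc: "u \<in> carrier G" if "u \<in> ?N" for u using lcs_carrier[OF that] .
  have P1: "?P \<noteq> {\<one>}" using c4 by auto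
  have P5: "lcs G 5 = {\<one>}"
  proof (rule lcs_eq_one_of_card)
    have "card (lcs G 5) < 2" using card_next_lt[of 4] P1 c4 by (simp add: eval_nat_numeral)
    moreover have "card (lcs G 5) > 0"
    proof -
      have "lcs G 5 \<noteq> {}" using one_in_lcs[of 5] by blast
      moreover have "finite (lcs G 5)" by (rule fin_lcs) simp
      ultimately show ?thesis by (simp add: card_gt_0_iff)
    qed
    ultimately show "card (lcs G 5) = 1" by simp
  qed
  have Pc: "h \<otimes> t = t \<otimes> h" if "t \<in> ?P" "h \<in> carrier G" for t h
    using central_of_next_trivial[of 4 t h] P5 that lcs_carrier[OF that(1)] by (simp add: eval_nat_numeral cm_eq_one_iff)
  have cmM: "cm h u \<in> ?M" if "u \<in> ?N" "h \<in> carrier G" for h u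
    using cm_in_lcs(2)[OF that] by (simp add: eval_nat_numeral)
  have cmP: "cm h u \<in> ?P" if "u \<in> ?M" "h \<in> carrier G" for h u
    using cm_in_lcs(2)[OF that] by (simp add: eval_nat_numeral)
  have conjN: "h \<otimes> u \<otimes> inv h \<in> ?N" if "u \<in> ?N" "h \<in> carrier G" for h u using lcs_conj[OF that] .
  \<comment> \<open>The commutator of \<open>g\<close> and \<open>h\<close> lies in the abelian
    group \<open>N\<close> and thus acts trivially on it.\<close>
  have act_comm: "g \<otimes> (h \<otimes> u \<otimes> inv h) \<otimes> inv g = h \<otimes> (g \<otimes> u \<otimes> inv g) \<otimes> inv h"
    if gh: "g \<in> carrier G" "h \<in> carrier G" and u: "u \<in> ?N" for g h u
  proof -
    let ?k = "cm g h" and ?v = "h \<otimes> (g \<otimes> u \<otimes> inv g) \<otimes> inv h"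
    have k: "?k \<in> ?N" and v: "?v \<in> ?N" using cm_in_derived gh conjN u by simp_all
    have "g \<otimes> (h \<otimes> u \<otimes> inv h) \<otimes> inv g = ?k \<otimes> ?v \<otimes> inv ?k"
      using gh Nc[OF u] by (simp add: cm_def word_simps)
    also have "\<dots> = ?v" using N_comm[OF k v] Nc[OF k] Nc[OF v] by (simp add: m_assoc)
    finally show ?thesis .
  qed
  have conj_P: "h \<otimes> t \<otimes> inv h = t" if "t \<in> ?P" "h \<in> carrier G" for t h
    using Pc[OF that] that lcs_carrier[OF that(1)] by (simp add: m_assoc)
  have conj_mult: "h \<otimes> (u \<otimes> v) \<otimes> inv h = (h \<otimes> u \<otimes> inv h) \<otimes> (h \<otimes> v \<otimes> inv h)"
    if "h \<in> carrier G" "u \<in> carrier G" "v \<in> carrier G" for h u v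
    using that by (simp add: m_assoc)
  have prodP: "u \<otimes> v \<in> ?P" if uv: "u \<in> ?M" "v \<in> ?M" "u \<notin> ?P" "v \<notin> ?P" for u v
  proof -
    obtain w where w: "w \<in> ?P" "v = u \<otimes> w"
      using index_two_cosets[OF P M PM finM idx' uv(1,3,2,4)] by blast
    have "u \<otimes> v = (u \<otimes> u) \<otimes> w" unfolding w(2) using lcs_carrier[OF uv(1)] lcs_carrier[OF w(1)] by (simp add: m_assoc)
    then show ?thesis using M_sq[OF uv(1)] w lcs_carrier[OF w(1)] by simp
  qed
  have "\<exists>m\<in>?M. \<exists>a\<in>carrier G. cm m a \<noteq> \<one>"
  proof (rule ccontr)
    assume "\<not> ?thesis"
    then have "lcs G (Suc 3) \<subseteq> {\<one>}" by (intro lcs_Suc_least triv_subgroup) auto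
    then show False using P1 one_in_lcs[of 4] by (auto simp: eval_nat_numeral)
  qed
  then obtain m a where ma: "m \<in> ?M" "a \<in> carrier G" "cm m a \<noteq> \<one>" by blast
  note a = ma(2)
  have am: "m \<otimes> a \<noteq> a \<otimes> m" using ma cm_eq_one_iff[OF lcs_carrier[OF ma(1)] a] by simp
  \<comment> \<open>As \<open>gamma_4\<close> is central of index 2 in \<open>gamma_3\<close>,
    commuting with one element of \<open>gamma_3\<close> outside \<open>gamma_4\<close> would mean
    centralizing all of \<open>gamma_3\<close>, including \<open>m\<close>.\<close>
  have A: "a \<otimes> u \<noteq> u \<otimes> a" if u: "u \<in> ?M" "u \<notin> ?P" for u
  proof
    assume au: "a \<otimes> u = u \<otimes> a"
    let ?C = "{g \<in> carrier G. \<forall>t\<in>{a}. g \<otimes> t = t \<otimes> g}"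
    have C: "subgroup ?C G" using a by (intro centralizer_subgroup) simp
    have CM: "subgroup (?C \<inter> ?M) G" using C M by (rule subgroups_Inter_pair)
    have "?C \<inter> ?M = ?M"
    proof (rule prime_index_eq[OF P CM M _ _ finM idx' two_is_prime_nat])
      show "?P \<subseteq> ?C \<inter> ?M" using PM Pc[OF _ a] lcs_carrier by auto
      show "u \<in> ?C \<inter> ?M" using u au lcs_carrier[OF u(1)] by simp
    qed (use u in auto)
    then have "m \<in> ?C" using ma(1) by blast
    then show False using am by simp
  qed
  have "\<exists>t\<in>?N. \<exists>d\<in>carrier G. cm t d \<notin> ?P"
  proof (rule ccontr)
    assume "\<not> ?thesis"
    then have "lcs G (Suc 2) \<subseteq> ?P" by (intro lcs_Suc_least P) auto
    then have "card ?M \<le> card ?P" using fin_lcs[of 4] by (intro card_mono) (auto simp: eval_nat_numeral)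
    then show False using c3 c4 by simp
  qed
  then obtain t d where td: "t \<in> ?N" "d \<in> carrier G" "cm t d \<notin> ?P" by blast
  have tG: "t \<in> carrier G" using Nc td by blast
  have sP: "cm d t \<notin> ?P"
  proof
    assume "cm d t \<in> ?P"
    then have "inv (cm d t) \<in> ?P" by (rule subgroup.m_inv_closed[OF P])
    then show False using td inv_cm[OF td(2) tG] by simp
  qed
  have tM: "t \<notin> ?M" using cmP[OF _ td(2)] sP by blast
  \<comment> \<open>Suppose \<open>a\<close> fixes \<open>t\<close> modulo \<open>gamma_4\<close>.
    Conjugating \<open>t\<close> by \<open>a\<close> and \<open>d\<close> in both orders then shows
    that \<open>a\<close> fixes \<open>s = cm d t\<close>, an element of \<open>gamma_3\<close>
    outside \<open>gamma_4\<close>, against \<open>A\<close>.\<close>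
  have rP: "cm a t \<notin> ?P"
  proof
    assume rP: "cm a t \<in> ?P"
    let ?r = "cm a t" and ?s = "cm d t"
    have sM: "?s \<in> ?M" using cmM td by blast
    have sG: "?s \<in> carrier G" and rG: "?r \<in> carrier G" using a td tG by auto
    have "a \<otimes> (?s \<otimes> t) \<otimes> inv a = d \<otimes> (?r \<otimes> t) \<otimes> inv d"
      using act_comm[OF a td(2,1)] conj_eq_cm[OF td(2) tG] conj_eq_cm[OF a tG] by simp
    then have "(a \<otimes> ?s \<otimes> inv a) \<otimes> (?r \<otimes> t) = ?r \<otimes> (?s \<otimes> t)"
      using conj_mult[OF a sG tG] conj_mult[OF td(2) rG tG] conj_P[OF rP td(2)] conj_eq_cm[OF td(2) tG] conj_eq_cm[OF a tG] by simp
    also have "\<dots> = ?s \<otimes> (?r \<otimes> t)" using Pc[OF rP sG] sG rG tG by (simp add: m_assoc[symmetric])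
    finally have "a \<otimes> ?s \<otimes> inv a = ?s" using a sG rG tG by (simp add: r_cancel)
    then have "a \<otimes> ?s = ?s \<otimes> a" using a sG by (metis inv_solve_right m_closed)
    then show False using A[OF sM sP] by simp
  qed
  have "\<exists>b\<in>carrier G. cm a b \<notin> ?M"
    using centralizes_mod_lcs[OF a _ td(1)] rP by blast
  then obtain b where b: "b \<in> carrier G" "cm a b \<notin> ?M" by blast
  define x where "x = cm a b"
  have x: "x \<in> ?N" "x \<notin> ?M" "x \<in> carrier G" using b a cm_in_derived by (auto simp: x_def)
  define y where "y = cm a x"
  have y: "y \<in> ?M" using cmM[OF x(1) a] by (simp add: y_def)
  have yG: "y \<in> carrier G" and yN: "y \<in> ?N" using y MN lcs_carrier by blast+
  \<comment> \<open>Outside \<open>gamma_3\<close> there is a single coset of \<open>gamma_3\<close>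
    in \<open>N\<close>, so \<open>x\<close> and \<open>t\<close> differ by an element of
    \<open>gamma_3\<close>, and \<open>a\<close> moves both by the same amount modulo
    \<open>gamma_4\<close>.\<close>
  have yP: "y \<notin> ?P"
  proof
    assume yP: "y \<in> ?P"
    obtain m' where m': "m' \<in> ?M" "x = t \<otimes> m'" using index_two_cosets[OF M N MN fin idx td(1) tM x(1,2)] by blast
    have m'G: "m' \<in> carrier G" using lcs_carrier[OF m'(1)] .
    let ?q = "t \<otimes> cm a m' \<otimes> inv t"
    have q: "?q \<in> ?P" using cmP[OF m'(1) a] lcs_conj tG by blast
    have qG: "?q \<in> carrier G" using lcs_carrier[OF q] .
    have "y = cm a t \<otimes> ?q" using cm_mult_right[OF a tG m'G] m'(2) by (simp add: y_def)
    then have "cm a t = y \<otimes> inv ?q" using a tG qG by (simp add: m_assoc)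
    then show False using rP subgroup.m_closed[OF P yP subgroup.m_inv_closed[OF P q]] by simp
  qed
  define z where "z = cm a y"
  have z: "z \<in> ?P" using cmP[OF y a] by (simp add: z_def)
  have zG: "z \<in> carrier G" and zM: "z \<in> ?M" using z PM lcs_carrier by blast+
  have z1: "z \<noteq> \<one>" using A[OF y yP] cm_eq_one_iff[OF a yG] by (simp add: z_def)
  have P_eq: "?P = {\<one>, z}"
    using z z1 one_in_lcs[of 4] c4 fin_lcs[of 4] by (intro card_subset_eq[symmetric]) auto
  have ax: "a \<otimes> x \<otimes> inv a = y \<otimes> x" using conj_eq_cm[OF a x(3)] by (simp add: y_def)
  have ay: "a \<otimes> y \<otimes> inv a = z \<otimes> y" using conj_eq_cm[OF a yG] by (simp add: z_def)
  \<comment> \<open>Modulo \<open>gamma_4\<close>, which has index 2 in \<open>gamma_3\<close>,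
    \<open>b\<close> moves \<open>x\<close> either not at all or in the same way as
    \<open>a\<close>. In the second case \<open>b a\<close> does not move it, and
    \<open>cm a (b a) = cm a b\<close>.\<close>
  have "\<exists>b\<in>carrier G. cm a b = x \<and> cm b x \<in> ?P"
  proof (cases "cm b x \<in> ?P")
    case True
    then show ?thesis using b by (auto simp: x_def)
  next
    case False
    have "cm (b \<otimes> a) x = (b \<otimes> y \<otimes> inv b) \<otimes> cm b x"
      using cm_mult_left[OF b(1) a x(3)] by (simp add: y_def)
    moreover have "b \<otimes> y \<otimes> inv b \<notin> ?P"
    proof
      assume "b \<otimes> y \<otimes> inv b \<in> ?P"
      from lcs_conj[OF this inv_closed[OF b(1)]]
      have "inv b \<otimes> (b \<otimes> y \<otimes> inv b) \<otimes> inv (inv b) \<in> ?P" .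
      then show False using yP b yG by (simp add: m_assoc)
    qed
    ultimately have "cm (b \<otimes> a) x \<in> ?P"
      using prodP[OF lcs_conj[OF y b(1)] cmM[OF x(1) b(1)] _ False] by simp
    moreover have "cm a (b \<otimes> a) = x" using cm_mult_right[OF a b(1) a] a b by (simp add: x_def)
    ultimately show ?thesis using a b by (intro bexI[of _ "b \<otimes> a"]) auto
  qed
  then obtain b1 where b1: "b1 \<in> carrier G" "cm a b1 = x" "cm b1 x \<in> ?P" by blast
  let ?q = "cm b1 x"
  have qG: "?q \<in> carrier G" using lcs_carrier[OF b1(3)] .
  have b1x: "b1 \<otimes> x \<otimes> inv b1 = ?q \<otimes> x" using conj_eq_cm[OF b1(1) x(3)] .
  \<comment> \<open>The actions of \<open>b1\<close> and \<open>a\<close> on \<open>x\<close>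
    commute, and \<open>b1\<close> changes \<open>x\<close> only by a central factor; comparing the
    two orders leaves \<open>y\<close> fixed.\<close>
  have b1y: "b1 \<otimes> y \<otimes> inv b1 = y"
  proof -
    have "a \<otimes> (?q \<otimes> x) \<otimes> inv a = b1 \<otimes> (y \<otimes> x) \<otimes> inv b1"
      using act_comm[OF a b1(1) x(1)] b1x ax by simp
    then have "?q \<otimes> (y \<otimes> x) = (b1 \<otimes> y \<otimes> inv b1) \<otimes> (?q \<otimes> x)"
      using conj_mult[OF a qG x(3)] conj_mult[OF b1(1) yG x(3)] conj_P[OF b1(3) a] ax b1x by simp
    moreover have "?q \<otimes> (y \<otimes> x) = y \<otimes> (?q \<otimes> x)" using Pc[OF b1(3) yG] qG yG x(3) by (simp add: m_assoc[symmetric])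
    ultimately have "y \<otimes> (?q \<otimes> x) = (b1 \<otimes> y \<otimes> inv b1) \<otimes> (?q \<otimes> x)" by simp
    then show ?thesis using b1(1) yG qG x(3) by simp
  qed
  have "\<exists>b\<in>carrier G. cm a b = x \<and> b \<otimes> x = x \<otimes> b \<and> b \<otimes> y = y \<otimes> b"
  proof (cases "?q = \<one>")
    case True
    have "b1 \<otimes> y = y \<otimes> b1" using b1y b1(1) yG by (metis inv_solve_right m_closed)
    then show ?thesis using b1 True cm_eq_one_iff[OF b1(1) x(3)] by auto
  next
    case False
    then have qz: "?q = z" using b1(3) P_eq by auto
    have z2: "z \<otimes> z = \<one>" using M_sq[OF zM] .
    \<comment> \<open>Conjugation by \<open>a^2\<close> sends \<open>x\<close> to \<open>z x\<close>
      and fixes \<open>y\<close>, so the factor \<open>a^2\<close> cancels the remaining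
      \<open>z\<close> without disturbing anything else.\<close>
    let ?aa = "a \<otimes> a"
    let ?b = "b1 \<otimes> ?aa"
    have bG: "?b \<in> carrier G" using a b1 by simp
    have az: "a \<otimes> z \<otimes> inv a = z" and bz: "b1 \<otimes> z \<otimes> inv b1 = z" using conj_P[OF z] a b1 by auto
    have two_step: "?b \<otimes> u \<otimes> inv ?b = b1 \<otimes> (a \<otimes> (a \<otimes> u \<otimes> inv a) \<otimes> inv a) \<otimes> inv b1" if "u \<in> carrier G" for u
      using that a b1 by (simp add: word_simps)
    have "a \<otimes> (a \<otimes> x \<otimes> inv a) \<otimes> inv a = (z \<otimes> y) \<otimes> (y \<otimes> x)"
      using conj_mult[OF a yG x(3)] ax ay by simp
    also have "\<dots> = z \<otimes> ((y \<otimes> y) \<otimes> x)" using zG yG x(3) by (simp add: m_assoc)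
    also have "\<dots> = z \<otimes> x" using M_sq[OF y] x(3) by simp
    finally have "?b \<otimes> x \<otimes> inv ?b = z \<otimes> (z \<otimes> x)"
      using two_step[OF x(3)] conj_mult[OF b1(1) zG x(3)] bz b1x qz by simp
    also have "\<dots> = x" using z2 zG x(3) by (simp add: m_assoc[symmetric])
    finally have bx: "?b \<otimes> x = x \<otimes> ?b" using bG x(3) by (metis inv_solve_right m_closed)
    have "a \<otimes> (a \<otimes> y \<otimes> inv a) \<otimes> inv a = z \<otimes> (z \<otimes> y)"
      using conj_mult[OF a zG yG] ay az by simp
    also have "\<dots> = y" using z2 zG yG by (simp add: m_assoc[symmetric])
    finally have "?b \<otimes> y \<otimes> inv ?b = y" using two_step[OF yG] b1y by simp
    then have "?b \<otimes> y = y \<otimes> ?b" using bG yG by (metis inv_solve_right m_closed)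
    moreover have "cm a ?b = x"
    proof -
      have "cm a ?aa = \<one>" using cm_eq_one_iff[OF a, of ?aa] a by (simp add: m_assoc)
      then show ?thesis using cm_mult_right[OF a b1(1), of ?aa] a b1 x(3) by simp
    qed
    ultimately show ?thesis using bx bG by blast
  qed
  then obtain b' where b': "b' \<in> carrier G" "cm a b' = x" "b' \<otimes> x = x \<otimes> b'" "b' \<otimes> y = y \<otimes> b'" by blast
  \<comment> \<open>The square \<open>x^2\<close> lies in \<open>gamma_3\<close> and commutes with
    \<open>a\<close>; by \<open>A\<close> this confines it to \<open>gamma_4\<close>.\<close>
  have xx: "x \<otimes> x \<in> {\<one>, z}"
  proof -
    have m: "x \<otimes> x \<in> ?M" using index_two_square[OF M N MN fin idx x(1)] .
    have "a \<otimes> (x \<otimes> x) \<otimes> inv a = y \<otimes> (x \<otimes> y) \<otimes> x"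
      using conj_mult[OF a x(3) x(3)] ax yG x(3) by (simp add: m_assoc)
    also have "x \<otimes> y = y \<otimes> x" using N_comm[OF x(1) yN] .
    also have "y \<otimes> (y \<otimes> x) \<otimes> x = (y \<otimes> y) \<otimes> (x \<otimes> x)" using yG x(3) by (simp add: m_assoc)
    also have "\<dots> = x \<otimes> x" using M_sq[OF y] x(3) by simp
    finally have "a \<otimes> (x \<otimes> x) = (x \<otimes> x) \<otimes> a" using a x(3) by (metis inv_solve_right m_closed)
    then have "x \<otimes> x \<in> ?P" using A[OF m] by blast
    then show ?thesis using P_eq by simp
  qed
  have x_ne: "x \<notin> {\<one>, y, z, y \<otimes> z}"
    using x(2) y zM subgroup.m_closed[OF M y zM] one_in_lcs[of 3] by auto
  have zN: "z \<in> ?N" using zM MN by blast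
  show ?thesis
    by (rule not_lie_zero_order_8[OF a b'(1) x(3) b'(2) yG y_def[symmetric] zG z_def[symmetric]
        Pc[OF z a] b'(3,4) Pc[OF z b'(1)] N_comm[OF x(1) yN] N_comm[OF x(1) zN] N_comm[OF yN zN]
        xx M_sq[OF y] M_sq[OF zM] z1 _ x_ne K]) (use yP P_eq in simp)
qed

end

section \<open>The characterisation\<close>
context group
begin

lemma derived_cyclic_iff: "derived_cyclic G \<longleftrightarrow> cyclic_group (G\<lparr>carrier := lcs G 2\<rparr>)"
proof -
  let ?N = "lcs G 2"
  have N: "subgroup ?N G" by (rule lcs_subgroup)
  interpret N: group "G\<lparr>carrier := ?N\<rparr>" by (rule subgroup_imp_group[OF N])
  have gen: "generate G {y} = range (\<lambda>k::int. y [^]\<^bsub>G\<lparr>carrier := ?N\<rparr>\<^esub> k)" if "y \<in> ?N" for y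
    using generate_pow[OF lcs_carrier[OF that]] int_pow_consistent[OF N that] by auto
  have "derived_cyclic G \<longleftrightarrow> (\<exists>y\<in>?N. ?N = generate G {y})"
    unfolding derived_cyclic_def using lcs_carrier generate.incl[of _ "{_}" G] by blast
  also have "\<dots> \<longleftrightarrow> cyclic_group (G\<lparr>carrier := ?N\<rparr>)"
    unfolding N.cyclic_group using gen by simp
  finally show ?thesis .
qed

text \<open>The pair \<open>(i, j)\<close> is sent to \<open>x^i y^j\<close>. Injectivity holds
  because \<open>y\<close> is not a power of \<open>x\<close>, and surjectivity follows by
  counting.\<close>

lemma iso_cyclic_times_two:
  assumes H: "subgroup H G" "finite H" and xy: "x \<in> H" "y \<in> H" and m: "ord x = m" "card H = 2 * m" "0 < m"
    and y: "y \<notin> generate G {x}" "y \<otimes> y = \<one>" "x \<otimes> y = y \<otimes> x"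
  shows "G\<lparr>carrier := H\<rparr> \<cong> integer_mod_group m \<times>\<times> integer_mod_group 2"
proof -
  let ?Z = "integer_mod_group m \<times>\<times> integer_mod_group 2"
  have c: "x \<in> carrier G" "y \<in> carrier G" using xy subgroup.mem_carrier[OF H(1)] by auto
  have yx: "y [^] (j::nat) \<otimes> x [^] (i::nat) = x [^] i \<otimes> y [^] j" for i j
    using c y(3) by (metis group_commutes_pow nat_pow_closed)
  define f where "f = (\<lambda>(i, j). x [^] nat i \<otimes> y [^] nat j)"
  have carr: "carrier ?Z = {0..<int m} \<times> {0..<2}" using m by (simp add: carrier_integer_mod_group)
  have gx: "x [^] (i::nat) \<in> generate G {x}" for i
    using nat_pow_in_subgroup[OF generate_is_subgroup[of "{x}"]] generate.incl[of x "{x}" G] c by simp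
  have y2: "y [^] (j mod 2) = y [^] (j::nat)" for j
  proof -
    have "y [^] j = (y [^] (2::nat)) [^] (j div 2) \<otimes> y [^] (j mod 2)"
      using c by (simp only: nat_pow_mult nat_pow_pow nat_pow_closed) simp
    then show ?thesis using y(2) c by (simp add: numeral_2_eq_2)
  qed
  have hom: "f \<in> hom ?Z (G\<lparr>carrier := H\<rparr>)"
  proof (rule homI)
    fix p assume "p \<in> carrier ?Z"
    then show "f p \<in> carrier (G\<lparr>carrier := H\<rparr>)"
      using nat_pow_in_subgroup[OF H(1) xy(1)] nat_pow_in_subgroup[OF H(1) xy(2)] subgroup.m_closed[OF H(1)]
      by (auto simp: f_def split: prod.splits)
  next
    fix p q assume pq: "p \<in> carrier ?Z" "q \<in> carrier ?Z"
    obtain i j i' j' where ij: "p = (i, j)" "q = (i', j')" by (cases p; cases q)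
    have r: "0 \<le> i" "0 \<le> j" "0 \<le> i'" "0 \<le> j'" using pq unfolding carr ij by auto
    have n1: "nat ((i + i') mod int m) = (nat i + nat i') mod m"
      using r m by (simp add: nat_mod_distrib nat_add_distrib)
    have n2: "nat ((j + j') mod 2) = (nat j + nat j') mod 2"
      using r by (simp add: nat_mod_distrib nat_add_distrib)
    have "f (p \<otimes>\<^bsub>?Z\<^esub> q) = x [^] ((nat i + nat i') mod m) \<otimes> y [^] ((nat j + nat j') mod 2)"
      by (simp add: f_def ij DirProd_def n1 n2)
    also have "\<dots> = x [^] (nat i + nat i') \<otimes> y [^] (nat j + nat j')"
      using pow_mod_ord[OF c(1)] m(1) y2 by simp
    also have "\<dots> = x [^] nat i \<otimes> (x [^] nat i' \<otimes> y [^] nat j) \<otimes> y [^] nat j'"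
      using c by (simp add: nat_pow_mult[symmetric] m_assoc)
    also have "\<dots> = f p \<otimes> f q"
      unfolding yx[symmetric] using c by (simp add: f_def ij m_assoc)
    finally show "f (p \<otimes>\<^bsub>?Z\<^esub> q) = f p \<otimes>\<^bsub>G\<lparr>carrier := H\<rparr>\<^esub> f q" by simp
  qed
  have inj: "inj_on f (carrier ?Z)"
  proof (rule inj_onI)
    fix p q assume pq: "p \<in> carrier ?Z" "q \<in> carrier ?Z" and eq: "f p = f q"
    obtain i j i' j' where ij: "p = (i, j)" "q = (i', j')" by (cases p; cases q)
    have r: "0 \<le> i" "i < int m" "0 \<le> i'" "i' < int m" "j = 0 \<or> j = 1" "j' = 0 \<or> j' = 1"
      using pq unfolding carr ij by auto
    have no: "x [^] (k::nat) \<noteq> x [^] (l::nat) \<otimes> y" for k l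
    proof
      assume "x [^] k = x [^] l \<otimes> y"
      then have "y = inv (x [^] l) \<otimes> x [^] k" using c by simp
      moreover have "inv (x [^] l) \<otimes> x [^] k \<in> generate G {x}"
        using gx c by (intro subgroup.m_closed subgroup.m_inv_closed generate_is_subgroup) auto
      ultimately show False using y(1) by simp
    qed
    have e: "x [^] nat i \<otimes> y [^] nat j = x [^] nat i' \<otimes> y [^] nat j'" using eq by (simp add: f_def ij)
    have "j = j'"
      using r(5,6) e no[of "nat i" "nat i'"] no[of "nat i'" "nat i"] c by auto
    moreover from this have "x [^] nat i = x [^] nat i'" using e c by simp
    then have "nat i = nat i'"
      using ord_inj[OF c(1)] r m by (auto simp: inj_on_def nat_less_iff)
    then have "i = i'" using r by simp
    ultimately show "p = q" using ij by simp
  qed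
  have "f ` carrier ?Z \<subseteq> H" using hom by (auto simp: hom_def)
  moreover have "card (f ` carrier ?Z) = card H"
    using card_image[OF inj] m by (simp add: card_cartesian_product carrier_integer_mod_group)
  ultimately have "f ` carrier ?Z = H" using H(2) by (intro card_subset_eq) auto
  then have "f \<in> iso ?Z (G\<lparr>carrier := H\<rparr>)" using hom inj by (simp add: iso_iff)
  then have "?Z \<cong> G\<lparr>carrier := H\<rparr>" unfolding is_iso_def by blast
  then show ?thesis by (rule group.iso_sym[OF DirProd_group[OF group_integer_mod_group group_integer_mod_group]])
qed

lemma iso_klein_four_square:
  assumes H: "subgroup H G" and iso: "G\<lparr>carrier := H\<rparr> \<cong> integer_mod_group 2 \<times>\<times> integer_mod_group 2"
    and t: "t \<in> H"
  shows "t \<otimes> t = \<one>"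
proof -
  let ?Z = "integer_mod_group 2 \<times>\<times> integer_mod_group 2"
  obtain h where h: "h \<in> hom (G\<lparr>carrier := H\<rparr>) ?Z" "inj_on h H" "h ` H = carrier ?Z"
    using iso unfolding is_iso_def by (auto simp: iso_iff)
  have m: "h (a \<otimes> b) = h a \<otimes>\<^bsub>?Z\<^esub> h b" if "a \<in> H" "b \<in> H" for a b
    using h(1) that by (simp add: hom_def)
  have sq: "u \<otimes>\<^bsub>?Z\<^esub> u = (0, 0)" for u
    by (cases u) (simp add: DirProd_def)
  have one: "\<one> \<in> H" using subgroup.one_closed[OF H] .
  have "h (t \<otimes> t) = h (\<one> \<otimes> \<one>)" unfolding m[OF t t] m[OF one one] sq ..
  moreover have "\<one> \<otimes> \<one> = \<one>" by simp
  ultimately have "h (t \<otimes> t) = h \<one>" by (simp only:)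
  then show ?thesis using h(2) subgroup.m_closed[OF H t t] one by (auto simp: inj_on_def)
qed

lemma elementary_abelian_subgroup_iff:
  assumes H: "subgroup H G"
  shows "elementary_abelian (G\<lparr>carrier := H\<rparr>) p \<longleftrightarrow>
    (\<forall>a\<in>H. \<forall>b\<in>H. a \<otimes> b = b \<otimes> a) \<and> (\<forall>a\<in>H. a [^] p = \<one>)"
proof -
  interpret H: group "G\<lparr>carrier := H\<rparr>" by (rule subgroup_imp_group[OF H])
  have "comm_group (G\<lparr>carrier := H\<rparr>) \<longleftrightarrow> (\<forall>a\<in>H. \<forall>b\<in>H. a \<otimes> b = b \<otimes> a)"
  proof
    assume "comm_group (G\<lparr>carrier := H\<rparr>)"
    then interpret C: comm_group "G\<lparr>carrier := H\<rparr>" .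
    show "\<forall>a\<in>H. \<forall>b\<in>H. a \<otimes> b = b \<otimes> a" using C.m_comm by simp
  next
    assume "\<forall>a\<in>H. \<forall>b\<in>H. a \<otimes> b = b \<otimes> a"
    then show "comm_group (G\<lparr>carrier := H\<rparr>)" by (intro H.group_comm_groupI) simp
  qed
  then show ?thesis
    unfolding elementary_abelian_def by (simp add: nat_pow_consistent[symmetric])
qed

end

context p_derived
begin

text \<open>The minimum in \<open>nilpotency_class\<close> is attained because the series
  terminates; the terms descend, so one trivial term with a nontrivial predecessor identifies
  it.\<close>

lemma nilpotency_class_eq_iff:
  assumes "1 \<le> c"
  shows "nilpotency_class G = c \<longleftrightarrow> lcs G (Suc c) = {\<one>} \<and> lcs G c \<noteq> {\<one>}"
proof
  assume c: "nilpotency_class G = c"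
  obtain k where "lcs G (Suc k) = {\<one>}" using terminates by blast
  then have "lcs G (Suc c) = {\<one>}"
    using LeastI[of "\<lambda>c. lcs G (Suc c) = {\<one>}"] c unfolding nilpotency_class_def by blast
  moreover have "lcs G (Suc (c - 1)) \<noteq> {\<one>}"
    using not_less_Least[of "c - 1" "\<lambda>c. lcs G (Suc c) = {\<one>}"] c assms unfolding nilpotency_class_def by simp
  ultimately show "lcs G (Suc c) = {\<one>} \<and> lcs G c \<noteq> {\<one>}" using assms by simp
next
  assume c: "lcs G (Suc c) = {\<one>} \<and> lcs G c \<noteq> {\<one>}"
  show "nilpotency_class G = c"
    unfolding nilpotency_class_def
  proof (rule Least_equality)
    fix d assume "lcs G (Suc d) = {\<one>}"
    then show "c \<le> d" using c lcs_trivial_above[of "Suc d" c] by (metis not_less_eq_eq)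
  qed (use c in blast)
qed

lemma not_cyclic_if_exponent:
  assumes "\<And>t. t \<in> lcs G 2 \<Longrightarrow> t [^] m = \<one>" "0 < m" "m < card (lcs G 2)"
  shows "\<not> derived_cyclic G"
proof
  assume "derived_cyclic G"
  then obtain y where y: "y \<in> carrier G" "lcs G 2 = generate G {y}" unfolding derived_cyclic_def by blast
  then have "y [^] m = \<one>" using assms(1) generate.incl[of y "{y}" G] by simp
  then have "card (lcs G 2) dvd m" using pow_eq_id[OF y(1)] generate_pow_card[OF y(1)] y(2) by simp
  then show False using assms(2,3) dvd_imp_le by fastforce
qed

lemma cyclic_if_prime_order:
  assumes "n = 1"
  shows "derived_cyclic G"
proof -
  have "card (lcs G 2) = p" using card assms by simp
  then have "card (lcs G 2) > 1" using p_gt_1 by simp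
  then have "lcs G 2 \<noteq> {\<one>}" by auto
  then obtain z where z: "z \<in> lcs G 2" "ord z = p" using central_element[OF lcs_subgroup lcs_conj] by blast
  have zG: "z \<in> carrier G" using lcs_carrier z by blast
  have "generate G {z} = lcs G 2"
    using generate_pow_card[OF zG] z card assms fin zG
    by (intro subgroup_eq_of_card generate_is_subgroup generate_subset_subgroup[OF lcs_subgroup]) auto
  then show ?thesis using zG unfolding derived_cyclic_def by metis
qed

text \<open>The orders of the second, third and fourth term are strictly decreasing powers of 2 that
  start with 8 and stay above 1.\<close>

lemma order_8_class_4_cards:
  assumes pn: "p = 2" "n = 3" and l4: "lcs G 4 \<noteq> {\<one>}"
  shows "card (lcs G 3) = 4" "card (lcs G 4) = 2"
proof -
  have l32: "lcs G 3 \<noteq> {\<one>}" "lcs G 2 \<noteq> {\<one>}"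
    using l4 lcs_trivial_above[of 3 4] lcs_trivial_above[of 2 4] by auto
  obtain i where i: "card (lcs G 3) = 2 ^ i" using card_lcs[of 3] pn by auto
  obtain j where j: "card (lcs G 4) = 2 ^ j" using card_lcs[of 4] pn by auto
  have "(2::nat) ^ i < 2 ^ 3" using card_next_lt[OF _ l32(2)] i card pn by (simp add: eval_nat_numeral)
  then have i3: "i < 3" by (rule power_less_imp_less_exp[rotated]) simp
  have "(2::nat) ^ j < 2 ^ i" using card_next_lt[OF _ l32(1)] i j by (simp add: eval_nat_numeral)
  then have ji: "j < i" by (rule power_less_imp_less_exp[rotated]) simp
  have "j \<noteq> 0" using card_gt_one[OF l4] j by (auto intro: gr0I)
  then have "i = 2" "j = 1" using i3 ji by linarith+
  then show "card (lcs G 3) = 4" "card (lcs G 4) = 2" using i j by simp_all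
qed

text \<open>The left side says that \<open>p^n - p + 1\<close> is the least number of steps, phrased
  through two values of the monotone predicate \<open>lie_zero\<close>. The condition
  \<open>1 \<le> n\<close> makes the truncated subtraction exact.\<close>

theorem gap_iff:
  assumes K: "CHAR('k::field) = p"
  shows "1 \<le> n \<and> lie_zero TYPE('k) G (p ^ n - p + 1) \<and> \<not> lie_zero TYPE('k) G (p ^ n - p) \<longleftrightarrow>
     ((p = 2 \<and> nilpotency_class G = 2 \<and> card (lcs G 2) = 4
         \<and> \<not> cyclic_group (G\<lparr>carrier := lcs G 2\<rparr>))
    \<or> (p = 2 \<and> nilpotency_class G = 4
         \<and> G\<lparr>carrier := lcs G 2\<rparr> \<cong> integer_mod_group 4 \<times>\<times> integer_mod_group 2
         \<and> G\<lparr>carrier := lcs G 3\<rparr> \<cong> integer_mod_group 2 \<times>\<times> integer_mod_group 2)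
    \<or> (p = 2 \<and> nilpotency_class G = 4 \<and> card (lcs G 2) = 8
         \<and> elementary_abelian (G\<lparr>carrier := lcs G 2\<rparr>) 2)
    \<or> (p = 3 \<and> nilpotency_class G = 3 \<and> card (lcs G 2) = 9
         \<and> elementary_abelian (G\<lparr>carrier := lcs G 2\<rparr>) 3))" (is "?L \<longleftrightarrow> ?R")
proof
  assume L: ?L
  then have n1: "1 \<le> n" and hi: "lie_zero TYPE('k) G (p ^ n - p + 1)" and lo: "\<not> lie_zero TYPE('k) G (p ^ n - p)" by auto
  have pn_ge: "p \<le> p ^ n" using self_le_power[of p n] p_gt_1 n1 by simp
  \<comment> \<open>For cyclic \<open>N\<close>, \<open>p^n - 1\<close> steps do not suffice, and
    this is at least \<open>p^n - p + 1\<close>.\<close>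
  have nc: "\<not> derived_cyclic G"
  proof
    assume "derived_cyclic G"
    then obtain y where y: "y \<in> carrier G" "lcs G 2 = generate G {y}" unfolding derived_cyclic_def by blast
    have "\<not> lie_zero TYPE('k) G (p ^ n - 1)" using not_lie_zero_cyclic[OF fin pc p card y] n1 by simp
    moreover have "p ^ n - p + 1 \<le> p ^ n - 1" using pn_ge p_gt_1 by linarith
    ultimately show False using lie_zero_mono[OF hi] by blast
  qed
  have "n \<noteq> 1" using cyclic_if_prime_order nc by blast
  then consider "n = 2" | "3 \<le> n" using n1 by linarith
  then show ?R
  proof cases
    case 1
    show ?thesis
    proof (cases "lcs G 3 = {\<one>}")
      case True
      have lz: "lie_zero TYPE('k) G (2 * p - 1)" by (rule lie_zero_square_class_2[OF 1 nc True K])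
      have "p = 2"
      proof (rule ccontr)
        assume "p \<noteq> 2"
        then have p3: "3 \<le> p" using p_gt_1 by linarith
        have "3 * p \<le> p * p" using p3 by (rule mult_right_mono) simp
        moreover have "p ^ n = p * p" using 1 by (simp add: power2_eq_square)
        ultimately have "2 * p - 1 \<le> p ^ n - p" by linarith
        then show False using lo lie_zero_mono[OF lz] by blast
      qed
      moreover have "lcs G 2 \<noteq> {\<one>}" using card 1 one_less_power[OF p_gt_1, of 2] by auto
      then have "nilpotency_class G = 2" using nilpotency_class_eq_iff[of 2] True by (simp add: eval_nat_numeral)
      moreover have "card (lcs G 2) = 4" using card 1 \<open>p = 2\<close> by simp
      ultimately show ?thesis using nc derived_cyclic_iff by blast
    next
      case False
      have l4: "lcs G 4 = {\<one>}" by (rule square_third_term(2)[OF 1 nc False])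
      have cen: "h \<otimes> t = t \<otimes> h" if "t \<in> lcs G 3" "h \<in> carrier G" for t h
        using central_of_next_trivial[of 3 t h] l4 that lcs_carrier[OF that(1)] by (simp add: eval_nat_numeral cm_eq_one_iff)
      have Nc: "a \<otimes> b = b \<otimes> a" if ab: "a \<in> lcs G 2" "b \<in> lcs G 2" for a b
      proof (rule derived_centralizes[OF lcs_carrier[OF ab(2)] _ ab(1)])
        fix g h assume "g \<in> carrier G" "h \<in> carrier G"
        then show "h \<otimes> cm g b = cm g b \<otimes> h"
          using cm_in_lcs(2)[OF ab(2)] by (intro cen) (simp_all add: eval_nat_numeral)
      qed
      have lz: "lie_zero TYPE('k) G (3 * p - 2)" by (rule lie_zero_square_class_3[OF 1 nc False K])
      have "p \<noteq> 2"
      proof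
        assume "p = 2"
        then show False using not_lie_zero_square_class_3_two[OF _ 1 nc False, where ?'k = 'k] hi 1 by simp
      qed
      moreover have "p < 4"
      proof (rule ccontr)
        assume "\<not> p < 4"
        then have p4: "4 \<le> p" by simp
        have "4 * p \<le> p * p" using p4 by (rule mult_right_mono) simp
        moreover have "p ^ n = p * p" using 1 by (simp add: power2_eq_square)
        ultimately have "3 * p - 2 \<le> p ^ n - p" by linarith
        then show False using lo lie_zero_mono[OF lz] by blast
      qed
      ultimately have p3: "p = 3" using p_gt_1 by linarith
      have "nilpotency_class G = 3" using nilpotency_class_eq_iff[of 3] False l4 by (simp add: eval_nat_numeral)
      moreover have "card (lcs G 2) = 9" using card 1 p3 by simp
      moreover have "elementary_abelian (G\<lparr>carrier := lcs G 2\<rparr>) 3"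
        using elementary_abelian_subgroup_iff[OF lcs_subgroup] Nc exponent_of_noncyclic_square[OF 1 nc] p3 by blast
      ultimately show ?thesis using p3 by blast
    qed
  next
    case 2
    \<comment> \<open>Only \<open>p = 2\<close>, \<open>n = 3\<close> escapes the sharper general
      bound; there 6 steps fail, which by \<open>order_8_cases\<close> fixes the orders of
      \<open>gamma_3\<close> and \<open>gamma_4\<close>.\<close>
    have pn: "p = 2" "n = 3" using lie_zero_noncyclic_large[OF p_derived_axioms 2 nc K] lo by auto
    have K2: "CHAR('k) = 2" using K pn by simp
    have "\<not> lie_zero TYPE('k) G 6" using lo pn by simp
    then have c: "card (lcs G 3) = 4" "card (lcs G 4) = 2" using order_8_cases[OF pn nc K2] by auto
    note M_sq = order_8_third_4(2)[OF pn nc c(1) K2] and N_comm = order_8_third_4(3)[OF pn nc c(1) K2]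
    have l4: "lcs G 4 \<noteq> {\<one>}" using c by auto
    have "lcs G 5 = {\<one>}"
    proof (rule ccontr)
      assume "lcs G 5 \<noteq> {\<one>}"
      then have "card (lcs G 5) > 1" using card_gt_one by simp
      moreover have "card (lcs G 5) < 2" using card_next_lt[of 4] l4 c by (simp add: eval_nat_numeral)
      ultimately show False by simp
    qed
    then have cl: "nilpotency_class G = 4" using nilpotency_class_eq_iff[of 4] l4 by (simp add: eval_nat_numeral)
    have cN: "card (lcs G 2) = 8" using card pn by simp
    have N: "subgroup (lcs G 2) G" and M: "subgroup (lcs G 3) G" by (rule lcs_subgroup)+
    have MN: "lcs G 3 \<subseteq> lcs G 2" using lcs_antimono[of 2 3] by simp
    have pw: "t [^] (2::nat) = t \<otimes> t" if "t \<in> carrier G" for t using that by (simp add: numeral_2_eq_2)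
    show ?thesis
    proof (cases "\<forall>t\<in>lcs G 2. t \<otimes> t = \<one>")
      case True
      then have "elementary_abelian (G\<lparr>carrier := lcs G 2\<rparr>) 2"
        unfolding elementary_abelian_subgroup_iff[OF N] using N_comm pw lcs_carrier by metis
      then show ?thesis using pn cl cN by blast
    next
      case False
      then obtain x where x: "x \<in> lcs G 2" "x \<otimes> x \<noteq> \<one>" by blast
      have xG: "x \<in> carrier G" using lcs_carrier x by blast
      have "x [^] (4::nat) = \<one>" using order_8_pow_4[OF pn nc x(1)] xG by (simp add: eval_nat_numeral m_assoc)
      then have "ord x dvd 2 ^ 2" using pow_eq_id[OF xG] by simp
      then obtain k where k: "k \<le> 2" "ord x = 2 ^ k" using divides_primepow_nat[OF two_is_prime_nat] by blast
      have "\<not> ord x dvd 2" using pow_eq_id[OF xG, of 2] pw[OF xG] x by simp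
      then have "k = 2" using k by (cases k rule: nat.exhaust) (auto simp: le_Suc_eq numeral_2_eq_2)
      then have ox: "ord x = 4" using k by simp
      have xM: "x \<notin> lcs G 3" using M_sq x by blast
      \<comment> \<open>\<open>x\<close> has order 4 and lies outside \<open>gamma_3\<close>, which
        also has order 4. So \<open>gamma_3\<close> is not contained in \<open><x>\<close> and
        supplies an involution outside \<open><x>\<close>.\<close>
      have "\<not> lcs G 3 \<subseteq> generate G {x}"
      proof
        assume "lcs G 3 \<subseteq> generate G {x}"
        then have "lcs G 3 = generate G {x}"
          using c generate_pow_card[OF xG] ox by (intro card_subset_eq) (auto intro: card_ge_0_finite)
        then show False using xM generate.incl[of x "{x}" G] by simp
      qed
      then obtain y where y: "y \<in> lcs G 3" "y \<notin> generate G {x}" by blast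
      have yN: "y \<in> lcs G 2" using y MN by blast
      have iso1: "G\<lparr>carrier := lcs G 2\<rparr> \<cong> integer_mod_group 4 \<times>\<times> integer_mod_group 2"
        by (rule iso_cyclic_times_two[OF N fin x(1) yN ox _ _ y(2) M_sq[OF y(1)] N_comm[OF x(1) yN]]) (simp_all add: cN)
      have "lcs G 3 \<noteq> {\<one>}" using c by auto
      then obtain u where u: "u \<in> lcs G 3" "u \<noteq> \<one>" using one_in_lcs[of 3] by blast
      have uG: "u \<in> carrier G" using lcs_carrier u by blast
      have "ord u dvd 2" using pow_eq_id[OF uG, of 2] pw[OF uG] M_sq[OF u(1)] by simp
      moreover have "ord u \<noteq> 1" using ord_eq_1[OF uG] u by simp
      ultimately have ou: "ord u = 2" using prime_nat_iff[of 2] by auto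
      have "generate G {u} \<noteq> lcs G 3" using generate_pow_card[OF uG] ou c by auto
      moreover have "generate G {u} \<subseteq> lcs G 3" using u by (intro generate_subset_subgroup[OF M]) simp
      ultimately obtain v where v: "v \<in> lcs G 3" "v \<notin> generate G {u}" by blast
      have iso2: "G\<lparr>carrier := lcs G 3\<rparr> \<cong> integer_mod_group 2 \<times>\<times> integer_mod_group 2"
        by (rule iso_cyclic_times_two[OF M fin_lcs u(1) v(1) ou _ _ v(2) M_sq[OF v(1)] N_comm])
          (use c u v MN in auto)
      show ?thesis using pn cl iso1 iso2 by blast
    qed
  qed
next
  assume R: ?R
  \<comment> \<open>The common core of the second and third condition: order 8, class 4 and
    \<open>gamma_3\<close> of exponent 2. Squares of \<open>N\<close> lie in the index-two subgroup
    \<open>gamma_3\<close>, so \<open>N\<close> has exponent dividing 4 and is not cyclic.\<close>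
  have class_4: ?L if pn: "p = 2" and cl: "nilpotency_class G = 4" and cN: "card (lcs G 2) = 8"
    and M_sq: "\<And>t. t \<in> lcs G 3 \<Longrightarrow> t \<otimes> t = \<one>"
  proof -
    have "(2::nat) ^ n = 2 ^ 3" using card pn cN by simp
    then have n3: "n = 3" by (simp only: power_inject_exp)
    have K2: "CHAR('k) = 2" using K pn by simp
    have l4: "lcs G 4 \<noteq> {\<one>}" using cl nilpotency_class_eq_iff[of 4] by simp
    note c = order_8_class_4_cards[OF pn n3 l4]
    have MN: "lcs G 3 \<subseteq> lcs G 2" using lcs_antimono[of 2 3] by simp
    have "t [^] (4::nat) = \<one>" if t: "t \<in> lcs G 2" for t
    proof -
      have tG: "t \<in> carrier G" using lcs_carrier t by blast
      have "t \<otimes> t \<in> lcs G 3" using index_two_square[OF lcs_subgroup lcs_subgroup MN fin _ t] c cN by simp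
      then have "(t \<otimes> t) \<otimes> (t \<otimes> t) = \<one>" by (rule M_sq)
      then show ?thesis using tG by (simp add: eval_nat_numeral m_assoc)
    qed
    then have nc: "\<not> derived_cyclic G" using cN by (intro not_cyclic_if_exponent[of 4]) auto
    have "lie_zero TYPE('k) G 7" using order_8_third_4(1)[OF pn n3 nc c(1) K2] c(2) by auto
    moreover have "\<not> lie_zero TYPE('k) G 6" by (rule not_lie_zero_order_8_class_4[OF pn n3 nc c K2])
    ultimately show ?thesis using pn n3 by simp
  qed
  from R consider
    (i) "p = 2" "nilpotency_class G = 2" "card (lcs G 2) = 4" "\<not> cyclic_group (G\<lparr>carrier := lcs G 2\<rparr>)"
  | (ii) "p = 2" "nilpotency_class G = 4" "G\<lparr>carrier := lcs G 2\<rparr> \<cong> integer_mod_group 4 \<times>\<times> integer_mod_group 2"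
      "G\<lparr>carrier := lcs G 3\<rparr> \<cong> integer_mod_group 2 \<times>\<times> integer_mod_group 2"
  | (iii) "p = 2" "nilpotency_class G = 4" "card (lcs G 2) = 8" "elementary_abelian (G\<lparr>carrier := lcs G 2\<rparr>) 2"
  | (iv) "p = 3" "nilpotency_class G = 3" "card (lcs G 2) = 9" "elementary_abelian (G\<lparr>carrier := lcs G 2\<rparr>) 3"
    by blast
  then show ?L
  proof cases
    case i
    have "(2::nat) ^ n = 2 ^ 2" using card i by simp
    then have n2: "n = 2" by (simp only: power_inject_exp)
    have l3: "lcs G 3 = {\<one>}" using i nilpotency_class_eq_iff[of 2] by (simp add: eval_nat_numeral)
    have nc: "\<not> derived_cyclic G" using i derived_cyclic_iff by blast
    show ?thesis
      using lie_zero_square_class_2[OF n2 nc l3 K] not_lie_zero_square_class_2[OF i(1) n2 nc l3, where ?'k = 'k] i(1) n2 by simp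
  next
    case ii
    have "card (lcs G 2) = card ({0..<4::int} \<times> {0..<2::int})"
      using iso_same_card[OF ii(3)] by (simp add: carrier_integer_mod_group)
    then have "card (lcs G 2) = 8" by simp
    then show ?thesis using class_4[OF ii(1,2)] iso_klein_four_square[OF lcs_subgroup ii(4)] by blast
  next
    case iii
    have "t \<otimes> t = \<one>" if "t \<in> lcs G 3" for t
    proof -
      have "t \<in> lcs G 2" using that lcs_antimono[of 2 3] by auto
      then have "t [^] (2::nat) = \<one>" using iii(4) elementary_abelian_subgroup_iff[OF lcs_subgroup] by blast
      then show ?thesis using lcs_carrier[OF that] by (simp add: numeral_2_eq_2)
    qed
    then show ?thesis using class_4[OF iii(1-3)] by blast
  next
    case iv
    have "(3::nat) ^ n = 3 ^ 2" using card iv by simp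
    then have n2: "n = 2" by (simp only: power_inject_exp)
    have l3: "lcs G 3 \<noteq> {\<one>}" using iv nilpotency_class_eq_iff[of 3] by simp
    have "t [^] (3::nat) = \<one>" if "t \<in> lcs G 2" for t
      using iv(4) elementary_abelian_subgroup_iff[OF lcs_subgroup] that by blast
    then have nc: "\<not> derived_cyclic G" using iv by (intro not_cyclic_if_exponent[of 3]) auto
    have K3: "CHAR('k) = 3" using K iv by simp
    show ?thesis
      using lie_zero_square_class_3[OF n2 nc l3 K] not_lie_zero_square_class_3_three[OF iv(1) n2 nc l3 K3] iv(1) n2 by simp
  qed
qed

end

text \<open>The equality is stated in the integers, since \<open>|G'| - p + 2\<close> is negative
  for trivial \<open>G'\<close> and large \<open>p\<close>.\<close>

theorem theorem1:
  fixes G :: "('g, 'b) monoid_scheme" and p :: nat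
  assumes "group G"
    and "CHAR('k::field) = p" and "p > 0"
    and "ga_lie_nilpotent TYPE('k) G"
  shows "int (t_L TYPE('k) G) = int (card (derived G (carrier G))) - int p + 2 \<longleftrightarrow>
     ((p = 2 \<and> nilpotency_class G = 2 \<and> card (lcs G 2) = 4
         \<and> \<not> cyclic_group (G\<lparr>carrier := lcs G 2\<rparr>))
    \<or> (p = 2 \<and> nilpotency_class G = 4
         \<and> G\<lparr>carrier := lcs G 2\<rparr> \<cong> integer_mod_group 4 \<times>\<times> integer_mod_group 2
         \<and> G\<lparr>carrier := lcs G 3\<rparr> \<cong> integer_mod_group 2 \<times>\<times> integer_mod_group 2)
    \<or> (p = 2 \<and> nilpotency_class G = 4 \<and> card (lcs G 2) = 8
         \<and> elementary_abelian (G\<lparr>carrier := lcs G 2\<rparr>) 2)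
    \<or> (p = 3 \<and> nilpotency_class G = 3 \<and> card (lcs G 2) = 9
         \<and> elementary_abelian (G\<lparr>carrier := lcs G 2\<rparr>) 3))" (is "?L \<longleftrightarrow> ?R")
proof -
  interpret group G by fact
  have p: "prime p" using prime_CHAR_semidom assms(2,3) by metis
  then have p2: "2 \<le> p" using prime_ge_2_nat by blast
  obtain k0 where k0: "lie_zero TYPE('k) G k0" using assms(4) ga_lie_nilpotent_iff[where ?'k = 'k] by blast
  define k where "k = (LEAST k. lie_zero TYPE('k) G k)"
  have k: "lie_zero TYPE('k) G k" unfolding k_def using k0 by (rule LeastI)
  have k_iff: "lie_zero TYPE('k) G j \<longleftrightarrow> k \<le> j" for j
    using lie_zero_mono[OF k, of j] Least_le[of "lie_zero TYPE('k) G" j] by (auto simp: k_def)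
  have k_pos: "0 < k" using k not_lie_zero_0[where ?'k = 'k] by (auto intro: gr0I)
  have tL: "t_L TYPE('k) G = k + 1" using k k_iff[of "k - 1"] k_pos by (intro t_L_eq) auto
  obtain s where "powers_central G (p ^ s)"
    by (rule lie_zero_imp_central_power[OF k assms(2) p]) (unfold powers_central_def, blast)
  note pc = this
  show ?thesis
  proof (cases "finite (lcs G 2)")
    case False
    \<comment> \<open>The cardinality of an infinite set is 0 by convention. The left side would
      then read \<open>k + 1 = 2 - p\<close>, impossible for \<open>k > 0\<close> and
      \<open>p \<ge> 2\<close>; on the right, every order and isomorphism type is that of a finite
      group.\<close>
    have "card (lcs G 2) = 0" using False by simp
    moreover have "\<not> G\<lparr>carrier := lcs G 2\<rparr> \<cong> integer_mod_group 4 \<times>\<times> integer_mod_group 2"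
      using iso_finite[of "G\<lparr>carrier := lcs G 2\<rparr>" "integer_mod_group 4 \<times>\<times> integer_mod_group 2"] False
      by (auto simp: carrier_integer_mod_group)
    moreover have "\<not> ?L" using \<open>card (lcs G 2) = 0\<close> tL p2 k_pos by (simp add: lcs_2)
    ultimately show ?thesis by simp
  next
    case True
    obtain n where n: "card (lcs G 2) = p ^ n" using derived_p_group[OF is_group True pc p] by blast
    interpret p_derived G p s n by (intro p_derived.intro p_derived_axioms.intro is_group p True pc n)
    have "?L \<longleftrightarrow> 1 \<le> n \<and> lie_zero TYPE('k) G (p ^ n - p + 1) \<and> \<not> lie_zero TYPE('k) G (p ^ n - p)"
    \<comment> \<open>For trivial \<open>N\<close> the left side reads \<open>k + 1 = 3 - p\<close>,
      which is impossible because \<open>k \<ge> 1\<close> and \<open>p \<ge> 2\<close>. For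
      \<open>n \<ge> 1\<close> the integer equation becomes one between natural numbers, as
      \<open>p \<le> p^n\<close>.\<close>
    proof (cases "n = 0")
      case True
      then show ?thesis using tL n p2 k_pos by (simp add: lcs_2)
    next
      case False
      then have "p \<le> p ^ n" using self_le_power[of p n] p2 by simp
      moreover have "?L \<longleftrightarrow> int k + int p = int (p ^ n) + 1"
        using tL n by (auto simp: lcs_2)
      ultimately have eq: "?L \<longleftrightarrow> k = p ^ n - p + 1" by linarith
      have "k = p ^ n - p + 1 \<longleftrightarrow> 1 \<le> n \<and> k \<le> p ^ n - p + 1 \<and> \<not> k \<le> p ^ n - p"
        using False by auto
      then show ?thesis unfolding k_iff eq .
    qed
    then show ?thesis using gap_iff[OF assms(2)] by (simp only:)
  qed
qed

end
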